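(* Let $F=P_{\ell_1}\cup\cdots\cup P_{\ell_k}$ be a linear forest with $k\ge 2$, $\ell_1\ge\cdots\ge\ell_k\ge 2$ and $\ell_i\ne 3$ for all $i$. Let $G$ be an $F$-free connected graph on $n\ge 2|F|$ vertices with minimum degree $\delta(G)\ge\delta_F$. Then $G$ is isomorphic to a subgraph of $G_F(n)$, unless one of the following holds (with $\ell\ge2$ an integer and $t,t_1,t_2$ nonnegative integers): (1) $F\in\{P_{\ell+1}\cup P_\ell,\ 2P_\ell\}$ with $\ell$ even, or $F\in\{P_{\ell+2}\cup P_\ell,\ P_{\ell+1}\cup P_\ell,\ 2P_\ell\cup P_2\}$ with $\ell$ odd, and $G=K_1+tK_{\ell-1}$; (2) $F=2P_\ell$ with $\ell$ odd, and $G$ is isomorphic to a subgraph of $K_1+(t_1K_{\ell-1}\cup t_2K_{\ell-2})$; (3) $F=3P_5$ and $G=K_2+tK_4$ or $G=E_2+tK_4$.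
   Context: $P_m$, $K_m$, $E_m$: path, complete graph, edgeless graph on $m$ vertices; $G\cup H$ disjoint union; $tG$ is $t$ disjoint copies of $G$; $G+H$ is the join (all edges between $V(G)$ and $V(H)$ added to $G\cup H$). $|F|=\sum\ell_i$ and $\delta_F=\sum_{i=1}^k\lfloor \ell_i/2\rfloor-1$. $G_F(n)=K_{\delta_F}+E_{n-\delta_F}$ if some $\ell_i$ is even, and $G_F(n)=K_{\delta_F}+(E_{n-\delta_F-2}\cup K_2)$ if all $\ell_i$ are odd. $F$-free means containing no subgraph isomorphic to $F$. *)

theory Defs
  imports Main
begin

text \<open>Finite simple graphs: a vertex set and a set of 2-element edges.\<close>
type_synonym 'a sgraph = "'a set \<times> 'a set set"

abbreviation verts :: "'a sgraph \<Rightarrow> 'a set" where "verts G \<equiv> fst G"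
abbreviation edges :: "'a sgraph \<Rightarrow> 'a set set" where "edges G \<equiv> snd G"

definition sgraph :: "'a sgraph \<Rightarrow> bool" where
  "sgraph G \<longleftrightarrow> finite (verts G) \<and>
     (\<forall>e\<in>edges G. \<exists>u v. u \<in> verts G \<and> v \<in> verts G \<and> u \<noteq> v \<and> e = {u, v})"

text \<open>H is isomorphic to a subgraph of G.\<close>
definition subgraph_iso :: "'b sgraph \<Rightarrow> 'a sgraph \<Rightarrow> bool" where
  "subgraph_iso H G \<longleftrightarrow> (\<exists>f. inj_on f (verts H) \<and> f ` verts H \<subseteq> verts G \<and>
     (\<forall>u\<in>verts H. \<forall>v\<in>verts H. {u, v} \<in> edges H \<longrightarrow> {f u, f v} \<in> edges G))"

definition graph_iso :: "'a sgraph \<Rightarrow> 'b sgraph \<Rightarrow> bool" where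
  "graph_iso G H \<longleftrightarrow> (\<exists>f. bij_betw f (verts G) (verts H) \<and>
     (\<forall>u\<in>verts G. \<forall>v\<in>verts G. {u, v} \<in> edges G \<longleftrightarrow> {f u, f v} \<in> edges H))"

definition free :: "'b sgraph \<Rightarrow> 'a sgraph \<Rightarrow> bool" where
  "free F G \<longleftrightarrow> \<not> subgraph_iso F G"

definition degree :: "'a sgraph \<Rightarrow> 'a \<Rightarrow> nat" where
  "degree G v = card {u \<in> verts G. {u, v} \<in> edges G}"

definition connected_graph :: "'a sgraph \<Rightarrow> bool" where
  "connected_graph G \<longleftrightarrow> (\<forall>u\<in>verts G. \<forall>v\<in>verts G.
     (u, v) \<in> {(x, y). {x, y} \<in> edges G}\<^sup>*)"

text \<open>Standard graphs and operations.\<close>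
definition complete :: "nat \<Rightarrow> nat sgraph" where
  "complete m = ({0..<m}, {{i, j} | i j. i < m \<and> j < m \<and> i \<noteq> j})"

definition edgeless :: "nat \<Rightarrow> nat sgraph" where
  "edgeless m = ({0..<m}, {})"

definition disj_union :: "'a sgraph \<Rightarrow> 'b sgraph \<Rightarrow> ('a + 'b) sgraph" where
  "disj_union G H = (Inl ` verts G \<union> Inr ` verts H,
     (\<lambda>e. Inl ` e) ` edges G \<union> (\<lambda>e. Inr ` e) ` edges H)"

definition join :: "'a sgraph \<Rightarrow> 'b sgraph \<Rightarrow> ('a + 'b) sgraph" where
  "join G H = (verts (disj_union G H),
     edges (disj_union G H) \<union> {{Inl u, Inr v} | u v. u \<in> verts G \<and> v \<in> verts H})"

text \<open>t disjoint copies of G.\<close>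
definition copies :: "nat \<Rightarrow> 'a sgraph \<Rightarrow> (nat \<times> 'a) sgraph" where
  "copies t G = ({(i, x). i < t \<and> x \<in> verts G},
     {(\<lambda>x. (i, x)) ` e | i e. i < t \<and> e \<in> edges G})"

text \<open>The linear forest P_{l_1} \<union> ... \<union> P_{l_k} for the list ls = [l_1,...,l_k];
  component i is the path (i,0) - (i,1) - ... - (i, l_i - 1).\<close>
definition linear_forest :: "nat list \<Rightarrow> (nat \<times> nat) sgraph" where
  "linear_forest ls = ({(i, j). i < length ls \<and> j < ls ! i},
     {{(i, j), (i, Suc j)} | i j. i < length ls \<and> Suc j < ls ! i})"

definition size_F :: "nat list \<Rightarrow> nat" where
  "size_F ls = sum_list ls"

definition delta_F :: "nat list \<Rightarrow> nat" where
  "delta_F ls = (\<Sum>l\<leftarrow>ls. l div 2) - 1"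

text \<open>G_F(n), split by the two cases of its definition (the types differ).\<close>
definition GF_even :: "nat list \<Rightarrow> nat \<Rightarrow> (nat + nat) sgraph" where
  "GF_even ls n = join (complete (delta_F ls)) (edgeless (n - delta_F ls))"

definition GF_odd :: "nat list \<Rightarrow> nat \<Rightarrow> (nat + (nat + nat)) sgraph" where
  "GF_odd ls n = join (complete (delta_F ls))
                   (disj_union (edgeless (n - delta_F ls - 2)) (complete 2))"

definition subgraph_of_GF :: "'a sgraph \<Rightarrow> nat list \<Rightarrow> nat \<Rightarrow> bool" where
  "subgraph_of_GF G ls n \<longleftrightarrow>
     (if (\<exists>l\<in>set ls. even l) then subgraph_iso G (GF_even ls n)
      else subgraph_iso G (GF_odd ls n))"

end

theory Submission
  imports Defs "HOL-Library.Multiset"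
begin

text \<open>Put \<open>d = \<delta>\<^sub>F\<close> and let \<open>r\<close> be the number of odd components of \<open>F\<close>; then \<open>|F| = 2d + 2 + r\<close>, so an
  \<open>F\<close>-free graph has no path with that many vertices, and \<open>l\<^sub>i \<noteq> 3\<close> gives \<open>k + r \<le> d + 1\<close>.

  If every cycle has fewer than \<open>2d\<close> vertices, Posa rotations at the end of a longest path produce
  blocks (``lobes'') with a cut vertex. Either three long paths leave a common vertex (a spider), which
  packs \<open>F\<close> unless the second component is longer than \<open>d\<close>, or \<open>G\<close> is \<open>K\<^sub>1 + tK\<^sub>d\<close>. The few forests with
  such a long second component give the exceptions (1) and (2).

  Otherwise take a longest cycle \<open>C\<close>. A longest path outside \<open>C\<close> that starts at a neighbour of \<open>C\<close>
  (an ear) with at least two vertices has so many attachments that counting the gaps between them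
  leaves nine parameter tuples; all but one of these yield a copy of \<open>F\<close>, and the remaining one is the
  exception \<open>3P\<^sub>5\<close>. If all such cycles have an independent complement, the neighbourhood \<open>A\<close> of a
  vertex off \<open>C\<close> cuts \<open>C\<close> into blocks of two or three vertices; the blocks of two show that \<open>A\<close> covers
  all edges, and a block of three can occur at most once, and only if all \<open>l\<^sub>i\<close> are odd.\<close>

section \<open>Paths, cycles and packings\<close>

text \<open>Degrees of at least d force a cycle on 2d vertices only when G is 2-connected. Cut
  vertices are the obstacle: short cycles need a treatment of their own, and exceptions (1) and (2)
  are built around a single vertex.

  Nine tuples suffice for the following reason. An ear on q vertices leaves each of its ends at
  least d + 1 - q neighbours on C, while C has at most 2d + 1 + r - q vertices and 2r <= d + 1.
  After a common neighbour of both ends the next attachment is more than q steps away, and for q >=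
  2 all this is compatible only with d <= 5.

  The independent case is an account of hubs. If every second vertex of P_l is placed in A, then P_l
  costs floor(l/2) hubs, so F costs d + 1 while A has d. There is no slack: a piece of path that
  saves a single hub completes F, and the structure of G is what remains when all such pieces are
  forbidden. The remaining ends of the paths are private partners of the hubs; n >= 2|F| makes the
  outside of C larger than C, so that a matching from C misses some outside vertex, whose
  neighbourhood is taken for A.\<close>

locale graph =
  fixes V :: "'a set" and adj :: "'a \<Rightarrow> 'a \<Rightarrow> bool"
  assumes fin: "finite V"
    and adj_sym: "adj x y \<Longrightarrow> adj y x"
    and adj_irrefl: "\<not> adj x x"
    and adj_in: "adj x y \<Longrightarrow> x \<in> V"
begin

lemma adj_commute: "adj x y \<longleftrightarrow> adj y x"
  using adj_sym by blast

lemma adj_in2: "adj x y \<Longrightarrow> y \<in> V"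
  using adj_in adj_sym by blast

definition nb :: "'a \<Rightarrow> 'a set" where
  "nb x = {y. adj x y}"

lemma nb_iff [simp]: "y \<in> nb x \<longleftrightarrow> adj x y"
  by (simp add: nb_def)

lemma finite_nb [simp]: "finite (nb x)"
  using fin by (rule finite_subset[rotated]) (auto intro: adj_in2)

definition pth :: "'a list \<Rightarrow> bool" where
  "pth xs \<longleftrightarrow> distinct xs \<and> set xs \<subseteq> V \<and> successively adj xs"

definition cyc :: "'a list \<Rightarrow> bool" where
  "cyc xs \<longleftrightarrow> 3 \<le> length xs \<and> pth xs \<and> adj (last xs) (hd xs)"

lemma pth_Nil [simp]: "pth []"
  by (simp add: pth_def)

lemma pth_singleton [simp]: "pth [x] \<longleftrightarrow> x \<in> V"
  by (simp add: pth_def)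

lemma pth_append:
  "pth (xs @ ys) \<longleftrightarrow> pth xs \<and> pth ys \<and> set xs \<inter> set ys = {} \<and>
     (xs = [] \<or> ys = [] \<or> adj (last xs) (hd ys))"
  by (auto simp: pth_def successively_append_iff)

lemma pth_Cons:
  "pth (x # xs) \<longleftrightarrow> x \<in> V \<and> x \<notin> set xs \<and> pth xs \<and> (xs = [] \<or> adj x (hd xs))"
  by (auto simp: pth_def successively_Cons)

lemma pth_rev [simp]: "pth (rev xs) \<longleftrightarrow> pth xs"
proof -
  have "successively (\<lambda>x y. adj y x) xs \<longleftrightarrow> successively adj xs"
    by (rule successively_cong) (auto simp: adj_commute)
  then show ?thesis by (simp add: pth_def)
qed

lemma pth_take: "pth xs \<Longrightarrow> pth (take n xs)"
  by (metis append_take_drop_id pth_append)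

lemma pth_drop: "pth xs \<Longrightarrow> pth (drop n xs)"
  by (metis append_take_drop_id pth_append)

lemma pth_length_le: "pth xs \<Longrightarrow> length xs \<le> card V"
  using fin by (metis card_mono distinct_card pth_def)

lemma finite_pths: "finite {xs. pth xs}"
proof (rule finite_subset)
  show "{xs. pth xs} \<subseteq> {xs. set xs \<subseteq> V \<and> length xs \<le> card V}"
    using pth_length_le by (auto simp: pth_def)
  show "finite {xs. set xs \<subseteq> V \<and> length xs \<le> card V}"
    using fin by (rule finite_lists_length_le)
qed

lemma cyc_rotate:
  assumes "cyc (xs @ ys)" shows "cyc (ys @ xs)"
proof (cases "xs = [] \<or> ys = []")
  case True then show ?thesis using assms by auto
next
  case False
  then show ?thesis using assms by (auto simp: cyc_def pth_append)
qed

text \<open>A copy of the linear forest as a list of vertex-disjoint paths. Exact orders lose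
  nothing, since a longer path may be cut; the explicit host set \<open>X\<close> lets disjoint
  regions be packed separately.\<close>

definition packs :: "nat list \<Rightarrow> 'a set \<Rightarrow> bool" where
  "packs ls X \<longleftrightarrow> (\<exists>ps. map length ps = ls \<and> distinct (concat ps) \<and>
     (\<forall>p\<in>set ps. pth p) \<and> set (concat ps) \<subseteq> X)"

lemma packsI:
  "map length ps = ls \<Longrightarrow> distinct (concat ps) \<Longrightarrow> (\<And>p. p \<in> set ps \<Longrightarrow> pth p) \<Longrightarrow>
    set (concat ps) \<subseteq> X \<Longrightarrow> packs ls X"
  unfolding packs_def by (intro exI[of _ ps]) auto

lemma packsE:
  assumes "packs ls X"
  obtains ps where "map length ps = ls" "distinct (concat ps)" "\<And>p. p \<in> set ps \<Longrightarrow> pth p"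
    "set (concat ps) \<subseteq> X"
  using assms that unfolding packs_def by auto

lemma packs_Nil [simp]: "packs [] X"
  by (simp add: packs_def)

lemma packs_mono: "packs ls X \<Longrightarrow> X \<subseteq> Y \<Longrightarrow> packs ls Y"
  unfolding packs_def by blast

lemma packs_append:
  assumes "packs as X" "packs bs Y" "X \<inter> Y = {}"
  shows "packs (as @ bs) (X \<union> Y)"
proof -
  obtain ps where ps: "map length ps = as" "distinct (concat ps)" "\<And>p. p \<in> set ps \<Longrightarrow> pth p"
     "set (concat ps) \<subseteq> X" using assms(1) by (rule packsE) auto
  obtain qs where qs: "map length qs = bs" "distinct (concat qs)"
     "\<And>p. p \<in> set qs \<Longrightarrow> pth p" "set (concat qs) \<subseteq> Y"
    using assms(2) by (rule packsE) auto
  have "set (concat ps) \<inter> set (concat qs) = {}" using ps(4) qs(4) assms(3) by blast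
  then have "distinct (concat (ps @ qs))"
    using ps(2) qs(2) unfolding concat_append distinct_append by blast
  moreover have "set (concat (ps @ qs)) \<subseteq> X \<union> Y"
    using ps(4) qs(4) unfolding concat_append set_append by blast
  ultimately show ?thesis using ps qs by (intro packsI[of "ps @ qs"]) auto
qed

lemma packs_append':
  assumes "packs as X" "packs bs Y" "X \<inter> Y = {}" "X \<union> Y \<subseteq> Z"
  shows "packs (as @ bs) Z"
  using packs_append[OF assms(1-3)] packs_mono assms(4) by blast

text \<open>Consecutive segments of one path serve the components in turn; in particular a path on
  |F| vertices contains F.\<close>

lemma packs_path: "pth p \<Longrightarrow> sum_list as \<le> length p \<Longrightarrow> packs as (set p)"
proof (induction as arbitrary: p)
  case Nil then show ?case by simp
next
  case (Cons a as)
  have "packs as (set (drop a p))"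
    using Cons by (intro Cons.IH) (auto simp: pth_drop)
  moreover have "packs [a] (set (take a p))"
    unfolding packs_def using Cons.prems
    by (intro exI[of _ "[take a p]"]) (auto simp: pth_take, auto simp: pth_def)
  moreover have "set (take a p) \<inter> set (drop a p) = {}"
    using Cons.prems(1) by (simp add: pth_def set_take_disj_set_drop_if_distinct)
  ultimately have "packs ([a] @ as) (set (take a p) \<union> set (drop a p))"
    by (intro packs_append)
  then show ?case by (metis append_Cons append_Nil append_take_drop_id set_append)
qed

lemma packs_Cons:
  assumes "pth p" "l \<le> length p" "packs as Y" "set p \<inter> Y = {}" "set p \<union> Y \<subseteq> Z"
  shows "packs (l # as) Z"
  using packs_append'[OF packs_path[of p "[l]"] assms(3)] assms by auto

lemma packs_move': "packs (l # xs @ ys) X \<Longrightarrow> packs (xs @ l # ys) X"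
proof -
  assume "packs (l # xs @ ys) X"
  then obtain ps where ps: "map length ps = l # xs @ ys" "distinct (concat ps)"
    "\<And>p. p \<in> set ps \<Longrightarrow> pth p" "set (concat ps) \<subseteq> X" by (rule packsE) auto
  then obtain us p vs where "ps = p # us @ vs" "map length us = xs" "length p = l"
     "map length vs = ys" by (auto simp: map_eq_append_conv map_eq_Cons_conv)
  then show ?thesis using ps by (intro packsI[of "us @ p # vs"]) auto
qed

lemma packs_ConsE:
  assumes "packs (l # ls) X"
  obtains p where "pth p" "length p = l" "set p \<subseteq> X" "packs ls (X - set p)"
proof -
  obtain ps where ps: "map length ps = l # ls" "distinct (concat ps)"
    "\<And>p. p \<in> set ps \<Longrightarrow> pth p" "set (concat ps) \<subseteq> X" using assms by (rule packsE) auto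
  then obtain p qs where p: "ps = p # qs" "length p = l" "map length qs = ls"
    by (auto simp: map_eq_Cons_conv)
  have "packs ls (X - set p)" using ps p by (intro packsI[of qs]) auto
  then show ?thesis using that[of p] ps p by auto
qed

lemma packs_perm: "mset as = mset bs \<Longrightarrow> packs as X \<Longrightarrow> packs bs X"
proof (induction as arbitrary: bs X)
  case Nil then show ?case by simp
next
  case (Cons a as)
  then have "a \<in> set bs" by (metis list.set_intros(1) set_mset_mset)
  then obtain us vs where bs: "bs = us @ a # vs" by (meson split_list)
  obtain p where p: "pth p" "length p = a" "set p \<subseteq> X" "packs as (X - set p)"
    using Cons.prems(2) by (rule packs_ConsE)
  have "mset as = mset (us @ vs)" using Cons.prems(1) unfolding bs by simp
  then have "packs (us @ vs) (X - set p)" using p(4) by (rule Cons.IH)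
  then have "packs (a # us @ vs) X"
    by (rule packs_Cons[OF p(1), rotated]) (use p in auto)
  then show ?case unfolding bs by (rule packs_move')
qed

end

lemma graph_of_sgraph:
  assumes "sgraph G" shows "graph (verts G) (\<lambda>x y. {x, y} \<in> edges G)"
proof
  show "finite (verts G)" using assms by (simp add: sgraph_def)
  have *: "x \<noteq> y \<and> x \<in> verts G" if "{x, y} \<in> edges G" for x y
    using assms that unfolding sgraph_def by (metis doubleton_eq_iff)
  show "{y, x} \<in> edges G" if "{x, y} \<in> edges G" for x y using that by (simp add: insert_commute)
  show "{x, x} \<notin> edges G" for x using * by blast
  show "x \<in> verts G" if "{x, y} \<in> edges G" for x y using * that by blast
qed

text \<open>The vertex \<open>(i, j)\<close> of the linear forest goes to the \<open>j\<close>-th vertex of the \<open>i\<close>-th path.\<close>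

lemma packs_imp_subgraph_iso:
  assumes "sgraph G" and "graph.packs (verts G) (\<lambda>x y. {x, y} \<in> edges G) ls (verts G)"
  shows "subgraph_iso (linear_forest ls) G"
proof -
  interpret graph "verts G" "\<lambda>x y. {x, y} \<in> edges G" using assms(1) by (rule graph_of_sgraph)
  obtain ps where ps: "map length ps = ls" "distinct (concat ps)"
     "\<And>p. p \<in> set ps \<Longrightarrow> pth p" "set (concat ps) \<subseteq> verts G" using assms(2) by (rule packsE) auto
  let ?f = "\<lambda>(i, j). ps ! i ! j"
  have len: "length ps = length ls" "\<And>i. i < length ls \<Longrightarrow> length (ps ! i) = ls ! i"
    using ps(1) by auto
  have disj: "set (ps ! i) \<inter> set (ps ! i') = {}" if "i < i'" "i' < length ls" for i i'
  proof -
    have "ps = take i' ps @ ps ! i' # drop (Suc i') ps" using that len by (simp add: id_take_nth_drop)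
    then have "set (concat (take i' ps)) \<inter> set (ps ! i') = {}"
      by (metis concat.simps(2) concat_append distinct_append ps(2)
          set_append Int_Un_distrib sup_eq_bot_iff)
    moreover have "ps ! i \<in> set (take i' ps)" using that len by (auto simp: in_set_conv_nth intro!: exI[of _ i])
    ultimately show ?thesis by auto
  qed
  have "inj_on ?f (verts (linear_forest ls))"
  proof (rule inj_onI)
    fix x y assume x: "x \<in> verts (linear_forest ls)" and y: "y \<in> verts (linear_forest ls)" and eq: "?f x = ?f y"
    obtain i j i' j' where xy: "x = (i, j)" "y = (i', j')" by (cases x, cases y)
    have b: "i < length ls" "j < ls ! i" "i' < length ls" "j' < ls ! i'"
      using x y xy by (auto simp: linear_forest_def)
    have "ps ! i ! j \<in> set (ps ! i)" "ps ! i' ! j' \<in> set (ps ! i')" using b len by auto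
    then have "i = i'" using disj[of i i'] disj[of i' i] b eq xy by (cases i i' rule: linorder_cases) auto
    moreover have "distinct (ps ! i)" using ps(3) b len by (simp add: pth_def)
    ultimately show "x = y" using eq xy b len by (simp add: nth_eq_iff_index_eq)
  qed
  moreover have "?f ` verts (linear_forest ls) \<subseteq> verts G"
  proof -
    have "ps ! i ! j \<in> verts G" if "i < length ls" "j < ls ! i" for i j
      using that len ps(3) unfolding pth_def by (metis nth_mem subsetD)
    then show ?thesis by (auto simp: linear_forest_def)
  qed
  moreover have "{?f u, ?f v} \<in> edges G" if "{u, v} \<in> edges (linear_forest ls)" for u v
  proof -
    obtain i j where e: "{u, v} = {(i, j), (i, Suc j)}" "i < length ls" "Suc j < ls ! i"
      using \<open>{u, v} \<in> edges (linear_forest ls)\<close> by (auto simp: linear_forest_def)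
    have "successively (\<lambda>x y. {x, y} \<in> edges G) (ps ! i)" using ps(3) e len by (simp add: pth_def)
    then have "{ps ! i ! j, ps ! i ! Suc j} \<in> edges G" using e len by (auto dest!: successively_nth[of _ _ j])
    moreover from this have "{ps ! i ! Suc j, ps ! i ! j} \<in> edges G" by (rule adj_sym)
    ultimately show ?thesis using e(1) by (auto simp: doubleton_eq_iff)
  qed
  ultimately show ?thesis unfolding subgraph_iso_def by blast
qed

section \<open>Rotations and lobes\<close>

context graph
begin

text \<open>Posa rotations: if the end of every Hamiltonian path of \<open>zs\<close> starting in \<open>hd zs\<close> sees
  only \<open>zs\<close> and \<open>zs\<close> is short compared with the degrees, then every vertex other than
  \<open>hd zs\<close> is such an end.\<close>

lemma rotation_closed:
  assumes zs: "pth zs" "2 \<le> length zs" "adj (last zs) (hd zs)"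
    and ends: "\<And>zs'. pth zs' \<Longrightarrow> set zs' = set zs \<Longrightarrow> hd zs' = hd zs \<Longrightarrow> nb (last zs') \<subseteq> set zs"
    and deg: "\<And>x. x \<in> V \<Longrightarrow> d \<le> card (nb x)"
    and short: "length zs < 2 * d \<or> length zs = 2"
    and x: "x \<in> set (tl zs)"
  shows "nb x \<subseteq> set zs"
proof -
  define Q where "Q = {u. \<exists>zs'. pth zs' \<and> set zs' = set zs \<and> hd zs' = hd zs \<and> last zs' = u}"
  have QI: "last zs' \<in> Q" if "pth zs'" "set zs' = set zs" "hd zs' = hd zs" for zs'
    using that by (auto simp: Q_def)
  have Qnb: "nb u \<subseteq> set zs" if "u \<in> Q" for u using that ends by (auto simp: Q_def)
  have dz: "distinct zs" and zV: "set zs \<subseteq> V" using zs(1) by (auto simp: pth_def)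
  define g where "g = length zs - 1"
  have len: "length zs = Suc g" "1 \<le> g" using zs(2) by (auto simp: g_def)
  have zne: "zs \<noteq> []" using zs(2) by auto
  have lastz: "last zs = zs ! g" using zne by (simp add: g_def last_conv_nth)
  have hdz: "hd zs = zs ! 0" using zne by (simp add: hd_conv_nth)
  have all: "zs ! t \<in> Q" if "1 \<le> t" "t \<le> g" for t
    using that
  proof (induction t rule: less_induct)
    \<comment> \<open>Strong induction replaces the choice of the smallest index whose vertex is not
      an end: its predecessor \<open>f\<close> is an end, and so is the last vertex
      \<open>e\<close>.\<close>
    case (less t)
    show ?case
    proof (rule ccontr)
      assume nQ: "zs ! t \<notin> Q"
      obtain h zt where zc: "zs = h # zt" using zne by (cases zs) auto
      have ztne: "zt \<noteq> []" using len zc by auto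
      \<comment> \<open>The closing edge between \<open>last zs\<close> and \<open>hd zs\<close>
        lets the path run round the other way, so index 1 is always an end.\<close>
      have "pth (h # rev zt)" using zs(1,3) zc ztne
        by (auto simp: pth_Cons hd_rev adj_commute)
      then have "last (h # rev zt) \<in> Q" by (rule QI) (auto simp: zc)
      then have "zs ! 1 \<in> Q" using ztne zc by (simp add: last_rev hd_conv_nth)
      then have t2: "2 \<le> t" using nQ less.prems by (cases "t = 1") auto
      have fQ: "zs ! (t - 1) \<in> Q" using less t2 by auto
      have eQ: "zs ! g \<in> Q" using QI[OF zs(1)] lastz by simp
      have tg: "t < g" using nQ eQ less.prems by (cases "t = g") auto
      define f where "f = zs ! (t - 1)"
      define e where "e = zs ! g"
      have eV: "e \<in> V" "f \<in> V" using zV len tg by (auto simp: e_def f_def)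
      have split: "zs = take (t - 1) zs @ [f] @ drop t zs"
        using t2 tg len id_take_nth_drop[of "t - 1" zs] by (simp add: f_def)
      have setz: "set zs = set (take (t - 1) zs) \<union> {f} \<union> set (drop t zs)"
        using arg_cong[OF split, of set] by auto
      have A: "take (t - 1) zs \<noteq> []" "hd (take (t - 1) zs) = hd zs" using t2 zne by auto
      have B: "drop t zs \<noteq> []" "hd (drop t zs) = zs ! t" "last (drop t zs) = e"
        using tg len by (auto simp: hd_drop_conv_nth e_def lastz)
      have pA: "pth (take (t - 1) zs @ [f])" "pth (drop t zs)" "set (take (t - 1) zs @ [f]) \<inter> set (drop t zs) = {}"
        using zs(1) split by (metis append.assoc pth_append)+
      \<comment> \<open>Otherwise reversing the part from index \<open>t\<close> on would make
        \<open>zs ! t\<close> the end.\<close>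
      have ef: "\<not> adj e f"
      proof
        assume "adj e f"
        then have p: "pth ((take (t - 1) zs @ [f]) @ rev (drop t zs))"
          using pA B by (subst pth_append) (auto simp: hd_rev adj_commute)
        have "last ((take (t - 1) zs @ [f]) @ rev (drop t zs)) \<in> Q"
          by (rule QI[OF p]) (use A setz in auto)
        then show False using nQ B by (simp add: last_rev)
      qed
      \<comment> \<open>Otherwise the route goes up to \<open>f\<close>, jumps to index
        \<open>Suc i\<close>, runs on to \<open>e\<close>, crosses to index \<open>i\<close> and
        walks down to \<open>zs ! t\<close>.\<close>
      have no_up: "\<not> adj f (zs ! Suc i)" if i: "t \<le> i" "i < g" "adj e (zs ! i)" for i
      proof
        assume a: "adj f (zs ! Suc i)"
        define B1 where "B1 = take (Suc i - t) (drop t zs)"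
        define C where "C = drop (Suc i) zs"
        have BC: "drop t zs = B1 @ C" unfolding B1_def C_def using i
          by (metis append_take_drop_id drop_drop le_SucI le_add_diff_inverse2)
        have B1: "B1 \<noteq> []" "hd B1 = zs ! t" "last B1 = zs ! i"
          using i len by (auto simp: B1_def hd_drop_conv_nth last_conv_nth)
        have C: "C \<noteq> []" "hd C = zs ! Suc i" "last C = e"
          using i len by (auto simp: C_def hd_drop_conv_nth e_def lastz)
        have pB: "pth B1" "pth C" "set B1 \<inter> set C = {}" using pA(2) BC by (auto simp: pth_append)
        have p: "pth ((take (t - 1) zs @ [f]) @ C @ rev B1)"
          using pA pB B1 C a i BC
          by (subst pth_append, subst pth_append) (auto simp: hd_rev adj_commute)
        have "last ((take (t - 1) zs @ [f]) @ C @ rev B1) \<in> Q"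
        proof (rule QI[OF p])
          show "set ((take (t - 1) zs @ [f]) @ C @ rev B1) = set zs"
            using setz BC by auto
          show "hd ((take (t - 1) zs @ [f]) @ C @ rev B1) = hd zs" using A by auto
        qed
        then show False using nQ B1 by (simp add: last_rev)
      qed
      \<comment> \<open>Otherwise the route leaves index \<open>i - 1\<close> for \<open>f\<close>,
        walks down to index \<open>i\<close>, crosses to \<open>e\<close> and walks down again to
        \<open>zs ! t\<close>.\<close>
      have no_down: "\<not> adj f (zs ! (i - 1))" if i: "1 \<le> i" "i \<le> t - 2" "adj e (zs ! i)" for i
      proof
        assume a: "adj f (zs ! (i - 1))"
        define A1 where "A1 = take i zs"
        define A2 where "A2 = drop i (take (t - 1) zs)"
        have AA: "take (t - 1) zs = A1 @ A2" unfolding A1_def A2_def using i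
          by (metis append_take_drop_id diff_le_mono2 le_trans min.absorb1 one_le_numeral take_take)
        have A1: "A1 \<noteq> []" "hd A1 = hd zs" "last A1 = zs ! (i - 1)"
          using i len tg zne by (auto simp: A1_def last_conv_nth min_def)
        have A2: "A2 \<noteq> []" "hd A2 = zs ! i" using i len tg t2
          by (auto simp: A2_def hd_drop_conv_nth)
        have pAA: "pth A1" "pth A2" "set A1 \<inter> set A2 = {}" "adj (last A2) f" "f \<notin> set A1" "f \<notin> set A2"
          using pA(1) A2 unfolding AA by (auto simp: pth_append)
        have p: "pth (A1 @ [f] @ rev A2 @ rev (drop t zs))"
          using pA pAA B A1 A2 a i eV unfolding AA
          by (subst pth_append, subst pth_append, subst pth_append) (auto simp: hd_rev last_rev adj_commute)
        have "last (A1 @ [f] @ rev A2 @ rev (drop t zs)) \<in> Q"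
        proof (rule QI[OF p])
          show "set (A1 @ [f] @ rev A2 @ rev (drop t zs)) = set zs"
            using setz AA by auto
          show "hd (A1 @ [f] @ rev A2 @ rev (drop t zs)) = hd zs" using A1 by auto
        qed
        then show False using nQ B by (simp add: last_rev)
      qed
      \<comment> \<open>The neighbours of \<open>e\<close> are shifted by one, upwards from index
        \<open>t\<close> on and downwards below it, so that they miss those of \<open>f\<close> and
        also index \<open>t - 1\<close>. Index 0 stays out of \<open>J\<close> since nothing lies
        below it; this costs one in the count.\<close>
      define I where "I = {i. i \<le> g \<and> adj f (zs ! i)}"
      define J where "J = {i. 1 \<le> i \<and> i \<le> g \<and> adj e (zs ! i)}"
      define phi where "phi = (\<lambda>i. if t \<le> i then Suc i else i - 1)"
      have fin': "finite I" "finite J" by (auto simp: I_def J_def)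
      have nbI: "nb f = (\<lambda>i. zs ! i) ` I"
        using Qnb[OF fQ] len by (force simp: I_def f_def in_set_conv_nth less_Suc_eq_le)
      have cI: "d \<le> card I" using deg[OF eV(2)] card_image_le[OF fin'(1), of "\<lambda>i. zs ! i"] nbI by simp
      have nbJ: "nb e \<subseteq> insert (zs ! 0) ((\<lambda>i. zs ! i) ` J)"
      proof
        fix y assume "y \<in> nb e"
        then obtain i where "i \<le> g" "y = zs ! i" "adj e y"
          using Qnb[OF eQ] len by (auto simp: e_def in_set_conv_nth less_Suc_eq_le subset_iff)
        then show "y \<in> insert (zs ! 0) ((\<lambda>i. zs ! i) ` J)" by (cases "i = 0") (auto simp: J_def)
      qed
      have "d \<le> Suc (card J)"
      proof -
        have "d \<le> card (nb e)" using deg eV by blast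
        also have "\<dots> \<le> card (insert (zs ! 0) ((\<lambda>i. zs ! i) ` J))" using nbJ fin' by (intro card_mono) auto
        also have "\<dots> \<le> Suc (card ((\<lambda>i. zs ! i) ` J))" by (rule card_insert_le_m1) auto
        also have "\<dots> \<le> Suc (card J)" using card_image_le[OF fin'(2)] by auto
        finally show ?thesis .
      qed
      have Jp: "i \<noteq> g \<and> i \<noteq> t - 1" if "i \<in> J" for i
        using that adj_irrefl ef by (auto simp: J_def e_def f_def)
      have inj: "inj_on phi J"
      proof (rule inj_onI)
        fix i j assume "i \<in> J" "j \<in> J" "phi i = phi j"
        then show "i = j" using Jp[of i] Jp[of j] by (auto simp: phi_def J_def split: if_splits)
      qed
      have disj: "phi ` J \<inter> I = {}"
      proof -
        have "phi i \<notin> I" if "i \<in> J" for i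
        proof (cases "t \<le> i")
          case True
          then show ?thesis using that Jp[OF that] no_up[of i] by (auto simp: phi_def J_def I_def)
        next
          case False
          then have "i \<le> t - 2" using Jp[OF that] by linarith
          then show ?thesis using that False no_down[of i] by (auto simp: phi_def J_def I_def)
        qed
        then show ?thesis by blast
      qed
      have sub: "phi ` J \<union> I \<subseteq> {0..g} - {t - 1}"
      proof -
        have "phi i \<in> {0..g} - {t - 1}" if "i \<in> J" for i
          using that Jp[OF that] by (auto simp: phi_def J_def split: if_splits)
        moreover have "t - 1 \<notin> I" using adj_irrefl by (auto simp: I_def f_def)
        ultimately show ?thesis by (auto simp: I_def)
      qed
      have "card (phi ` J) + card I \<le> card ({0..g} - {t - 1})"
        using card_mono[OF _ sub] disj fin' by (simp add: card_Un_disjoint)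
      also have "\<dots> = g" using tg by simp
      finally have "card J + card I \<le> g" using card_image[OF inj] by simp
      then have "2 * d \<le> Suc g" using cI \<open>d \<le> Suc (card J)\<close> by linarith
      then show False using short len t2 tg by auto
    qed
  qed
  obtain i where "x = tl zs ! i" "i < length (tl zs)" using x by (auto simp: in_set_conv_nth)
  then have "x = zs ! Suc i" "Suc i \<le> g" using len by (auto simp: nth_tl)
  then show ?thesis using all[of "Suc i"] Qnb by auto
qed

text \<open>Each pair of consecutive entries contributes at most one element, and an unpaired last
  entry one more; the induction removes entries in pairs.\<close>

lemma card_nonconsecutive:
  assumes "distinct xs" "S \<subseteq> set xs" "successively (\<lambda>a b. \<not> (a \<in> S \<and> b \<in> S)) xs"
  shows "2 * card S \<le> Suc (length xs)"
  using assms
proof (induction xs arbitrary: S rule: induct_list012)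
  case 1 then show ?case by simp
next
  case (2 x)
  then have "card S \<le> card {x}" by (intro card_mono) auto
  then show ?case by simp
next
  case (3 x y zs)
  let ?T = "S - {x, y}"
  have fS: "finite S" using 3(4) finite_subset by blast
  have "successively (\<lambda>a b. \<not> (a \<in> ?T \<and> b \<in> ?T)) zs"
    using 3(5) by (auto simp: successively_Cons elim!: successively_mono)
  then have "2 * card ?T \<le> Suc (length zs)" using 3 by (intro 3(1)) auto
  moreover have "card S \<le> Suc (card ?T)"
  proof -
    have "x \<notin> S \<or> y \<notin> S" using 3(5) by auto
    then obtain u where "S \<subseteq> insert u ?T" by auto
    then have "card S \<le> card (insert u ?T)" using fS by (intro card_mono) auto
    also have "\<dots> \<le> Suc (card ?T)" by (rule card_insert_le_m1) (use fS in auto)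
    finally show ?thesis .
  qed
  ultimately show ?case by simp
qed

text \<open>A subdivided claw with legs of at least \<open>a\<close>, \<open>b\<close>,
  \<open>c\<close> vertices, the centre not counted. Two legs joined through the centre give a path
  on \<open>a + b + 1\<close> vertices beside the third leg.\<close>

definition spider :: "nat \<Rightarrow> nat \<Rightarrow> nat \<Rightarrow> bool" where
  "spider a b c \<longleftrightarrow> (\<exists>u p1 p2 p3. distinct (u # p1 @ p2 @ p3) \<and> pth (u # p1) \<and> pth (u # p2) \<and> pth (u # p3) \<and>
     a \<le> length p1 \<and> b \<le> length p2 \<and> c \<le> length p3)"

lemma spiderI:
  assumes "pth (u # p1)" "pth (u # p2)" "pth (u # p3)"
    "set p1 \<inter> set p2 = {}" "set p1 \<inter> set p3 = {}" "set p2 \<inter> set p3 = {}"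
    "a \<le> length p1" "b \<le> length p2" "c \<le> length p3"
  shows "spider a b c"
  unfolding spider_def using assms by (intro exI[of _ u] exI[of _ p1] exI[of _ p2] exI[of _ p3]) (auto simp: pth_def)

end

section \<open>Cut vertices and lobes when all cycles are short\<close>

locale mgraph = graph +
  fixes d :: nat
  assumes deg: "x \<in> V \<Longrightarrow> d \<le> card (nb x)"
    and d_pos: "1 \<le> d"
    and conn: "x \<in> V \<Longrightarrow> y \<in> V \<Longrightarrow> (x, y) \<in> {(x, y). adj x y}\<^sup>*"
begin

lemma conn_cut:
  assumes "X \<subseteq> V" "X \<noteq> {}" "X \<noteq> V"
  obtains x y where "x \<in> X" "y \<in> V" "y \<notin> X" "adj x y"
proof -
  obtain a b where ab: "a \<in> X" "b \<in> V" "b \<notin> X" using assms by blast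
  have "(a, b) \<in> {(x, y). adj x y}\<^sup>*" using conn ab assms(1) by blast
  then have "b \<in> X \<or> (\<exists>x y. x \<in> X \<and> y \<in> V \<and> y \<notin> X \<and> adj x y)"
  proof (induction rule: rtrancl_induct)
    case base then show ?case using ab by simp
  next
    case (step y z) then show ?case using adj_in2 by auto
  qed
  then show ?thesis using ab that by blast
qed

text \<open>In other words, \<open>D\<close> is a union of components of G - w.\<close>

definition closed_at :: "'a \<Rightarrow> 'a set \<Rightarrow> bool" where
  "closed_at w D \<longleftrightarrow> w \<in> V \<and> D \<subseteq> V - {w} \<and> (\<forall>x\<in>D. nb x \<subseteq> insert w D)"

text \<open>A component of G - w with a Hamiltonian path of it that starts next to \<open>w\<close>.
  The upper bound is \<open>2 * d - 1\<close> and not \<open>2 * d - 2\<close> because for d = 1 a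
  pendant vertex counts as a lobe.\<close>

definition lobe :: "'a \<Rightarrow> 'a list \<Rightarrow> bool" where
  "lobe w L \<longleftrightarrow> pth (w # L) \<and> closed_at w (set L) \<and> d \<le> length L \<and> length L \<le> 2 * d - 1"

lemma closed_atD: "closed_at w D \<Longrightarrow> x \<in> D \<Longrightarrow> adj x y \<Longrightarrow> y = w \<or> y \<in> D"
  unfolding closed_at_def by (metis insertE nb_iff subsetD)

lemma closed_at_diff:
  assumes "closed_at w D" "closed_at w D'" shows "closed_at w (D - D')"
proof -
  have "y = w \<or> y \<in> D - D'" if "x \<in> D - D'" "adj x y" for x y
    using closed_atD[OF assms(1), of x y] closed_atD[OF assms(2), of y x] that assms adj_sym
    by (auto simp: closed_at_def)
  then have "\<forall>x\<in>D - D'. nb x \<subseteq> insert w (D - D')" by (metis insertCI nb_iff subsetI)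
  moreover have "w \<in> V" "D - D' \<subseteq> V - {w}" using assms by (auto simp: closed_at_def)
  ultimately show ?thesis unfolding closed_at_def by blast
qed

lemma closed_at_all: "w \<in> V \<Longrightarrow> closed_at w (V - {w})"
  using adj_in2 by (auto simp: closed_at_def)

text \<open>Take a longest path from \<open>r\<close> into \<open>D\<close> and, among those, one
  whose last vertex sees back as far as possible. The part from that earliest neighbour on is an
  edge or a cycle of length below 2d, so \<open>rotation_closed\<close> shuts it off from the
  rest.\<close>

lemma lobe_exists:
  assumes no_long: "\<And>cs. cyc cs \<Longrightarrow> length cs < 2 * d"
    and D: "closed_at r D" "D \<noteq> {}"
  obtains us L where "pth (us @ L)" "us \<noteq> []" "hd us = r" "set (tl us) \<subseteq> D" "set L \<subseteq> D" "lobe (last us) L"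
proof -
  have rV: "r \<in> V" "r \<notin> D" "D \<subseteq> V" using D by (auto simp: closed_at_def)
  obtain x0 y0 where "x0 \<in> D" "y0 \<notin> D" "adj x0 y0"
    using conn_cut[of D] rV D(2) by metis
  moreover from this have "y0 \<in> insert r D" using D(1) unfolding closed_at_def by (metis nb_iff subsetD)
  ultimately have x0: "x0 \<in> D" "adj r x0" by (auto intro: adj_sym)
  define P where "P = {p. pth p \<and> p \<noteq> [] \<and> hd p = r \<and> set (tl p) \<subseteq> D}"
  have finP: "finite P" unfolding P_def by (rule finite_subset[OF _ finite_pths]) auto
  have P0: "[r, x0] \<in> P" using x0 rV adj_irrefl by (auto simp: P_def pth_Cons)
  define N where "N = Max (length ` P)"
  have Nmax: "length p \<le> N" if "p \<in> P" for p using that finP by (simp add: N_def)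
  have "N \<in> length ` P" using finP P0 unfolding N_def by (intro Max_in) auto
  then obtain p0 where p0: "p0 \<in> P" "length p0 = N" by auto
  have N2: "2 \<le> N" using Nmax[OF P0] by simp
  have endnb: "nb (last p) \<subseteq> set p" if p: "p \<in> P" "length p = N" for p
  proof
    fix y assume y: "y \<in> nb (last p)"
    obtain z zs where pc: "p = z # zs" using p N2 by (cases p) auto
    have zs: "zs \<noteq> []" "last p \<in> set zs" using p pc N2 by auto
    then have lD: "last p \<in> D" using p pc by (auto simp: P_def)
    show "y \<in> set p"
    proof (rule ccontr)
      assume n: "y \<notin> set p"
      have "hd p = r" using p by (simp add: P_def)
      then have "y \<noteq> r" using n pc by auto
      then have yD: "y \<in> D" using closed_atD[OF D(1) lD] y by auto
      have "pth (p @ [y])" using p n y yD rV by (auto simp: P_def pth_append)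
      then have "p @ [y] \<in> P" using p yD pc by (auto simp: P_def)
      then show False using Nmax p by fastforce
    qed
  qed
  \<comment> \<open>Position of the earliest neighbour of the last vertex; its minimality keeps the
    neighbours of every rotated end inside the tail.\<close>
  define k where "k = (\<lambda>p. LEAST i. adj (last p) (p ! i))"
  obtain p where p: "p \<in> P" "length p = N" and kmin: "\<And>p'. p' \<in> P \<Longrightarrow> length p' = N \<Longrightarrow> k p \<le> k p'"
    using ex_has_least_nat[of "\<lambda>p. p \<in> P \<and> length p = N" p0 k] p0 by blast
  have pne: "p \<noteq> []" "hd p = r" "pth p" "set (tl p) \<subseteq> D" using p by (auto simp: P_def)
  define e where "e = last p"
  have eV: "e \<in> V" using pne by (auto simp: pth_def e_def)
  have "nb e \<noteq> {}" using deg[OF eV] d_pos by auto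
  then obtain y where y: "adj e y" by auto
  then have "y \<in> set p" using endnb[OF p] by (auto simp: e_def)
  then obtain i0 where i0: "i0 < N" "p ! i0 = y" using p by (auto simp: in_set_conv_nth)
  define j where "j = k p"
  have j: "adj e (p ! j)" "j \<le> i0"
    using y i0 LeastI[of "\<lambda>i. adj e (p ! i)" i0] Least_le[of "\<lambda>i. adj e (p ! i)" i0] by (auto simp: j_def k_def e_def)
  have jless: "\<not> adj e (p ! i)" if "i < j" for i
    using not_less_Least[of i "\<lambda>i. adj e (p ! i)"] that by (simp add: j_def k_def e_def)
  have e_nth: "e = p ! (N - 1)" using pne p by (simp add: e_def last_conv_nth)
  have jN: "j < N - 1"
  proof -
    have "j \<noteq> N - 1" using j(1) e_nth adj_irrefl by auto
    then show ?thesis using j(2) i0(1) by simp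
  qed
  define us where "us = take j p"
  define zs where "zs = drop j p"
  have pz: "p = us @ zs" by (simp add: us_def zs_def)
  have zlen: "length zs = N - j" "2 \<le> length zs" using p jN by (auto simp: zs_def)
  have zne: "zs \<noteq> []" using zlen by auto
  have zhd: "hd zs = p ! j" using jN p by (simp add: zs_def hd_drop_conv_nth)
  have zlast: "last zs = e" using zne by (simp add: pz e_def)
  have pthz: "pth zs" using pne(3) pz by (simp add: pth_append)
  \<comment> \<open>Rotating the tail gives a path of the same maximal length, so all neighbours of
    the new end lie on the path, and none lies before position \<open>j\<close> by the choice of
    \<open>p\<close>.\<close>
  have ends: "nb (last zs') \<subseteq> set zs" if z': "pth zs'" "set zs' = set zs" "hd zs' = hd zs" for zs'
  proof -
    have z'ne: "zs' \<noteq> []" using z' zne by auto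
    have len': "length zs' = length zs" using z' pthz by (metis distinct_card pth_def)
    have "pth (us @ zs')" using pne(3) z' zne z'ne unfolding pz by (auto simp: pth_append)
    moreover have "hd (us @ zs') = r" using pne(2) z' zne z'ne unfolding pz by (cases us) auto
    moreover have "set (tl (us @ zs')) \<subseteq> D"
    proof -
      have "distinct (us @ zs')" using \<open>pth (us @ zs')\<close> by (simp add: pth_def)
      moreover have "set (us @ zs') = set p" using z' pz by simp
      moreover have "distinct p" using pne by (simp add: pth_def)
      ultimately have "set (tl (us @ zs')) = set (tl p)"
        using pne(1,2) \<open>hd (us @ zs') = r\<close> z'ne
        by (metis Diff_insert_absorb append_is_Nil_conv distinct.simps(2) list.collapse list.simps(15))
      then show ?thesis using pne(4) by simp
    qed
    ultimately have P': "us @ zs' \<in> P" "length (us @ zs') = N"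
      using z'ne len' p pz by (auto simp: P_def)
    have sub: "nb (last zs') \<subseteq> set us \<union> set zs" using endnb[OF P'] z'ne z' by auto
    have "x \<in> set zs" if x: "adj (last zs') x" for x
    proof (rule ccontr)
      assume "x \<notin> set zs"
      then have "x \<in> set us" using sub x by auto
      then obtain i where i: "i < length us" "us ! i = x" by (auto simp: in_set_conv_nth)
      have "k (us @ zs') \<le> i" unfolding k_def
        by (rule Least_le) (use i x z'ne in \<open>auto simp: nth_append\<close>)
      then show False using kmin[OF P'] i p jN unfolding j_def us_def by auto
    qed
    then show ?thesis by auto
  qed
  have short: "length zs < 2 * d \<or> length zs = 2"
  proof (cases "length zs = 2")
    case False
    then have "cyc zs" using zlen pthz j(1) zhd zlast by (auto simp: cyc_def)
    then show ?thesis using no_long by blast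
  qed simp
  have closed: "nb x \<subseteq> set zs" if "x \<in> set (tl zs)" for x
    by (rule rotation_closed[OF pthz zlen(2) _ ends deg short that]) (use j(1) zhd zlast in auto)
  obtain w L where zc: "zs = w # L" using zne by (cases zs) auto
  have Lne: "L \<noteq> []" using zlen zc by auto
  have dL: "d \<le> length L"
  proof -
    have "nb e \<subseteq> set zs - {e}" using ends[OF pthz] zlast adj_irrefl by auto
    then have "d \<le> card (set zs - {e})" using deg[OF eV] card_mono[of "set zs - {e}" "nb e"] by simp
    also have "\<dots> = length zs - 1"
    proof -
      have "e \<in> set zs" using zlast zne last_in_set by blast
      moreover have "card (set zs) = length zs" using pthz by (simp add: pth_def distinct_card)
      ultimately show ?thesis by (simp add: card_Diff_singleton)
    qed
    finally show ?thesis using zc by simp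
  qed
  have LD: "set L \<subseteq> D" "set (tl (us @ [w])) \<subseteq> D" using pne(4) unfolding pz zc by (cases us; auto)+
  have "lobe w L"
    unfolding lobe_def closed_at_def
    using pthz dL short closed zc d_pos by (auto simp: pth_Cons) (auto simp: pth_def)
  moreover have "pth ((us @ [w]) @ L)" using pne(3) pz zc by simp
  moreover have "hd (us @ [w]) = r" using pne(2) pz zc by (cases us) auto
  ultimately show ?thesis using that[of "us @ [w]" L] LD by auto
qed


text \<open>Every component of G - v is a clique on \<open>d\<close> vertices joined completely to
  \<open>v\<close>: the graph K_1 + tK_d.\<close>

definition clique_star :: "'a \<Rightarrow> bool" where
  "clique_star v \<longleftrightarrow> v \<in> V \<and> (\<forall>x\<in>V - {v}. \<exists>K. x \<in> K \<and> K \<subseteq> V - {v} \<and> card K = d \<and>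
     (\<forall>y\<in>K. nb y = insert v (K - {y})))"

definition comp_avoiding :: "'a \<Rightarrow> 'a \<Rightarrow> 'a set" where
  "comp_avoiding v x = {y. (x, y) \<in> {(a, b). adj a b \<and> a \<noteq> v \<and> b \<noteq> v}\<^sup>*}"

lemma comp_avoiding_self: "x \<in> comp_avoiding v x"
  by (simp add: comp_avoiding_def)

lemma comp_avoiding_closed:
  assumes "v \<in> V" "x \<in> V" "x \<noteq> v" shows "closed_at v (comp_avoiding v x)"
proof -
  have "y \<in> V - {v}" if "y \<in> comp_avoiding v x" for y
    using that unfolding comp_avoiding_def mem_Collect_eq
    by (induction rule: rtrancl_induct) (use assms adj_in2 in auto)
  moreover have "z \<in> insert v (comp_avoiding v x)" if "y \<in> comp_avoiding v x" "adj y z" for y z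
  proof (cases "z = v")
    case False
    have "y \<noteq> v" using calculation that by blast
    then show ?thesis using that False unfolding comp_avoiding_def
      by (auto intro: rtrancl.rtrancl_into_rtrancl)
  qed simp
  ultimately show ?thesis using assms unfolding closed_at_def by (metis nb_iff subsetI)
qed

lemma comp_avoiding_least:
  assumes "closed_at v D" "D \<inter> comp_avoiding v x \<noteq> {}"
  shows "comp_avoiding v x \<subseteq> D"
proof -
  let ?R = "{(a, b). adj a b \<and> a \<noteq> v \<and> b \<noteq> v}"
  have sym: "sym ?R" using adj_sym by (auto simp: sym_def)
  obtain z where z: "z \<in> D" "(x, z) \<in> ?R\<^sup>*" using assms(2) by (auto simp: comp_avoiding_def)
  have "y \<in> D" if "(x, y) \<in> ?R\<^sup>*" for y
  proof -
    have "(z, y) \<in> ?R\<^sup>*" using z(2) that sym_rtrancl[OF sym] by (meson rtrancl_trans symD)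
    then show ?thesis
    proof (induction rule: rtrancl_induct)
      case base then show ?case using z by simp
    next
      case (step a b) then show ?case using closed_atD[OF assms(1), of a b] by auto
    qed
  qed
  then show ?thesis by (auto simp: comp_avoiding_def)
qed

lemma lobe_eq_comp:
  assumes "lobe v L" "x \<in> V" "x \<noteq> v" "set L \<subseteq> comp_avoiding v x"
  shows "set L = comp_avoiding v x"
proof -
  have "L \<noteq> []" using assms(1) d_pos by (auto simp: lobe_def)
  then have "set L \<inter> comp_avoiding v x \<noteq> {}" using assms(4) by (cases L) auto
  moreover have "closed_at v (set L)" using assms(1) by (simp add: lobe_def)
  ultimately show ?thesis using comp_avoiding_least assms(4) by blast
qed

text \<open>A vertex of \<open>K\<close> has at least \<open>d\<close> neighbours and only
  \<open>d\<close> candidates for them: \<open>v\<close> and the other \<open>d - 1\<close>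
  vertices.\<close>

lemma small_comp_clique:
  assumes "closed_at v K" "card K = d" "y \<in> K"
  shows "nb y = insert v (K - {y})"
proof (rule card_subset_eq)
  have fK: "finite K" using assms(2) d_pos by (metis card.infinite not_one_le_zero)
  show "finite (insert v (K - {y}))" using fK by simp
  show "nb y \<subseteq> insert v (K - {y})" 
    using closed_atD[OF assms(1,3)] adj_irrefl unfolding nb_def by blast
  have "v \<notin> K" "y \<in> V" using assms by (auto simp: closed_at_def)
  then have "card (insert v (K - {y})) = d" using fK assms(2,3) d_pos by simp
  then show "card (nb y) = card (insert v (K - {y}))"
    using deg[of y] \<open>y \<in> V\<close> card_mono[OF \<open>finite (insert v (K - {y}))\<close> \<open>nb y \<subseteq> _\<close>] by simp
qed

text \<open>Join the lobes by a longest path \<open>Q\<close>. The path through \<open>L1\<close>,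
  \<open>Q\<close>, \<open>L2\<close> is too short to use all vertices, and whatever lies outside
  hangs on \<open>Q\<close>; a longest path \<open>zs\<close> hanging there turns out to have
  \<open>d\<close> vertices and becomes the third leg.\<close>

lemma spider_of_two_lobes:
  assumes bound: "\<And>p. pth p \<Longrightarrow> length p < 2 * d + 2 + r"
    and r: "2 * r \<le> d + 1"
    and n: "2 * d + 2 + r \<le> card V"
    and L1: "lobe v L1" and L2: "lobe w L2" and vw: "v \<noteq> w" and disj: "set L1 \<inter> set L2 = {}"
    and Q0: "pth Q0" "Q0 \<noteq> []" "hd Q0 = v" "last Q0 = w" "set Q0 \<inter> (set L1 \<union> set L2) = {}"
  shows "spider d d (d + 1)"
proof -
  define P where "P = {q. pth q \<and> q \<noteq> [] \<and> hd q = v \<and> last q = w \<and> set q \<inter> (set L1 \<union> set L2) = {}}"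
  have finP: "finite P" unfolding P_def by (rule finite_subset[OF _ finite_pths]) auto
  have "Q0 \<in> P" using Q0 by (simp add: P_def)
  then have "Max (length ` P) \<in> length ` P" using finP by (intro Max_in) auto
  then obtain Q where Q: "Q \<in> P" "length Q = Max (length ` P)" by auto
  have Qmax: "length q \<le> length Q" if "q \<in> P" for q using that finP Q by simp
  have Qp: "pth Q" "Q \<noteq> []" "hd Q = v" "last Q = w" "set Q \<inter> set L1 = {}" "set Q \<inter> set L2 = {}"
    using Q by (auto simp: P_def)
  have lens: "d \<le> length L1" "d \<le> length L2" using L1 L2 by (auto simp: lobe_def)
  have Lne: "L1 \<noteq> []" "L2 \<noteq> []" using lens d_pos by auto
  have pL: "pth L1" "pth L2" "adj v (hd L1)" "adj w (hd L2)" using L1 L2 Lne by (auto simp: lobe_def pth_Cons)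
  have cl: "closed_at v (set L1)" "closed_at w (set L2)" using L1 L2 by (auto simp: lobe_def)
  have "pth (rev L1 @ Q @ L2)"
    using pL Qp Lne disj by (auto simp: pth_append last_rev hd_append adj_commute)
  then have tot: "length L1 + length Q + length L2 < 2 * d + 2 + r" using bound by fastforce
  define X where "X = set L1 \<union> set Q \<union> set L2"
  have "card X \<le> card (set L1) + card (set Q) + card (set L2)"
    unfolding X_def by (meson add_mono card_Un_le le_trans order_refl)
  also have "\<dots> \<le> length L1 + length Q + length L2" by (intro add_mono card_length)
  finally have "card X < card V" using tot n by linarith
  moreover have XV: "X \<subseteq> V" using Qp pL by (auto simp: X_def pth_def)
  ultimately have "X \<noteq> V" by auto
  have vQ: "v \<in> set Q" "w \<in> set Q" using Qp hd_in_set[of Q] last_in_set[of Q] by auto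
  then have "X \<noteq> {}" by (auto simp: X_def)
  then obtain x0 z0 where xz: "x0 \<in> X" "z0 \<in> V" "z0 \<notin> X" "adj x0 z0"
    by (rule conn_cut[OF XV _ \<open>X \<noteq> V\<close>])
  \<comment> \<open>The lobes are closed, so the outside is reached only through \<open>Q\<close>,
    which contains both \<open>v\<close> and \<open>w\<close>.\<close>
  have outQ: "x \<in> set Q" if "x \<in> X" "adj x z" "z \<notin> X" for x z
    using that closed_atD[OF cl(1), of x z] closed_atD[OF cl(2), of x z] vQ by (auto simp: X_def)
  define Z where "Z = {zs. pth zs \<and> zs \<noteq> [] \<and> set zs \<inter> X = {} \<and> (\<exists>x\<in>set Q. adj x (hd zs))}"
  have finZ: "finite Z" unfolding Z_def by (rule finite_subset[OF _ finite_pths]) auto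
  have "[z0] \<in> Z" using xz outQ by (auto simp: Z_def)
  then have "Max (length ` Z) \<in> length ` Z" using finZ by (intro Max_in) auto
  then obtain zs where zs: "zs \<in> Z" "length zs = Max (length ` Z)" by auto
  have Zmax: "length q \<le> length zs" if "q \<in> Z" for q using that finZ zs by simp
  have zp: "pth zs" "zs \<noteq> []" "set zs \<inter> X = {}" using zs by (auto simp: Z_def)
  obtain x where x: "x \<in> set Q" "adj x (hd zs)" using zs by (auto simp: Z_def)
  define e where "e = last zs"
  have "e \<in> set zs" using zp last_in_set[of zs] by (simp add: e_def)
  then have eX: "e \<notin> X" "e \<in> V" "e \<in> set zs" using zp unfolding pth_def by blast+
  have nbe: "nb e \<subseteq> (set zs - {e}) \<union> (nb e \<inter> set Q)"
  proof
    fix y assume y: "y \<in> nb e"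
    have "y \<in> set zs" if "y \<notin> X"
    proof (rule ccontr)
      assume "y \<notin> set zs"
      then have "pth (zs @ [y])" using zp y adj_in2 by (auto simp: pth_append e_def)
      then have "zs @ [y] \<in> Z" using zp x that by (auto simp: Z_def)
      then show False using Zmax by fastforce
    qed
    then show "y \<in> (set zs - {e}) \<union> (nb e \<inter> set Q)"
      using y outQ[of y e] eX adj_irrefl adj_sym by auto
  qed
  define S where "S = nb e \<inter> set Q"
  have d_le: "d + 1 \<le> length zs + card S"
  proof -
    have "d \<le> card ((set zs - {e}) \<union> S)"
      using deg[OF eX(2)] card_mono[OF _ nbe] unfolding S_def by fastforce
    also have "\<dots> \<le> card (set zs - {e}) + card S" by (rule card_Un_le)
    also have "card (set zs - {e}) = length zs - 1"
      using zp eX by (simp add: pth_def distinct_card card_Diff_singleton)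
    finally show ?thesis using zp(2) by (cases zs) auto
  qed
  \<comment> \<open>Between two consecutive neighbours on \<open>Q\<close> the vertex
    \<open>e\<close> could be inserted, contrary to the choice of \<open>Q\<close>.\<close>
  have S2: "2 * card S \<le> Suc (length Q)"
  proof (rule card_nonconsecutive)
    show "distinct Q" "S \<subseteq> set Q" using Qp by (auto simp: pth_def S_def)
    show "successively (\<lambda>a b. \<not> (a \<in> S \<and> b \<in> S)) Q"
      unfolding successively_conv_nth
    proof (intro allI impI notI)
      fix i assume i: "Suc i < length Q" and ab: "Q ! i \<in> S \<and> Q ! Suc i \<in> S"
      define A where "A = take (Suc i) Q"
      define B where "B = drop (Suc i) Q"
      have AB: "Q = A @ B" "A \<noteq> []" "B \<noteq> []" "last A = Q ! i" "hd B = Q ! Suc i"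
        using i id_take_nth_drop[of i Q]
        by (auto simp: A_def B_def hd_drop_conv_nth take_Suc_conv_app_nth)
      have "pth (A @ e # B)"
        using Qp(1) ab eX unfolding AB(1)
        by (auto simp: pth_append pth_Cons S_def AB X_def adj_commute)
      moreover have "hd (A @ e # B) = v" "last (A @ e # B) = w" using Qp AB by auto
      moreover have "set (A @ e # B) \<inter> (set L1 \<union> set L2) = {}"
        using Qp eX AB by (auto simp: X_def)
      ultimately have "A @ e # B \<in> P" by (simp add: P_def)
      then show False using Qmax AB by fastforce
    qed
  qed
  \<comment> \<open>\<open>x\<close> and \<open>s\<close> are attachments of the two ends of
    \<open>zs\<close>. Replacing the stretch of \<open>Q\<close> between them by \<open>zs\<close>
    may not lengthen \<open>Q\<close>, so at least \<open>length zs\<close> vertices lie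
    between.\<close>
  have gap: "length zs + 2 \<le> length Q" if s: "s \<in> S" "s \<noteq> x" for s
  proof -
    obtain a b A B C ys where Q': "Q = A @ a # B @ b # C" "adj a (hd ys)" "adj (last ys) b" "ys = zs \<or> ys = rev zs"
    proof -
      have sQ: "s \<in> set Q" "adj e s" using s by (auto simp: S_def)
      obtain A R where AR: "Q = A @ x # R" using x by (meson split_list)
      then consider "s \<in> set R" | "s \<in> set A" using sQ s by auto
      then show ?thesis
      proof cases
        case 1
        then obtain B C where "R = B @ s # C" by (meson split_list)
        then show ?thesis using that[of A x B s C zs] AR x sQ by (auto simp: e_def)
      next
        case 2
        then obtain A' B where "A = A' @ s # B" by (meson split_list)
        then show ?thesis using that[of A' s B x R "rev zs"] AR x sQ zp
          by (auto simp: e_def hd_rev last_rev adj_commute)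
      qed
    qed
    have ys: "pth ys" "ys \<noteq> []" "set ys \<inter> X = {}" "length ys = length zs" using Q'(4) zp by auto
    have "pth ((A @ [a]) @ B @ (b # C))" using Qp(1) Q'(1) by simp
    then have pc: "pth (A @ [a])" "pth (b # C)" "set (A @ [a]) \<inter> set (b # C) = {}"
      unfolding pth_append by auto
    have "set (A @ [a]) \<inter> set ys = {}" "set ys \<inter> set (b # C) = {}"
      using ys(3) Q'(1) by (auto simp: X_def)
    then have "pth ((A @ [a]) @ ys @ (b # C))"
      using pc ys Q'(2,3) pth_append[of "A @ [a]" "ys @ b # C"] pth_append[of ys "b # C"] by auto
    then have "pth (A @ a # ys @ b # C)" by simp
    moreover have "hd (A @ a # ys @ b # C) = v" "last (A @ a # ys @ b # C) = w" using Qp Q' by (auto simp: hd_append)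
    moreover have "set (A @ a # ys @ b # C) \<inter> (set L1 \<union> set L2) = {}"
      using Qp ys Q' by (auto simp: X_def)
    ultimately have "A @ a # ys @ b # C \<in> P" by (simp add: P_def)
    then show ?thesis using Qmax Q'(1) ys by fastforce
  qed
  \<comment> \<open>\<open>Q\<close> has at most r + 1 vertices. A shorter \<open>zs\<close> would
    leave \<open>e\<close> a second attachment; then |zs| <= r - 1 and |S| <= (r + 2) / 2, and 2r <=
    d + 1 contradicts \<open>d_le\<close>.\<close>
  have big: "d \<le> length zs"
  proof (rule ccontr)
    assume n: "\<not> d \<le> length zs"
    then have c2: "2 \<le> card S" using d_le by linarith
    have "\<not> S \<subseteq> {x}"
    proof
      assume "S \<subseteq> {x}"
      then have "card S \<le> card {x}" by (intro card_mono) auto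
      then show False using c2 by simp
    qed
    then obtain s where "s \<in> S" "s \<noteq> x" by blast
    then show False using gap d_le S2 tot lens r by fastforce
  qed
  obtain A B where AB: "Q = A @ x # B" using x by (meson split_list)
  have arm1: "pth (x # rev A @ L1)"
    using Qp pL Lne unfolding AB by (cases A) (auto simp: pth_append pth_Cons hd_append hd_rev last_rev adj_commute)
  have arm2: "pth (x # B @ L2)"
    using Qp pL Lne unfolding AB by (cases B) (auto simp: pth_append pth_Cons hd_append hd_rev last_rev adj_commute)
  have arm3: "pth (x # zs)"
    using zp x Qp XV by (auto simp: pth_Cons X_def)
  have xx: "x \<notin> set zs" using x zp by (auto simp: X_def)
  have d12: "set (rev A @ L1) \<inter> set (B @ L2) = {}" using Qp disj unfolding AB by (auto simp: pth_def)
  have d13: "set (rev A @ L1) \<inter> set zs = {}" "set (B @ L2) \<inter> set zs = {}"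
    "set zs \<inter> set (rev A @ L1) = {}" "set zs \<inter> set (B @ L2) = {}" "set (B @ L2) \<inter> set (rev A @ L1) = {}"
    using zp AB d12 by (auto simp: X_def)
  show ?thesis
  \<comment> \<open>The longer leg exists because \<open>v\<close> and \<open>w\<close> differ, so
    \<open>x\<close> cannot be both the first and the last vertex of \<open>Q\<close>.\<close>
  proof (cases "A = []")
    case True
    then have "B \<noteq> []" using AB Qp vw by auto
    then have "d + 1 \<le> length (B @ L2)" using lens by (cases B) auto
    then show ?thesis
      by (intro spiderI[OF arm1 arm3 arm2]) (use d12 d13 lens big in \<open>auto simp del: set_append\<close>)
  next
    case False
    then have "d + 1 \<le> length (rev A @ L1)" using lens by (cases A) auto
    then show ?thesis
      by (intro spiderI[OF arm2 arm3 arm1]) (use d12 d13 lens big in \<open>auto simp del: set_append\<close>)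
  qed
qed

text \<open>If the lobe found in \<open>D\<close> hangs at a vertex other than \<open>v\<close>, the
  access path adds that vertex to the at least \<open>d\<close> vertices of the lobe.\<close>

lemma closed_arm:
  assumes no_long: "\<And>cs. cyc cs \<Longrightarrow> length cs < 2 * d"
    and D: "closed_at v D" "D \<noteq> {}"
  shows "\<exists>p. pth (v # p) \<and> set p \<subseteq> D \<and> (d + 1 \<le> length p \<or> lobe v p)"
proof -
  obtain us L where l: "pth (us @ L)" "us \<noteq> []" "hd us = v" "set (tl us) \<subseteq> D" "set L \<subseteq> D" "lobe (last us) L"
    using lobe_exists[OF no_long D] by metis
  obtain us' where us: "us = v # us'" using l by (metis list.collapse)
  show ?thesis
  proof (cases "us' = []")
    case True then show ?thesis using l us by (auto simp: pth_append)
  next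
    case False
    then show ?thesis using l us by (intro exI[of _ "us' @ L"]) (cases us', auto simp: lobe_def)
  qed
qed

text \<open>Two lobes at different vertices give a spider. Otherwise two lobes hang at the same
  \<open>v\<close>, and the rest supplies a third arm there. If it is long, it is the third leg. If
  it is a lobe and G is no clique star at \<open>v\<close>, some component of G - v carries an arm
  on d + 1 vertices, and two of the three lobes avoid that component.\<close>

theorem spider_or_clique_star:
  assumes no_long: "\<And>cs. cyc cs \<Longrightarrow> length cs < 2 * d"
    and bound: "\<And>p. pth p \<Longrightarrow> length p < 2 * d + 2 + r"
    and r: "2 * r \<le> d + 1"
    and n: "4 * d + 4 \<le> card V"
  shows "spider d d (d + 1) \<or> (\<exists>v. clique_star v)"
proof (rule disjCI)
  assume "\<not> (\<exists>v. clique_star v)"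
  obtain v0 where v0: "v0 \<in> V" using n by fastforce
  have "V - {v0} \<noteq> {}"
  proof
    assume "V - {v0} = {}"
    then have "card V \<le> card {v0}" by (intro card_mono) auto
    then show False using n by simp
  qed
  then obtain v L1 where L1: "lobe v L1"
    using lobe_exists[OF no_long closed_at_all[OF v0]] by metis
  have vV: "v \<in> V" and cl1: "closed_at v (set L1)" using L1 by (auto simp: lobe_def closed_at_def)
  \<comment> \<open>Two lobes have at most 2(2d - 1) vertices together, so something is left besides
    them and \<open>v\<close>.\<close>
  have ne: "V - {v} - X \<noteq> {}" if "card X \<le> 2 * (2 * d - 1)" "finite X" for X
  proof
    assume "V - {v} - X = {}"
    then have "card V \<le> card (insert v X)" using that by (intro card_mono) auto
    also have "\<dots> \<le> Suc (card X)" by (rule card_insert_le_m1) (use that in auto)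
    finally show False using n that d_pos by linarith
  qed
  have cL1: "card (set L1) \<le> 2 * d - 1" using L1 card_length[of L1] by (auto simp: lobe_def)
  obtain us2 L2 where l2: "pth (us2 @ L2)" "us2 \<noteq> []" "hd us2 = v" "set (tl us2) \<subseteq> V - {v} - set L1"
     "set L2 \<subseteq> V - {v} - set L1" "lobe (last us2) L2"
    by (rule lobe_exists[OF no_long closed_at_diff[OF closed_at_all[OF vV] cl1] ne[of "set L1"]])
      (use cL1 in auto)
  show "spider d d (d + 1)"
  proof (cases "last us2 = v")
    case False
    have us2: "us2 = v # tl us2" using l2(2,3) by (metis list.collapse)
    have "set us2 \<inter> (set L1 \<union> set L2) = {}"
      using l2 us2 L1 by (auto simp: pth_append lobe_def pth_Cons) (metis Diff_iff set_ConsD subsetD us2)+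
    then show ?thesis
      using spider_of_two_lobes[OF bound r _ L1 l2(6)] False l2 n r by (auto simp: pth_append)
  next
    case True
    then have L2: "lobe v L2" using l2 by simp
    then have cl2: "closed_at v (set L2)" by (simp add: lobe_def)
    have cL2: "card (set L2) \<le> 2 * d - 1" using L2 card_length[of L2] by (auto simp: lobe_def)
    have "card (set L1 \<union> set L2) \<le> 2 * (2 * d - 1)" using card_Un_le[of "set L1" "set L2"] cL1 cL2 by linarith
    then have ne3: "V - {v} - set L1 - set L2 \<noteq> {}" using ne[of "set L1 \<union> set L2"] by (simp add: Diff_eq Int_assoc)
    have cl3: "closed_at v (V - {v} - set L1 - set L2)"
      using closed_at_diff[OF closed_at_diff[OF closed_at_all[OF vV] cl1] cl2] .
    have d12: "set L1 \<inter> set L2 = {}" using l2 by auto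
    have arms: "pth (v # L1)" "pth (v # L2)" "d \<le> length L1" "d \<le> length L2" using L1 L2 by (auto simp: lobe_def)
    obtain p3 where p3: "pth (v # p3)" "set p3 \<subseteq> V - {v} - set L1 - set L2" "d + 1 \<le> length p3 \<or> lobe v p3"
      using closed_arm[OF no_long cl3 ne3] by blast
    show ?thesis
    proof (cases "lobe v p3")
      case False
      then show ?thesis using p3 arms d12 by (intro spiderI[of v L1 L2 p3]) auto
    next
      case L3: True
      then have cl3': "closed_at v (set p3)" "d \<le> length p3" by (auto simp: lobe_def)
      obtain x where x: "x \<in> V - {v}" and nox: "\<And>K. x \<in> K \<Longrightarrow> K \<subseteq> V - {v} \<Longrightarrow> card K = d \<Longrightarrow>
          \<exists>y\<in>K. nb y \<noteq> insert v (K - {y})"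
        using \<open>\<not> (\<exists>v. clique_star v)\<close> vV unfolding clique_star_def by meson
      define K where "K = comp_avoiding v x"
      have clK: "closed_at v K" using comp_avoiding_closed vV x by (auto simp: K_def)
      have xK: "x \<in> K" by (simp add: K_def comp_avoiding_self)
      obtain p where p: "pth (v # p)" "set p \<subseteq> K" "d + 1 \<le> length p \<or> lobe v p"
        using closed_arm[OF no_long clK] xK by blast
      \<comment> \<open>An arm of only \<open>d\<close> vertices would be a lobe that fills its
        component, which would then be a clique on \<open>d\<close> vertices joined to
        \<open>v\<close>, against the choice of \<open>x\<close>.\<close>
      have plong: "d + 1 \<le> length p"
      proof (rule ccontr)
        assume short: "\<not> d + 1 \<le> length p"
        then have lp: "lobe v p" using p by blast
        then have "set p = K" using lobe_eq_comp p(2) x by (auto simp: K_def)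
        moreover have "card (set p) = d" using lp short by (auto simp: lobe_def pth_def distinct_card)
        ultimately have cK: "card K = d" by simp
        show False using nox[OF xK _ cK] clK small_comp_clique[OF clK cK] by (auto simp: closed_at_def)
      qed
      have meet: "K \<subseteq> D" if "closed_at v D" "D \<inter> K \<noteq> {}" for D
        using comp_avoiding_least[OF that(1)] that(2) by (simp add: K_def)
      have dd: "set L1 \<inter> set p3 = {}" "set L2 \<inter> set p3 = {}" using p3 by auto
      \<comment> \<open>A closed set that meets the component \<open>K\<close> contains it, so at
        most one of the three disjoint lobes meets \<open>K\<close>.\<close>
      consider "set L1 \<inter> K = {}" "set L2 \<inter> K = {}" | "set L1 \<inter> K = {}" "set p3 \<inter> K = {}"
        | "set L2 \<inter> K = {}" "set p3 \<inter> K = {}"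
        using meet[OF cl1] meet[OF cl2] meet[OF cl3'(1)] xK d12 dd by blast
      then show ?thesis
      proof cases
        case 1 then show ?thesis using p plong arms d12 by (intro spiderI[of v L1 L2 p]) auto
      next
        case 2 then show ?thesis using p plong arms dd p3 cl3' by (intro spiderI[of v L1 p3 p]) auto
      next
        case 3 then show ?thesis using p plong arms dd p3 cl3' by (intro spiderI[of v L2 p3 p]) auto
      qed
    qed
  qed
qed

end

section \<open>Packing the forest into spiders and clique stars\<close>

lemma sum_list_halves:
  "sum_list ls = 2 * (\<Sum>l\<leftarrow>ls. l div 2) + length (filter odd ls)"
proof (induction ls)
  case (Cons a ls)
  have "a = 2 * (a div 2) + (if odd a then 1 else 0)" by presburger
  then show ?case using Cons by simp
qed simp

text \<open>The rounded half of each \<open>l\<close> is at least 1, and at least 2 for odd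
  \<open>l\<close> since 3 is excluded.\<close>

lemma length_plus_odd_le_halves:
  fixes ls :: "nat list"
  assumes "\<forall>l\<in>set ls. 2 \<le> l \<and> l \<noteq> 3"
  shows "length ls + length (filter odd ls) \<le> (\<Sum>l\<leftarrow>ls. l div 2)"
  using assms
proof (induction ls)
  case (Cons a ls)
  have "1 \<le> a div 2" "odd a \<Longrightarrow> 2 \<le> a div 2" using Cons.prems by (auto, presburger+)
  then show ?case using Cons by auto
qed simp

lemma greedy_prefix:
  fixes xs :: "nat list"
  assumes "1 \<le> t" "t \<le> sum_list xs"
  obtains as x bs where "xs = as @ x # bs" "sum_list as < t" "t \<le> sum_list as + x"
proof -
  have "\<exists>as x bs. xs = as @ x # bs \<and> sum_list as < t \<and> t \<le> sum_list as + x"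
    using assms
  proof (induction xs rule: rev_induct)
    case (snoc x xs)
    show ?case
    proof (cases "t \<le> sum_list xs")
      case True
      then obtain as y bs where "xs = as @ y # bs" "sum_list as < t" "t \<le> sum_list as + y"
        using snoc by blast
      then show ?thesis by (intro exI[of _ as] exI[of _ y] exI[of _ "bs @ [x]"]) auto
    next
      case False then show ?thesis using snoc by (intro exI[of _ xs] exI[of _ x] exI[of _ "[]"]) auto
    qed
  qed simp
  then show ?thesis using that by blast
qed

context graph
begin

lemma spider_packs:
  assumes "spider a b c" "sum_list xs \<le> a + b + 1" "sum_list ys \<le> c"
  shows "packs (xs @ ys) V"
proof -
  obtain u p1 p2 p3 where s: "distinct (u # p1 @ p2 @ p3)" "pth (u # p1)" "pth (u # p2)" "pth (u # p3)"
     "a \<le> length p1" "b \<le> length p2" "c \<le> length p3" using assms(1) unfolding spider_def by blast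
  have q: "pth (rev p1 @ u # p2)" using s
    by (cases p1) (auto simp: pth_append pth_Cons last_rev adj_commute)
  have "packs xs (set (rev p1 @ u # p2))" by (rule packs_path[OF q]) (use s assms in auto)
  moreover have "pth p3" using s by (cases p3) (auto simp: pth_Cons)
  then have "packs ys (set p3)" using s assms by (intro packs_path) auto
  moreover have "set (rev p1 @ u # p2) \<inter> set p3 = {}" using s(1) by auto
  ultimately show ?thesis
    by (rule packs_append') (use s in \<open>auto simp: pth_def\<close>)
qed

lemma spider_rearrange: "spider a b c \<Longrightarrow> spider a c b"
  unfolding spider_def by (elim exE conjE) (intro exI conjI, auto)

end

context mgraph
begin

lemma clique_starD:
  assumes "clique_star v" "x \<in> V" "x \<noteq> v"
  obtains K where "x \<in> K" "K \<subseteq> V - {v}" "card K = d" "\<forall>y\<in>K. nb y = insert v (K - {y})"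
proof -
  have "\<exists>K. x \<in> K \<and> K \<subseteq> V - {v} \<and> card K = d \<and> (\<forall>y\<in>K. nb y = insert v (K - {y}))"
    using assms by (simp add: clique_star_def)
  then obtain K where K: "x \<in> K \<and> K \<subseteq> V - {v} \<and> card K = d \<and> (\<forall>y\<in>K. nb y = insert v (K - {y}))" ..
  show ?thesis by (rule that[of K]) (use K in simp_all)
qed

lemma clique_starE:
  assumes "clique_star v" "x \<in> V" "x \<noteq> v"
  obtains p where "x \<in> set p" "pth (v # p)" "length p = d" "closed_at v (set p)"
proof -
  obtain K where K0: "x \<in> K" "K \<subseteq> V - {v}" "card K = d" "\<forall>y\<in>K. nb y = insert v (K - {y})"
    using clique_starD[OF assms] .
  have K: "x \<in> K" "K \<subseteq> V - {v}" "card K = d" "\<And>y. y \<in> K \<Longrightarrow> nb y = insert v (K - {y})"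
    using K0 by simp_all
  have "finite K" using K(3) d_pos by (metis card.infinite not_one_le_zero)
  then obtain p where p: "set p = K" "distinct p" using finite_distinct_list by blast
  have vV: "v \<in> V" "v \<notin> K" using assms K by (auto simp: clique_star_def)
  have "pth q" if "distinct q" "set q \<subseteq> K" for q
    using that
  proof (induction q)
    case (Cons a q)
    have "hd q \<in> nb a" if "q \<noteq> []"
    proof -
      have "hd q \<in> set q" using that by simp
      then show ?thesis using Cons.prems K(4)[of a] by auto
    qed
    then show ?case using Cons K(2) by (auto simp: pth_Cons)
  qed simp
  moreover have "adj v (hd p)" if "p \<noteq> []"
  proof -
    have "hd p \<in> K" using that p by auto
    then have "v \<in> nb (hd p)" using K(4) by auto
    then show ?thesis by (simp add: adj_commute)
  qed
  ultimately have "pth (v # p)" using p vV by (auto simp: pth_Cons)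
  moreover have "closed_at v (set p)" using K p vV by (auto simp: closed_at_def)
  ultimately show ?thesis using that p K distinct_card by metis
qed

text \<open>Two cliques joined through \<open>v\<close> form a path on 2d + 1 vertices; two further
  cliques are paths on \<open>d\<close> vertices each.\<close>

lemma clique_star_packs:
  assumes star: "clique_star v" and n: "3 * d + 2 \<le> card V"
    and s: "sum_list xs \<le> 2 * d + 1" "sum_list ys \<le> d" "sum_list zs \<le> d"
  shows "packs (xs @ ys @ zs) V"
proof -
  have vV: "v \<in> V" using star by (simp add: clique_star_def)
  \<comment> \<open>\<open>X\<close> collects the cliques already chosen. Closedness keeps a clique
    through a new vertex disjoint from them, and the bound 3d leaves room for a fourth.\<close>
  have ex: "\<exists>p. pth (v # p) \<and> length p = d \<and> closed_at v (set p) \<and> set p \<inter> X = {}"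
    if X: "closed_at v X" "card X \<le> 3 * d" for X
  proof -
    have "V - {v} - X \<noteq> {}"
    proof
      assume "V - {v} - X = {}"
      moreover have fX: "finite X" using X fin by (auto simp: closed_at_def intro: finite_subset)
      ultimately have "card V \<le> card (insert v X)" by (intro card_mono) auto
      also have "\<dots> \<le> Suc (card X)" by (rule card_insert_le_m1) (use fX in auto)
      finally show False using n X by linarith
    qed
    then obtain x where x: "x \<in> V" "x \<noteq> v" "x \<notin> X" by blast
    obtain p where p: "x \<in> set p" "pth (v # p)" "length p = d" "closed_at v (set p)"
      using clique_starE[OF star x(1,2)] .
    obtain K where K0: "x \<in> K" "K \<subseteq> V - {v}" "card K = d" "\<forall>y\<in>K. nb y = insert v (K - {y})"
      using clique_starD[OF star x(1,2)] .
    have K: "x \<in> K" "K \<subseteq> V - {v}" "card K = d" "\<And>y. y \<in> K \<Longrightarrow> nb y = insert v (K - {y})"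
      using K0 by simp_all
    have "K \<inter> X = {}"
    proof (rule ccontr)
      assume "K \<inter> X \<noteq> {}"
      then obtain y where y: "y \<in> K" "y \<in> X" by blast
      then have "adj y x" using K x by (metis Diff_iff insertCI nb_iff singletonD)
      then show False using closed_atD[OF X(1) y(2), of x] x by blast
    qed
    moreover have "set p = K"
    proof (rule ccontr)
      assume "set p \<noteq> K"
      moreover have "card (set p) = d" using p by (simp add: pth_def distinct_card)
      ultimately have "\<not> K \<subseteq> set p" using K by (metis List.finite_set card_subset_eq)
      then obtain y where y: "y \<in> K" "y \<notin> set p" by blast
      then have "adj x y" using K p by (metis Diff_iff insertCI nb_iff singletonD)
      then show False using closed_atD[OF p(4) p(1)] y K by blast
    qed
    ultimately show ?thesis using p by blast
  qed
  have un: "closed_at v (X \<union> Y)" if "closed_at v X" "closed_at v Y" for X Y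
    using that unfolding closed_at_def by blast
  have cs: "card (set p \<union> X) \<le> d + card X" if "length p = d" for p X
    using card_Un_le[of "set p" X] card_length[of p] that by linarith
  obtain p1 where p1: "pth (v # p1)" "length p1 = d" "closed_at v (set p1)"
    using ex[of "{}"] vV by (auto simp: closed_at_def)
  obtain p2 where p2: "pth (v # p2)" "length p2 = d" "closed_at v (set p2)" "set p2 \<inter> set p1 = {}"
    using ex[OF p1(3)] p1(2) card_length[of p1] by auto
  have c12: "closed_at v (set p2 \<union> set p1)" using un p1 p2 by blast
  obtain p3 where p3: "pth (v # p3)" "length p3 = d" "closed_at v (set p3)" "set p3 \<inter> (set p2 \<union> set p1) = {}"
    using ex[OF c12] cs[OF p2(2), of "set p1"] card_length[of p1] p1(2) by auto
  have c123: "closed_at v (set p3 \<union> (set p2 \<union> set p1))" using un c12 p3 by blast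
  obtain p4 where p4: "pth (v # p4)" "length p4 = d" "set p4 \<inter> (set p3 \<union> (set p2 \<union> set p1)) = {}"
    using ex[OF c123] cs[OF p3(2), of "set p2 \<union> set p1"] cs[OF p2(2), of "set p1"] card_length[of p1] p1(2) by auto
  have q: "pth (rev p1 @ v # p2)" using p1(1) p2(1,4)
    by (cases p1) (auto simp: pth_append pth_Cons last_rev adj_commute)
  have tl': "pth p" if "pth (v # p)" for p using that by (cases p) (auto simp: pth_Cons)
  have "packs (ys @ zs) (set p3 \<union> set p4)"
    by (rule packs_append[OF packs_path[OF tl'[OF p3(1)]] packs_path[OF tl'[OF p4(1)]]])
      (use s p3 p4 in auto)
  moreover have "packs xs (set (rev p1 @ v # p2))" by (rule packs_path[OF q]) (use s p1 p2 in auto)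
  moreover have "set (rev p1 @ v # p2) \<inter> (set p3 \<union> set p4) = {}"
    using p1 p2 p3 p4 by (auto simp: pth_Cons)
  moreover have "set (rev p1 @ v # p2) \<union> (set p3 \<union> set p4) \<subseteq> V"
    using p1 p2 p3 p4 by (auto simp: pth_def)
  ultimately show ?thesis using packs_append' by blast
qed

text \<open>F exceeds the long path of the spider by \<open>r\<close> and that of the clique star by
  r + 1. A greedy prefix of the shorter components just covers the excess. In a spider this prefix,
  or its last member alone, fits into the free leg; in a clique star the last member and the part
  before it go into separate cliques.\<close>

lemma packs_of_spider_or_star:
  assumes alt: "spider d d (d + 1) \<or> (\<exists>v. clique_star v)" and n: "3 * d + 2 \<le> card V"
    and ls: "ls = l1 # rest" "(\<Sum>l\<leftarrow>ls. l div 2) = d + 1" "\<forall>l\<in>set ls. 2 \<le> l \<and> l \<noteq> 3" "rest \<noteq> []"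
    and small: "\<forall>l\<in>set rest. l \<le> d"
  shows "packs ls V"
proof -
  define r where "r = length (filter odd ls)"
  have tot: "sum_list ls = 2 * d + 2 + r" using sum_list_halves[of ls] ls(2) by (simp add: r_def)
  have r: "length ls + r \<le> d + 1" using length_plus_odd_le_halves[OF ls(3)] ls(2) by (simp add: r_def)
  have rl: "r \<le> length ls" by (simp add: r_def)
  have "1 \<le> (\<Sum>l\<leftarrow>rest. l div 2)"
  proof -
    obtain x xs where "rest = x # xs" using ls(4) by (cases rest) auto
    then show ?thesis using ls(1,3) by auto
  qed
  then have "l1 div 2 \<le> d" using ls(1,2) by auto
  then have l1: "l1 \<le> 2 * d + 1" by presburger
  have sr: "r + 1 \<le> sum_list rest" using tot l1 ls(1) by auto
  show ?thesis using alt
  proof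
    assume sp: "spider d d (d + 1)"
    then have sp': "spider d (d + 1) d" by (rule spider_rearrange)
    show ?thesis
    proof (cases "r = 0")
      case True
      then show ?thesis using spider_packs[OF sp', of ls "[]"] tot by auto
    next
      case False
      then obtain as x bs where ab: "rest = as @ x # bs" "sum_list as < r" "r \<le> sum_list as + x"
        using greedy_prefix[of r rest] sr by auto
      show ?thesis
      proof (cases "r \<le> x")
        case True
        have "packs ((l1 # as @ bs) @ [x]) V"
          by (rule spider_packs[OF sp']) (use True tot ls(1) ab small in auto)
        then show ?thesis by (rule packs_perm[rotated]) (simp add: ls(1) ab)
      next
        \<comment> \<open>The part \<open>as\<close> and the component \<open>x\<close> are each
          below \<open>r\<close>, so together at most 2r - 2 <= d.\<close>
        case f: False
        have "packs ((l1 # bs) @ (as @ [x])) V"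
          by (rule spider_packs[OF sp']) (use f tot ls(1) ab r rl in auto)
        then show ?thesis by (rule packs_perm[rotated]) (simp add: ls(1) ab)
      qed
    qed
  next
    assume "\<exists>v. clique_star v"
    then obtain v where v: "clique_star v" by blast
    obtain as x bs where ab: "rest = as @ x # bs" "sum_list as < r + 1" "r + 1 \<le> sum_list as + x"
      using greedy_prefix[of "r + 1" rest] sr by auto
    have "packs ((l1 # bs) @ as @ [x]) V"
      by (rule clique_star_packs[OF v n]) (use tot ls(1) ab small r rl in auto)
    then show ?thesis by (rule packs_perm[rotated]) (simp add: ls(1) ab)
  qed
qed

end

section \<open>Forests whose second component has more than d vertices\<close>

text \<open>The rounded halves of the two long paths already sum to at least l2 - 1, so at most 1
  remains for all other components. The alternatives with sum \<open>l2\<close> lead to exception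
  (1), the last one to exception (2).\<close>

lemma two_long_paths_classification:
  fixes ls :: "nat list"
  assumes ls: "ls = l1 # l2 # rest" "l2 \<le> l1" "\<forall>l\<in>set ls. 2 \<le> l \<and> l \<noteq> 3"
    and S: "(\<Sum>l\<leftarrow>ls. l div 2) \<le> l2"
  shows "(even l2 \<and> ls \<in> {[l2 + 1, l2], [l2, l2]} \<and> (\<Sum>l\<leftarrow>ls. l div 2) = l2) \<or>
    (odd l2 \<and> ls \<in> {[l2 + 2, l2], [l2 + 1, l2], [l2, l2, 2]} \<and> (\<Sum>l\<leftarrow>ls. l div 2) = l2) \<or>
    (odd l2 \<and> ls = [l2, l2] \<and> (\<Sum>l\<leftarrow>ls. l div 2) + 1 = l2)"
proof (cases rest)
  case Nil
  then have "l1 div 2 + l2 div 2 \<le> l2" using ls S by simp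
  then have "even l2 \<and> (l1 = l2 \<or> l1 = l2 + 1) \<or> odd l2 \<and> (l1 = l2 \<or> l1 = l2 + 1 \<or> l1 = l2 + 2)"
    using ls(2) by presburger
  then show ?thesis using Nil ls(1) by (auto, presburger+)
next
  case (Cons x xs)
  have "length xs \<le> (\<Sum>l\<leftarrow>xs. l div 2)" using length_plus_odd_le_halves[of xs] ls Cons by auto
  moreover have h: "l1 div 2 + l2 div 2 + x div 2 + (\<Sum>l\<leftarrow>xs. l div 2) \<le> l2" using ls S Cons by simp
  moreover have "2 \<le> x" "x \<noteq> 3" using ls Cons by auto
  ultimately have "length xs = 0" "x = 2" "odd l2" "l1 = l2" using ls(2) by presburger+
  then show ?thesis using ls Cons by (auto, presburger+)
qed

section \<open>Graphs without two disjoint paths on d + 2 vertices\<close>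

context mgraph
begin

lemma comp_avoiding_eq_or_disjoint:
  assumes "v \<in> V" "x \<in> V" "y \<in> V" "x \<noteq> v" "y \<noteq> v"
  shows "comp_avoiding v x = comp_avoiding v y \<or> comp_avoiding v x \<inter> comp_avoiding v y = {}"
proof (cases "comp_avoiding v x \<inter> comp_avoiding v y = {}")
  case False
  then have "comp_avoiding v y \<inter> comp_avoiding v x \<noteq> {}" by blast
  then have "comp_avoiding v x \<subseteq> comp_avoiding v y"
    by (rule comp_avoiding_least[OF comp_avoiding_closed[OF assms(1,3,5)]])
  moreover have "comp_avoiding v y \<subseteq> comp_avoiding v x"
    by (rule comp_avoiding_least[OF comp_avoiding_closed[OF assms(1,2,4)] False])
  ultimately show ?thesis by blast
qed simp

text \<open>When \<open>w\<close> sees nothing but \<open>L\<close> and \<open>v\<close>, absorbing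
  it moves the point of attachment from \<open>w\<close> to \<open>v\<close>.\<close>

lemma closed_at_insert:
  assumes "closed_at w L" "w \<noteq> v" "v \<in> V" "v \<notin> L" "\<And>x. adj w x \<Longrightarrow> x \<in> L \<or> x = v"
  shows "closed_at v (insert w L)"
proof -
  have "\<forall>x\<in>insert w L. nb x \<subseteq> insert v (insert w L)"
    using assms(1,5) unfolding closed_at_def nb_def by blast
  then show ?thesis using assms(1-4) unfolding closed_at_def by blast
qed

text \<open>Look at a lobe inside the component. Two access vertices besides \<open>v\<close>
  already give d + 2 vertices. With fewer, the lobe fills the component, alone or with its
  attachment vertex \<open>w\<close>, unless \<open>w\<close> has a further neighbour, which then
  prolongs the path.\<close>

lemma comp_has_long_path:
  assumes no_long: "\<And>cs. cyc cs \<Longrightarrow> length cs < 2 * d"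
    and x: "v \<in> V" "x \<in> V" "x \<noteq> v" and big: "d + 2 \<le> card (comp_avoiding v x)"
  obtains p where "pth p" "set p \<subseteq> comp_avoiding v x" "d + 2 \<le> length p"
proof -
  let ?K = "comp_avoiding v x"
  have clK: "closed_at v ?K" using comp_avoiding_closed x by simp
  obtain us L where l: "pth (us @ L)" "us \<noteq> []" "hd us = v" "set (tl us) \<subseteq> ?K" "set L \<subseteq> ?K" "lobe (last us) L"
    using lobe_exists[OF no_long clK] comp_avoiding_self by blast
  obtain us' where us: "us = v # us'" using l by (metis list.collapse)
  have dL: "d \<le> length L" "pth L" using l by (auto simp: lobe_def pth_append)
  have vK: "v \<notin> ?K" using clK by (auto simp: closed_at_def)
  show ?thesis
  proof (cases us' rule: rev_cases)
    case Nil
    then have "set L = ?K" using lobe_eq_comp[of v L x] l us x by auto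
    then have "d + 2 \<le> length L" using big card_length[of L] by simp
    then show ?thesis using that[of L] l dL by auto
  next
    case (snoc us'' w)
    have p1: "pth (us' @ L)" using l us by (cases us') (auto simp: pth_append pth_Cons)
    show ?thesis
    proof (cases "us'' = []")
      case False
      then show ?thesis using that[of "us' @ L"] p1 l us dL snoc by (cases us'') auto
    next
      case True
      then have w: "us = [v, w]" "lobe w L" using us snoc l by auto
      have wK: "w \<in> ?K" using l w by auto
      then have wv: "w \<noteq> v" using vK by auto
      have pw: "pth (w # L)" using w by (simp add: lobe_def)
      have clL: "closed_at w (set L)" using w by (simp add: lobe_def)
      show ?thesis
      proof (cases "\<exists>z. adj w z \<and> z \<notin> set L \<and> z \<noteq> v")
        case True
        then obtain z where z: "adj w z" "z \<notin> set L" "z \<noteq> v" by blast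
        then have zK: "z \<in> ?K" using closed_atD[OF clK wK] by blast
        have "z \<noteq> w" using z adj_irrefl by auto
        then have "pth (z # w # L)" using pw z adj_in2 adj_sym by (auto simp: pth_Cons)
        then show ?thesis using that[of "z # w # L"] zK wK l dL by auto
      next
        case False
        have "closed_at v (insert w (set L))"
          by (rule closed_at_insert[OF clL wv x(1)]) (use False l vK in auto)
        then have "?K \<subseteq> insert w (set L)" using comp_avoiding_least wK by blast
        then have "card ?K \<le> card (set (w # L))" by (intro card_mono) auto
        then have "d + 2 \<le> length (w # L)" using big card_length[of "w # L"] by linarith
        then show ?thesis using that[of "w # L"] pw wK l by auto
      qed
    qed
  qed
qed

lemma closed_arm_d:
  assumes no_long: "\<And>cs. cyc cs \<Longrightarrow> length cs < 2 * d"
    and D: "closed_at v D" "D \<noteq> {}"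
  obtains p where "pth (v # p)" "set p \<subseteq> D" "d \<le> length p"
  using closed_arm[OF assms] unfolding lobe_def by (metis le_add1 le_trans)

lemma packs_two:
  assumes "pth p" "pth q" "set p \<inter> set q = {}" "a \<le> length p" "b \<le> length q"
  shows "packs [a, b] V"
proof -
  have "packs ([a] @ [b]) (set p \<union> set q)" using assms by (intro packs_append packs_path) auto
  then show ?thesis using assms packs_mono by (auto simp: pth_def)
qed

text \<open>Without two disjoint paths on \<open>d + 2\<close> vertices there is a vertex all of whose
  complementary components are small: either the attachment vertex of a lobe has three
  components, or every lobe hangs by one vertex off a common centre.\<close>

theorem small_components:
  assumes no_long: "\<And>cs. cyc cs \<Longrightarrow> length cs < 2 * d"
    and n: "4 * d + 8 \<le> card V" and free: "\<not> packs [d + 2, d + 2] V"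
  obtains x where "x \<in> V" "\<And>y. y \<in> V \<Longrightarrow> y \<noteq> x \<Longrightarrow> card (comp_avoiding x y) \<le> d + 1"
proof -
  have no2: False if "pth p" "pth q" "set p \<inter> set q = {}" "d + 2 \<le> length p" "d + 2 \<le> length q" for p q
    using packs_two[OF that] free by blast
  have big: "X \<noteq> {}" if "V \<subseteq> X \<union> Y" "card Y < card V" "finite Y" for X Y
  proof
    assume "X = {}"
    then have "card V \<le> card Y" using that by (intro card_mono) auto
    then show False using that by simp
  qed
  have tl': "pth p" if "pth (v # p)" for p v using that by (cases p) (auto simp: pth_Cons)
  show ?thesis
  \<comment> \<open>Is there a lobe whose attachment vertex has two more components? If so, that
    vertex is the one sought; if not, the fact \<open>one\<close> says that all the rest beside any
    lobe is a single component.\<close>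
  proof (cases "\<exists>v L y z. lobe v L \<and> y \<in> V - {v} - set L \<and> z \<in> V - {v} - set L \<and> comp_avoiding v y \<noteq> comp_avoiding v z")
    case True
    then obtain v L y z where vL: "lobe v L" and yz: "y \<in> V - {v} - set L" "z \<in> V - {v} - set L"
      "comp_avoiding v y \<noteq> comp_avoiding v z" by blast
    have clL: "closed_at v (set L)" "v \<in> V" using vL by (auto simp: lobe_def closed_at_def)
    have Lne: "L \<noteq> []" using vL d_pos by (auto simp: lobe_def)
    have clc: "closed_at v (comp_avoiding v y)" "closed_at v (comp_avoiding v z)"
      using comp_avoiding_closed clL yz by auto
    have djL: "set L \<inter> comp_avoiding v u = {}" if "u \<in> V - {v} - set L" for u
      using comp_avoiding_least[OF clL(1), of u] comp_avoiding_self[of u v] that by blast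
    have dj: "comp_avoiding v y \<inter> comp_avoiding v z = {}"
      using comp_avoiding_eq_or_disjoint[of v y z] yz clL by blast
    have "card (comp_avoiding v x) \<le> d + 1" if x: "x \<in> V" "x \<noteq> v" for x
    proof (rule ccontr)
      assume "\<not> ?thesis"
      then have bigK: "d + 2 \<le> card (comp_avoiding v x)" by simp
      let ?K = "comp_avoiding v x"
      obtain p where p: "pth p" "set p \<subseteq> ?K" "d + 2 \<le> length p"
        using comp_has_long_path[OF no_long clL(2) x bigK] .
      have xK: "x \<in> ?K" by (rule comp_avoiding_self)
      \<comment> \<open>Arms into two components other than \<open>?K\<close> join through
        \<open>v\<close> to a path on 2d + 1 >= d + 2 vertices, disjoint from the path
        \<open>p\<close> inside \<open>?K\<close>.\<close>
      have two: False if D: "closed_at v D1" "closed_at v D2" "D1 \<noteq> {}" "D2 \<noteq> {}" "D1 \<inter> D2 = {}" "D1 \<inter> ?K = {}" "D2 \<inter> ?K = {}" for D1 D2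
      proof -
        obtain p1 where p1: "pth (v # p1)" "set p1 \<subseteq> D1" "d \<le> length p1" using closed_arm_d[OF no_long D(1,3)] .
        obtain p2 where p2: "pth (v # p2)" "set p2 \<subseteq> D2" "d \<le> length p2" using closed_arm_d[OF no_long D(2,4)] .
        have "set p1 \<inter> set p2 = {}" using p1 p2 D by blast
        then have q: "pth (rev p1 @ v # p2)" using p1(1) p2(1)
          by (cases p1) (auto simp: pth_append pth_Cons last_rev adj_commute)
        have "v \<notin> ?K" using comp_avoiding_closed[OF clL(2) x] by (auto simp: closed_at_def)
        then have "set p \<inter> set (rev p1 @ v # p2) = {}" using p p1 p2 D by auto
        then show False using no2[OF p(1) q] p p1 p2 d_pos by auto
      qed
      have meet: "?K \<subseteq> D" if "closed_at v D" "D \<inter> ?K \<noteq> {}" for D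
        using comp_avoiding_least that by blast
      have ne: "comp_avoiding v y \<noteq> {}" "comp_avoiding v z \<noteq> {}" "set L \<noteq> {}"
        using comp_avoiding_self Lne by auto
      have "set L \<inter> ?K = {} \<and> comp_avoiding v y \<inter> ?K = {} \<or> set L \<inter> ?K = {} \<and> comp_avoiding v z \<inter> ?K = {}
        \<or> comp_avoiding v y \<inter> ?K = {} \<and> comp_avoiding v z \<inter> ?K = {}"
        using meet[OF clL(1)] meet[OF clc(1)] meet[OF clc(2)] xK djL[OF yz(1)] djL[OF yz(2)] dj by blast
      then show False
        using two[OF clL(1) clc(1) ne(3) ne(1) djL[OF yz(1)]] two[OF clL(1) clc(2) ne(3) ne(2) djL[OF yz(2)]]
          two[OF clc ne(1,2) dj] by blast
    qed
    then show ?thesis using that clL by blast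
  next
    case False
    then have one: "comp_avoiding v y = comp_avoiding v z"
      if "lobe v L" "y \<in> V - {v} - set L" "z \<in> V - {v} - set L" for v L y z using that by blast
    obtain v0 where v0: "v0 \<in> V" using n by fastforce
    have "V - {v0} \<noteq> {}" by (rule big[of _ "{v0}"]) (use n in auto)
    then obtain v L where L: "lobe v L" using lobe_exists[OF no_long closed_at_all[OF v0]] by metis
    have clL: "closed_at v (set L)" "v \<in> V" "pth (v # L)" "d \<le> length L" "length L \<le> 2 * d - 1" "v \<notin> set L"
      using L by (auto simp: lobe_def closed_at_def)
    have setV: "set L \<subseteq> V" using clL by (auto simp: closed_at_def)
    define K where "K = V - {v} - set L"
    have cardvL: "card (set (v # L)) \<le> 2 * d" using card_length[of "v # L"] clL d_pos by simp
    have clK: "closed_at v K" unfolding K_def by (rule closed_at_diff[OF closed_at_all clL(1)]) (rule clL)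
    have "K \<noteq> {}" by (rule big[of _ "set (v # L)"]) (use cardvL n in \<open>auto simp: K_def\<close>)
    then obtain k where k: "k \<in> K" by blast
    have Keq: "comp_avoiding v k = K"
    proof
      show "comp_avoiding v k \<subseteq> K" using comp_avoiding_least[OF clK] comp_avoiding_self k by blast
      show "K \<subseteq> comp_avoiding v k"
        using one[OF L, of _ k] k comp_avoiding_self unfolding K_def by blast
    qed
    have cardK: "card V \<le> card K + 2 * d"
    proof -
      have "V \<subseteq> K \<union> set (v # L)" by (auto simp: K_def)
      then have "card V \<le> card (K \<union> set (v # L))" using fin by (intro card_mono) (auto simp: K_def)
      then show ?thesis using card_Un_le[of K "set (v # L)"] cardvL by linarith
    qed
    \<comment> \<open>A lobe with more than \<open>d\<close> vertices forms with \<open>v\<close> a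
      path on d + 2 vertices, and the large component \<open>K\<close> contains another one.\<close>
    have Llen: "length L = d"
    proof (rule ccontr)
      assume "length L \<noteq> d"
      then have l: "d + 2 \<le> length (v # L)" using clL by simp
      obtain p where p: "pth p" "set p \<subseteq> comp_avoiding v k" "d + 2 \<le> length p"
        by (rule comp_has_long_path[OF no_long clL(2), of k]) (use k cardK n Keq in \<open>auto simp: K_def\<close>)
      show False by (rule no2[OF p(1) clL(3) _ p(3) l]) (use p Keq in \<open>auto simp: K_def\<close>)
    qed
    obtain us L' where l': "pth (us @ L')" "us \<noteq> []" "hd us = v" "set (tl us) \<subseteq> K" "set L' \<subseteq> K" "lobe (last us) L'"
      using lobe_exists[OF no_long clK] k by blast
    define w where "w = last us"
    have L': "lobe w L'" using l' by (simp add: w_def)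
    have clL': "closed_at w (set L')" "w \<in> V" "pth (w # L')" "d \<le> length L'" "length L' \<le> 2 * d - 1" "w \<notin> set L'"
      using L' by (auto simp: lobe_def closed_at_def)
    \<comment> \<open>A second lobe at \<open>v\<close> would fill the component \<open>K\<close>,
      which is too large for a lobe.\<close>
    have wv: "w \<noteq> v"
    proof
      assume "w = v"
      then have "closed_at v (set L')" using clL' by simp
      moreover have "L' \<noteq> []" using clL' d_pos by auto
      then have "set L' \<inter> comp_avoiding v k \<noteq> {}" using l' Keq by (cases L') auto
      ultimately have "K \<subseteq> set L'" using comp_avoiding_least Keq by blast
      then have "card K \<le> card (set L')" by (intro card_mono) auto
      also have "\<dots> \<le> 2 * d - 1" using card_length[of L'] clL' by linarith
      finally show False using cardK n by linarith
    qed
    have wK: "w \<in> K"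
    proof -
      have "us = v # tl us" using l' by (metis list.collapse)
      then have "w \<in> set (tl us)" using wv unfolding w_def by (metis last.simps last_in_set)
      then show ?thesis using l' by blast
    qed
    have LL': "set L \<inter> set L' = {}" "v \<notin> set L'" "w \<notin> set L" using l' wK by (auto simp: K_def)
    have arm: "pth (x # v # L)" if "adj v x" "x \<notin> set L" for x
      using that clL adj_in2 adj_irrefl by (auto simp: pth_Cons adj_commute)
    have arm': "pth (x # w # L')" if "adj w x" "x \<notin> set L'" for x
      using that clL' adj_in2 adj_irrefl by (auto simp: pth_Cons adj_commute)
    have nbL: "x \<notin> set L" if "adj w x" for x
      using closed_atD[OF clL(1), of x w] that wv LL' adj_sym by blast
    have nbL': "x \<notin> set L'" if "adj v x" for x
      using closed_atD[OF clL'(1), of x v] that wv LL' adj_sym by blast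
    \<comment> \<open>One more neighbour prolongs each of \<open>v # L\<close> and
      \<open>w # L'\<close> to at least d + 2 vertices, so the two new neighbours cannot be
      different.\<close>
    have meetF: False if "adj v x" "x \<notin> set L" "adj w x'" "x' \<notin> set L'" "x \<noteq> x'" "x \<noteq> w" "x' \<noteq> v" for x x'
      by (rule no2[OF arm[of x] arm'[of x']]) (use that nbL nbL' LL' wv clL clL' in auto)
    have cut: "\<exists>a\<in>X. adj u a" if X: "closed_at u X" "X \<noteq> {}" for u X
    proof -
      have "X \<subseteq> V" "X \<noteq> V" using X by (auto simp: closed_at_def)
      then obtain a b where "a \<in> X" "b \<notin> X" "adj a b" using conn_cut[of X] X(2) by metis
      then show ?thesis using closed_atD[OF X(1), of a b] adj_sym by blast
    qed
    have exx: "\<exists>x\<in>K. adj v x" using cut[OF clK] k by blast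
    show ?thesis
    \<comment> \<open>In both cases the outside neighbours of \<open>v\<close> and \<open>w\<close>
      collapse to one vertex \<open>x\<close>. If \<open>v\<close> and \<open>w\<close> are
      adjacent, counting the vertices on both sides of \<open>x\<close> contradicts the order of G;
      if not, \<open>x\<close> is the centre sought.\<close>
    proof (cases "adj v w")
      case vw: True
      define W where "W = V - set (v # L) - set (w # L')"
      have cvw: "card (set (v # L) \<union> set (w # L')) \<le> 4 * d"
        using card_Un_le[of "set (v # L)" "set (w # L')"] cardvL card_length[of "w # L'"] clL' d_pos by simp
      have Wne: "W \<noteq> {}"
        by (rule big[of _ "set (v # L) \<union> set (w # L')"]) (use cvw n in \<open>auto simp: W_def\<close>)
      have VW: "V = W \<union> set (v # L) \<union> set (w # L')"
        using setV clL(2) clL' by (auto simp: W_def closed_at_def)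
      \<comment> \<open>Otherwise \<open>v # L\<close> would be closed off at \<open>w\<close>, so
        the lobe at \<open>w\<close> would leave two components, contrary to
        \<open>one\<close>.\<close>
      have Wv: "\<exists>x\<in>W. adj v x"
      proof (rule ccontr)
        assume no: "\<not> (\<exists>x\<in>W. adj v x)"
        have "closed_at w (set (v # L))"
        proof -
          have "y = w \<or> y \<in> set (v # L)" if "y0 \<in> set (v # L)" "adj y0 y" for y0 y
          proof (cases "y0 = v")
            case True
            have "y \<in> V" using that adj_in2 by blast
            moreover have "y \<notin> set L'" using nbL' that True by blast
            ultimately show ?thesis using no that True VW by auto
          next
            case False then show ?thesis using closed_atD[OF clL(1), of y0 y] that by auto
          qed
          then have "\<forall>x\<in>set (v # L). nb x \<subseteq> insert w (set (v # L))" by (metis insertCI nb_iff subsetI)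
          then show ?thesis using clL clL' setV wv LL' unfolding closed_at_def by auto
        qed
        moreover obtain x where x: "x \<in> W" using Wne by blast
        moreover have "comp_avoiding w v = comp_avoiding w x"
          by (rule one[OF L']) (use x clL wv LL' in \<open>auto simp: W_def\<close>)
        ultimately have "comp_avoiding w x \<subseteq> set (v # L)"
          using comp_avoiding_least[of w "set (v # L)" v] comp_avoiding_self[of v w] by auto
        then show False using comp_avoiding_self[of x w] x by (auto simp: W_def)
      qed
      have Ww: "\<exists>x\<in>W. adj w x"
      proof (rule ccontr)
        assume no: "\<not> (\<exists>x\<in>W. adj w x)"
        have "closed_at v (set (w # L'))"
        proof -
          have "y = v \<or> y \<in> set (w # L')" if "y0 \<in> set (w # L')" "adj y0 y" for y0 y
          proof (cases "y0 = w")
            case True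
            have "y \<in> V" using that adj_in2 by blast
            moreover have "y \<notin> set L" using nbL that True by blast
            ultimately show ?thesis using no that True VW by auto
          next
            case False then show ?thesis using closed_atD[OF clL'(1), of y0 y] that by auto
          qed
          then have "\<forall>x\<in>set (w # L'). nb x \<subseteq> insert v (set (w # L'))" by (metis insertCI nb_iff subsetI)
          then show ?thesis using clL clL' setV wv LL' unfolding closed_at_def by auto
        qed
        moreover obtain x where x: "x \<in> W" using Wne by blast
        moreover have "comp_avoiding v w = comp_avoiding v x"
          by (rule one[OF L]) (use x clL' wv LL' in \<open>auto simp: W_def\<close>)
        ultimately have "comp_avoiding v x \<subseteq> set (w # L')"
          using comp_avoiding_least[of v "set (w # L')" w] comp_avoiding_self[of w v] by auto
        then show False using comp_avoiding_self[of x v] x by (auto simp: W_def)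
      qed
      obtain x where x: "x \<in> W" "adj v x" using Wv by blast
      have wx: "x' = x" if "x' \<in> W" "adj w x'" for x'
        using meetF[of x x'] that x by (auto simp: W_def)
      then have xw: "adj w x" using Ww by blast
      have vx: "x' = x" if "x' \<in> W" "adj v x'" for x'
        using meetF[of x' x] that x xw by (auto simp: W_def)
      have xV: "x \<in> V" using x adj_in2 by blast
      define Y where "Y = set (v # L) \<union> set (w # L')"
      have clY: "closed_at x Y"
      proof -
        have "y = x \<or> y \<in> Y" if y0: "y0 \<in> Y" "adj y0 y" for y0 y
        proof -
          have yV: "y \<in> V" using y0 adj_in2 by blast
          consider "y0 = v" | "y0 = w" | "y0 \<in> set L" | "y0 \<in> set L'" using y0 by (auto simp: Y_def)
          then show ?thesis
          proof cases
            case 1 then show ?thesis using vx[of y] y0 yV VW by (auto simp: Y_def)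
          next
            case 2 then show ?thesis using wx[of y] y0 yV VW by (auto simp: Y_def)
          next
            case 3 then show ?thesis using closed_atD[OF clL(1), of y0 y] y0 by (auto simp: Y_def)
          next
            case 4 then show ?thesis using closed_atD[OF clL'(1), of y0 y] y0 by (auto simp: Y_def)
          qed
        qed
        then have "\<forall>y0\<in>Y. nb y0 \<subseteq> insert x Y" by (metis insertCI nb_iff subsetI)
        moreover have "x \<notin> Y" using x by (auto simp: W_def Y_def)
        moreover have "Y \<subseteq> V" using clL(2) clL' setV by (auto simp: closed_at_def Y_def)
        ultimately show ?thesis using xV unfolding closed_at_def by auto
      qed
      have clW: "closed_at x (V - {x} - Y)" by (rule closed_at_diff[OF closed_at_all[OF xV] clY])
      have "card (insert x Y) \<le> Suc (card Y)" by (rule card_insert_le_m1) (auto simp: Y_def)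
      then have "card (insert x Y) < card V" using cvw n unfolding Y_def by linarith
      then have "V - {x} - Y \<noteq> {}" by (intro big[of _ "insert x Y"]) (auto simp: Y_def)
      then obtain p where p: "pth (x # p)" "set p \<subseteq> V - {x} - Y" "d + 1 \<le> length p \<or> lobe x p"
        using closed_arm[OF no_long clW] by blast
      \<comment> \<open>A longer arm beyond \<open>x\<close> would be disjoint from the path w, v,
        \<open>L\<close>, which has d + 2 vertices.\<close>
      have "lobe x p"
      proof (rule ccontr)
        assume "\<not> lobe x p"
        then have long: "d + 2 \<le> length (x # p)" using p by simp
        have q: "pth (w # v # L)" using arm[OF vw] LL' by blast
        show False by (rule no2[OF p(1) q _ long]) (use p Llen clY in \<open>auto simp: Y_def closed_at_def\<close>)
      qed
      have "V - {x} \<subseteq> Y \<union> set p"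
      proof
        fix u assume u: "u \<in> V - {x}"
        show "u \<in> Y \<union> set p"
        proof (rule ccontr)
          assume nu: "u \<notin> Y \<union> set p"
          have "v \<in> V - {x} - set p" using p clL x by (auto simp: Y_def W_def)
          then have "comp_avoiding x u = comp_avoiding x v" using one[OF \<open>lobe x p\<close>] u nu by blast
          moreover have "comp_avoiding x v \<subseteq> Y"
            using comp_avoiding_least[OF clY, of v] comp_avoiding_self[of v x] by (auto simp: Y_def)
          ultimately show False using comp_avoiding_self[of u x] nu by blast
        qed
      qed
      \<comment> \<open>All vertices are now accounted for: |Y| <= 3d + 1 and |p| = d bound the
        order by 4d + 2.\<close>
      then have "V \<subseteq> insert x (Y \<union> set p)" by blast
      then have "card V \<le> card (insert x (Y \<union> set p))" by (intro card_mono) (auto simp: Y_def)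
      also have "\<dots> \<le> Suc (card (Y \<union> set p))" by (rule card_insert_le_m1) (auto simp: Y_def)
      also have "\<dots> \<le> Suc (card Y + card (set p))" using card_Un_le by simp
      finally have "card V \<le> Suc (card Y + length p)" using card_length[of p] by linarith
      moreover have "length p = d"
      proof (rule ccontr)
        assume "length p \<noteq> d"
        then have long: "d + 2 \<le> length (x # p)" using \<open>lobe x p\<close> by (auto simp: lobe_def)
        have q: "pth (w # v # L)" using arm[OF vw] LL' by blast
        show False by (rule no2[OF p(1) q _ long]) (use p Llen clY in \<open>auto simp: Y_def closed_at_def\<close>)
      qed
      moreover have "card Y \<le> 3 * d + 1"
      proof -
        have "card (set (v # L)) \<le> d + 1" using card_length[of "v # L"] Llen by simp
        moreover have "card (set (w # L')) \<le> 2 * d" using card_length[of "w # L'"] clL' d_pos by simp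
        ultimately show ?thesis unfolding Y_def using card_Un_le[of "set (v # L)" "set (w # L')"] by linarith
      qed
      ultimately show ?thesis using n by linarith
    next
      case vw: False
      obtain x where x: "x \<in> K" "adj v x" using exx by blast
      have xL: "x \<notin> set L" "x \<noteq> w" "x \<noteq> v" using x vw by (auto simp: K_def)
      have wx: "x' = x0" if "adj w x'" "x' \<notin> set L'" "adj v x0" "x0 \<notin> set L" for x' x0
        using meetF[of x0 x'] that vw adj_commute by blast
      have "\<exists>x'. adj w x' \<and> x' \<notin> set L'"
      proof (rule ccontr)
        assume "\<not> ?thesis"
        then have *: "\<And>x'. adj w x' \<Longrightarrow> x' \<in> set L'" by blast
        have "closed_at v (set (w # L'))"
          using closed_at_insert[OF clL'(1) wv clL(2) LL'(2)] * by auto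
        moreover have "set (w # L') \<inter> comp_avoiding v k \<noteq> {}" using wK Keq by auto
        ultimately have "K \<subseteq> set (w # L')" using comp_avoiding_least Keq by blast
        then have "card K \<le> card (set (w # L'))" by (intro card_mono) auto
        also have "\<dots> \<le> 2 * d" using card_length[of "w # L'"] clL' d_pos by simp
        finally show False using cardK n by linarith
      qed
      then obtain x' where "adj w x'" "x' \<notin> set L'" by blast
      then have uniq: "x0 = x" if "adj v x0" "x0 \<notin> set L" for x0 using wx that x xL by metis
      have xV: "x \<in> V" using x by (auto simp: K_def)
      have clvL: "closed_at x (set (v # L))"
        using closed_at_insert[OF clL(1) _ xV xL(1)] xL uniq by auto
      \<comment> \<open>The component of G - x through \<open>v\<close> lies in \<open>v # L\<close>
        and has at most d + 1 vertices; a larger one elsewhere would contain a long path disjoint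
        from x, v, \<open>L\<close>.\<close>
      have "card (comp_avoiding x y) \<le> d + 1" if y: "y \<in> V" "y \<noteq> x" for y
      proof (cases "set (v # L) \<inter> comp_avoiding x y = {}")
        case False
        then have "comp_avoiding x y \<subseteq> set (v # L)" using comp_avoiding_least[OF clvL] by blast
        then have "card (comp_avoiding x y) \<le> card (set (v # L))" by (intro card_mono) auto
        then show ?thesis using card_length[of "v # L"] Llen by simp
      next
        case True
        show ?thesis
        proof (rule ccontr)
          assume "\<not> ?thesis"
          then have b: "d + 2 \<le> card (comp_avoiding x y)" by simp
          obtain p where p: "pth p" "set p \<subseteq> comp_avoiding x y" "d + 2 \<le> length p"
            using comp_has_long_path[OF no_long xV y b] .
          have q: "pth (x # v # L)" using arm x xL by blast
          have "x \<notin> comp_avoiding x y" using comp_avoiding_closed[OF xV y] by (auto simp: closed_at_def)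
          then show False using no2[OF p(1) q _ p(3)] p True Llen by auto
        qed
      qed
      then show ?thesis using that xV by blast
    qed
  qed
qed

end

section \<open>Ears of a longest cycle\<close>

lemma mod_add_left_cancel_nat:
  fixes c :: nat assumes "(i + j) mod c = (i + k) mod c" shows "j mod c = k mod c"
proof -
  obtain a b where "i + j + c * a = i + k + c * b" using assms nat_mod_eq_iff by blast
  then have "j + c * a = k + c * b" by simp
  then show ?thesis using nat_mod_eq_iff by blast
qed

text \<open>On a circle of \<open>c\<close> points the arcs of \<open>w i\<close> points that start
  at the elements \<open>i\<close> of \<open>I\<close> are disjoint, because no arc contains a
  second starting point.\<close>

lemma sum_gaps_le:
  fixes c :: nat
  assumes c: "0 < c" and I: "I \<subseteq> {..<c}"
    and w: "\<And>i. i \<in> I \<Longrightarrow> w i \<le> c"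
    and gap: "\<And>i e. i \<in> I \<Longrightarrow> 0 < e \<Longrightarrow> e < w i \<Longrightarrow> (i + e) mod c \<notin> I"
  shows "(\<Sum>i\<in>I. w i) \<le> c"
proof -
  have finI: "finite I" using I finite_subset by blast
  define D where "D = (\<lambda>i. (\<lambda>j. (i + j) mod c) ` {..<w i})"
  have cardD: "card (D i) = w i" if i: "i \<in> I" for i
  proof -
    have "inj_on (\<lambda>j. (i + j) mod c) {..<w i}"
    proof (rule inj_onI)
      fix j k assume jk: "j \<in> {..<w i}" "k \<in> {..<w i}" "(i + j) mod c = (i + k) mod c"
      have "j < c" "k < c" using jk w[OF i] by auto
      then show "j = k" using mod_add_left_cancel_nat[OF jk(3)] by simp
    qed
    then show ?thesis by (simp add: D_def card_image)
  qed
  have disj: "D i \<inter> D k = {}" if ik: "i \<in> I" "k \<in> I" "i \<noteq> k" for i k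
  proof -
    have False if h: "i \<in> I" "k \<in> I" "i \<noteq> k" "j' \<le> j" "j < w i" "(i + j) mod c = (k + j') mod c" for i k j j'
    proof -
      have ij: "i < c" "k < c" "j < c" using h I w[of i] by auto
      obtain s where s: "j = j' + s" using h(4) le_Suc_ex by blast
      have "(i + s) mod c = k mod c"
      proof -
        have "(i + s + j') mod c = (k + j') mod c" using h(6) s by (simp add: ac_simps)
        then show ?thesis using mod_add_left_cancel_nat[of j' "i + s" c k] by (simp add: ac_simps)
      qed
      then have e: "(i + s) mod c = k" using ij by simp
      have "s \<noteq> 0"
      proof
        assume "s = 0"
        then show False using e h(3) ij by simp
      qed
      then show False using gap[OF h(1), of s] e h s by auto
    qed
    then show ?thesis using ik by (auto simp: D_def) (metis nle_le)
  qed
  have "(\<Sum>i\<in>I. w i) = (\<Sum>i\<in>I. card (D i))" using cardD by simp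
  also have "\<dots> = card (\<Union>i\<in>I. D i)"
    using finI disj by (intro card_UN_disjoint[symmetric]) (auto simp: D_def)
  also have "\<dots> \<le> card {..<c}" using c by (intro card_mono) (auto simp: D_def)
  finally show ?thesis by simp
qed

locale lcyc = mgraph +
  fixes cs :: "'a list" and r :: nat
  assumes cs: "cyc cs" and longest: "\<And>zs. cyc zs \<Longrightarrow> length zs \<le> length cs"
    and c2d: "2 * d \<le> length cs"
    and bound: "\<And>p. pth p \<Longrightarrow> length p < 2 * d + 2 + r"
    and r2: "2 * r \<le> d + 1" and rd: "r < d"
    and n: "4 * d + 4 + 2 * r \<le> card V"
begin

text \<open>Reading indices modulo the length lets an arc that passes the end of the list keep
  increasing indices.\<close>

definition at :: "nat \<Rightarrow> 'a" where
  "at i = cs ! (i mod length cs)"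

lemma c3: "3 \<le> length cs" using cs by (simp add: cyc_def)

lemma cs_pos: "0 < length cs" "cs \<noteq> []" using c3 by auto

lemma pth_cs: "pth cs" "distinct cs" "set cs \<subseteq> V" using cs by (auto simp: cyc_def pth_def)

lemma at_in: "at i \<in> set cs" using cs_pos by (simp add: at_def)

lemma in_cs_at: "a \<in> set cs \<Longrightarrow> \<exists>i<length cs. a = at i"
  by (auto simp: in_set_conv_nth at_def)

lemma at_mod [simp]: "at (i mod length cs) = at i" by (simp add: at_def)

lemma at_eq_iff: "i < length cs \<Longrightarrow> j < length cs \<Longrightarrow> at i = at j \<longleftrightarrow> i = j"
  using pth_cs by (simp add: at_def nth_eq_iff_index_eq)

lemma cyc_rotate_n: "cyc zs \<Longrightarrow> cyc (rotate k zs)"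
  by (metis append_take_drop_id cyc_rotate rotate_drop_take)

lemma rot: "cyc (rotate k cs)" "pth (rotate k cs)" "length (rotate k cs) = length cs" "set (rotate k cs) = set cs"
  using cyc_rotate_n[OF cs, of k] by (auto simp: cyc_def)

lemma rot_nth: "e < length cs \<Longrightarrow> rotate k cs ! e = at (k + e)"
  by (simp add: nth_rotate at_def)

lemma rot_hd: "hd (rotate k cs) = at k"
  using rot_nth[of 0 k] cs_pos by (simp add: hd_conv_nth)

text \<open>Any vertex of the cycle may be taken as index 0; facts proved for an aligned cycle are
  transferred by interpreting the locale at the rotated list.\<close>

lemma lcyc_rot: "lcyc V adj d (rotate k cs) r"
  by unfold_locales (use rot longest c2d bound r2 rd n in auto)

lemma lcyc_same_length: "cyc zs \<Longrightarrow> length zs = length cs \<Longrightarrow> lcyc V adj d zs r"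
  by unfold_locales (use longest c2d bound r2 rd n in auto)

lemma adj_at: "adj (at i) (at (Suc i))"
proof -
  have "adj (rotate i cs ! 0) (rotate i cs ! 1)"
    using rot(2)[of i] c3 successively_nth[of adj "rotate i cs" 0] by (simp add: pth_def)
  then show ?thesis using rot_nth[of 0 i] rot_nth[of 1 i] c3 cs_pos by auto
qed

text \<open>Replacing the \<open>e - 1\<close> vertices strictly between the two attachments by
  \<open>ys\<close> gives a cycle, which is not longer than \<open>cs\<close>.\<close>

lemma spacing:
  assumes ys: "pth ys" "ys \<noteq> []" "set ys \<inter> set cs = {}"
    and a: "adj (hd ys) (at i)" "adj (last ys) (at (i + e))" and e: "0 < e" "e < length cs"
  shows "length ys < e"
proof -
  define zs where "zs = rotate i cs"
  have z: "pth zs" "length zs = length cs" "set zs = set cs" "adj (last zs) (hd zs)" "hd zs = at i"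
    using rot[of i] rot_hd[of i] by (auto simp: zs_def cyc_def)
  have dr: "drop e zs \<noteq> []" "hd (drop e zs) = at (i + e)" "last (drop e zs) = last zs"
    using e z rot_nth[OF e(2), of i] by (auto simp: hd_drop_conv_nth zs_def)
  have notin: "at i \<notin> set (drop e zs)"
  proof
    assume "at i \<in> set (drop e zs)"
    moreover have "at i \<in> set (take e zs)"
      using z e by (metis hd_in_set hd_take length_greater_0_conv cs_pos(1) take_eq_Nil not_gr0)
    ultimately show False using z(1) set_take_disj_set_drop_if_distinct[of zs e e] by (auto simp: pth_def)
  qed
  have "set (drop e zs) \<subseteq> set cs" using z set_drop_subset by fast
  then have p: "pth (at i # ys @ drop e zs)"
    using ys a z dr notin at_in[of i] pth_cs(3) pth_drop[OF z(1)]
    by (auto simp: pth_Cons pth_append hd_append adj_commute)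
  have "cyc (at i # ys @ drop e zs)"
    unfolding cyc_def using p dr z e ys by (cases ys) auto
  then have "length (at i # ys @ drop e zs) \<le> length cs" by (rule longest)
  then show ?thesis using z e by simp
qed

lemma spacing1:
  assumes "y \<in> V" "y \<notin> set cs" "adj y (at i)" "adj y (at (i + e))" "0 < e" "e < length cs"
  shows "2 \<le> e"
  using spacing[of "[y]" i e] assms by auto

text \<open>A union of components of the graph without the cycle.\<close>

definition closedR :: "'a set \<Rightarrow> bool" where
  "closedR S \<longleftrightarrow> S \<subseteq> V - set cs \<and> (\<forall>x\<in>S. nb x \<subseteq> S \<union> set cs)"

definition touch :: "'a \<Rightarrow> bool" where
  "touch x \<longleftrightarrow> nb x \<inter> set cs \<noteq> {}"

text \<open>Only the first vertex is required to see the cycle; that the last one does follows from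
  maximality and the degrees (\<open>ear_touch_last\<close>). Maximality is relative to
  \<open>S\<close>, so that a further ear can be taken from what earlier ones leave.\<close>

definition ear :: "'a set \<Rightarrow> 'a list \<Rightarrow> bool" where
  "ear S ys \<longleftrightarrow> pth ys \<and> ys \<noteq> [] \<and> set ys \<subseteq> S \<and> touch (hd ys) \<and>
     (\<forall>zs. pth zs \<longrightarrow> zs \<noteq> [] \<longrightarrow> set zs \<subseteq> S \<longrightarrow> touch (hd zs) \<longrightarrow> length zs \<le> length ys)"

lemma earD:
  assumes "ear S ys"
  shows "pth ys" "ys \<noteq> []" "set ys \<subseteq> S" "touch (hd ys)"
    "\<And>zs. pth zs \<Longrightarrow> zs \<noteq> [] \<Longrightarrow> set zs \<subseteq> S \<Longrightarrow> touch (hd zs) \<Longrightarrow> length zs \<le> length ys"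
  using assms unfolding ear_def by blast+

lemma closedR_touch:
  assumes "closedR S" "S \<noteq> {}" obtains x where "x \<in> S" "touch x"
proof -
  have "S \<subseteq> V" "S \<noteq> V" using assms at_in[of 0] pth_cs(3) by (auto simp: closedR_def)
  then obtain x y where xy: "x \<in> S" "y \<notin> S" "adj x y" using conn_cut[of S] assms(2) by metis
  then have "y \<in> S \<union> set cs" using assms(1) unfolding closedR_def by (metis nb_iff subsetD)
  then have "touch x" using xy by (auto simp: touch_def)
  then show ?thesis using that xy by blast
qed

lemma ear_exists:
  assumes "closedR S" "S \<noteq> {}" obtains ys where "ear S ys"
proof -
  define P where "P = {ys. pth ys \<and> ys \<noteq> [] \<and> set ys \<subseteq> S \<and> touch (hd ys)}"
  have finP: "finite P" unfolding P_def by (rule finite_subset[OF _ finite_pths]) auto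
  obtain x where "x \<in> S" "touch x" using closedR_touch[OF assms] .
  then have "[x] \<in> P" using assms(1) by (auto simp: P_def closedR_def)
  then have "Max (length ` P) \<in> length ` P" using finP by (intro Max_in) auto
  then obtain ys where ys: "ys \<in> P" "length ys = Max (length ` P)" by auto
  then have "length zs \<le> length ys" if "zs \<in> P" for zs using that finP by simp
  then have "ear S ys" using ys(1) unfolding P_def ear_def by blast
  then show ?thesis using that by blast
qed

text \<open>Opening the cycle at the attachment and continuing along the ear gives a path on
  \<open>length cs + length ys\<close> vertices.\<close>

lemma ear_length:
  assumes "S \<subseteq> V - set cs" "ear S ys" shows "length cs + length ys \<le> 2 * d + 1 + r"
proof -
  obtain a where "adj (hd ys) a" "a \<in> set cs" using earD(4)[OF assms(2)] by (auto simp: touch_def)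
  then obtain i where i: "adj (hd ys) (at i)" using in_cs_at by blast
  have "pth (rev ys @ rotate i cs)"
    using earD(1-3)[OF assms(2)] assms(1) rot(2)[of i] i rot_hd[of i]
    by (auto simp: pth_append last_rev)
  then show ?thesis using bound by fastforce
qed

lemma ear_length_le:
  assumes "S \<subseteq> V - set cs" "ear S ys" shows "length ys \<le> r + 1"
  using ear_length[OF assms] c2d by linarith

text \<open>By maximality the last vertex sees only the ear and the cycle, and at most
  \<open>length ys - 1\<close> of its neighbours are on the ear.\<close>

lemma ear_last:
  assumes "closedR S" "ear S ys"
  shows "d + 1 \<le> length ys + card (nb (last ys) \<inter> set cs)"
proof -
  note e = earD[OF assms(2)]
  let ?e = "last ys"
  have eS: "?e \<in> set ys" "?e \<in> V" using e(1,2) by (auto simp: pth_def)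
  have "nb ?e \<subseteq> (set ys - {?e}) \<union> (nb ?e \<inter> set cs)"
  proof
    fix y assume y: "y \<in> nb ?e"
    show "y \<in> (set ys - {?e}) \<union> (nb ?e \<inter> set cs)"
    proof (cases "y \<in> set cs")
      case False
      then have yS: "y \<in> S" using assms(1) eS(1) e(3) y unfolding closedR_def by blast
      have "y \<in> set ys"
      proof (rule ccontr)
        assume "y \<notin> set ys"
        then have "pth (ys @ [y])" using e y adj_in2 by (auto simp: pth_append)
        then have "length (ys @ [y]) \<le> length ys" using e yS by (intro e(5)) auto
        then show False by simp
      qed
      then show ?thesis using y adj_irrefl by auto
    qed (use y in auto)
  qed
  then have "card (nb ?e) \<le> card ((set ys - {?e}) \<union> (nb ?e \<inter> set cs))" by (intro card_mono) auto
  also have "\<dots> \<le> card (set ys - {?e}) + card (nb ?e \<inter> set cs)" by (rule card_Un_le)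
  also have "card (set ys - {?e}) = length ys - 1" using e(1) eS by (simp add: pth_def distinct_card card_Diff_singleton)
  finally show ?thesis using deg[OF eS(2)] e(2) by (cases ys) auto
qed

text \<open>The ear has at most r + 1 <= d vertices, too few to hold all neighbours of its last
  vertex. Hence the reversed list is an ear as well, and both ends are on an equal footing.\<close>

lemma ear_touch_last:
  assumes "closedR S" "ear S ys" shows "touch (last ys)"
proof -
  have "length ys \<le> d" using ear_length_le[OF _ assms(2)] assms(1) rd by (auto simp: closedR_def)
  then have "card (nb (last ys) \<inter> set cs) \<noteq> 0" using ear_last[OF assms] by linarith
  then show ?thesis by (auto simp: touch_def)
qed

lemma ear_rev:
  assumes "closedR S" "ear S ys" shows "ear S (rev ys)"
  using assms(2) ear_touch_last[OF assms] unfolding ear_def by (auto simp: hd_rev)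

lemma ear_hd:
  assumes "closedR S" "ear S ys"
  shows "d + 1 \<le> length ys + card (nb (hd ys) \<inter> set cs)"
  using ear_last[OF assms(1) ear_rev[OF assms]] by (simp add: last_rev)

lemma ear_same:
  assumes "closedR S" "ear S ys" "pth zs" "set zs \<subseteq> S" "length zs = length ys" "touch (last zs)"
  shows "ear S zs"
proof -
  have "ear S (rev zs)"
    unfolding ear_def using assms earD[OF assms(2)] by (auto simp: hd_rev)
  then show ?thesis using ear_rev[OF assms(1)] by fastforce
qed

text \<open>Attachments of the same end are at least 2 steps apart on the cycle, those of different
  ends more than |ys| steps. So each attachment starts a gap of at least 2 and each common one a gap
  of at least |ys| + 1; and as soon as there are two attachments, at least two gaps are of the
  larger kind.\<close>

lemma ear_count:
  assumes S: "closedR S" and e: "ear S ys"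
    and A: "A = nb (hd ys) \<inter> set cs" and B: "B = nb (last ys) \<inter> set cs"
  shows "2 * card (A \<union> B) + (length ys - 1) * card (A \<inter> B) \<le> length cs"
    and "2 \<le> card (A \<union> B) \<Longrightarrow> 2 * card (A \<union> B) + 2 * (length ys - 1) \<le> length cs"
proof -
  note ed = earD[OF e]
  define c where "c = length cs"
  define q where "q = length ys"
  have SR: "S \<subseteq> V - set cs" using S by (simp add: closedR_def)
  have ysR: "set ys \<inter> set cs = {}" using ed(3) SR by blast
  have q1: "1 \<le> q" using ed(2) by (cases ys) (auto simp: q_def)
  have qc: "q < c" "2 \<le> c" "0 < c" using ear_length_le[OF SR e] rd c2d c3 by (auto simp: q_def c_def)
  define ind where "ind = (\<lambda>X. {i. i < c \<and> at i \<in> X})"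
  have bij: "card (ind X) = card X" if "X \<subseteq> set cs" for X
  proof -
    have "at ` ind X = X" using that in_cs_at by (auto simp: ind_def c_def)
    moreover have "inj_on at (ind X)" by (rule inj_onI) (simp add: ind_def c_def at_eq_iff)
    ultimately show ?thesis by (metis card_image)
  qed
  have hdl: "hd ys \<in> V" "hd ys \<notin> set cs" "last ys \<in> V" "last ys \<notin> set cs"
    using ed(1) ysR hd_in_set[OF ed(2)] last_in_set[OF ed(2)] unfolding pth_def by blast+
  have AB: "A \<subseteq> set cs" "B \<subseteq> set cs" "A \<union> B \<subseteq> set cs" "A \<inter> B \<subseteq> set cs" using A B by auto
  have sp: "q < e" if "at i \<in> A \<and> at (i + e) \<in> B \<or> at i \<in> B \<and> at (i + e) \<in> A" "0 < e" "e < c" for i e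
  proof -
    have "length ys < e" if "at i \<in> A" "at (i + e) \<in> B"
      using spacing[of ys i e] that ed ysR \<open>0 < e\<close> \<open>e < c\<close> by (auto simp: A B c_def)
    moreover have "length (rev ys) < e" if "at i \<in> B" "at (i + e) \<in> A"
      using spacing[of "rev ys" i e] that ed ysR \<open>0 < e\<close> \<open>e < c\<close> by (auto simp: A B c_def hd_rev last_rev)
    ultimately show ?thesis using that(1) by (auto simp: q_def)
  qed
  have sp2: "2 \<le> e" if "at i \<in> A \<union> B" "at (i + e) \<in> A \<union> B" "0 < e" "e < c" for i e
  proof -
    have "2 \<le> e" if "at i \<in> A" "at (i + e) \<in> A"
      using spacing1[of "hd ys" i e] that hdl \<open>0 < e\<close> \<open>e < c\<close> by (auto simp: A c_def)
    moreover have "2 \<le> e" if "at i \<in> B" "at (i + e) \<in> B"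
      using spacing1[of "last ys" i e] that hdl \<open>0 < e\<close> \<open>e < c\<close> by (auto simp: B c_def)
    ultimately show ?thesis using that sp[of i e] q1 by fastforce
  qed
  define I where "I = ind (A \<union> B)"
  \<comment> \<open>The attachments after which the next \<open>q\<close> steps are free of
    attachments.\<close>
  define Big where "Big = {i \<in> I. \<forall>e. 0 < e \<longrightarrow> e \<le> q \<longrightarrow> (i + e) mod c \<notin> I}"
  have Imem: "(k mod c) \<in> I \<longleftrightarrow> at k \<in> A \<union> B" for k
    using qc by (auto simp: I_def ind_def c_def)
  have Ilt: "i < c" "at i \<in> A \<union> B" if "i \<in> I" for i using that by (auto simp: I_def ind_def)
  have finI: "finite I" by (simp add: I_def ind_def)
  have BigI: "Big \<subseteq> I" by (auto simp: Big_def)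
  have sub: "ind (A \<inter> B) \<subseteq> Big"
  proof
    fix i assume i: "i \<in> ind (A \<inter> B)"
    then have "i \<in> I" by (auto simp: I_def ind_def)
    moreover have "(i + e) mod c \<notin> I" if e: "0 < e" "e \<le> q" for e
    proof
      assume "(i + e) mod c \<in> I"
      then have "at (i + e) \<in> A \<union> B" using Imem by blast
      then have "q < e" using sp[of i e] i e qc by (auto simp: ind_def)
      then show False using e by simp
    qed
    ultimately show "i \<in> Big" by (simp add: Big_def)
  qed
  have main: "2 * card I + (q - 1) * card Big \<le> c"
  proof -
    have "(\<Sum>i\<in>I. if i \<in> Big then q + 1 else 2) \<le> c"
    proof (rule sum_gaps_le)
      show "(i + e) mod c \<notin> I" if "i \<in> I" "0 < e" "e < (if i \<in> Big then q + 1 else 2)" for i e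
      proof (cases "i \<in> Big")
        case True then show ?thesis using that by (auto simp: Big_def)
      next
        case False
        then have "e = 1" using that by auto
        then show ?thesis using sp2[of i e] Ilt[OF that(1)] qc Imem[of "i + e"] by auto
      qed
    qed (use qc Ilt in auto)
    also have "(\<Sum>i\<in>I. if i \<in> Big then q + 1 else 2) = (\<Sum>i\<in>I. 2 + (if i \<in> Big then q - 1 else 0))"
      using q1 by (intro sum.cong) auto
    also have "\<dots> = 2 * card I + (\<Sum>i\<in>I. if i \<in> Big then q - 1 else 0)"
      by (subst sum.distrib) simp
    also have "(\<Sum>i\<in>I. if i \<in> Big then q - 1 else 0) = (\<Sum>i\<in>I \<inter> Big. q - 1)"
      by (rule sum.inter_restrict[OF finI, symmetric])
    also have "I \<inter> Big = Big" using BigI by blast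
    also have "(\<Sum>i\<in>Big. q - 1) = (q - 1) * card Big" by simp
    finally show ?thesis .
  qed
  have cI: "card I = card (A \<union> B)" unfolding I_def by (rule bij[OF AB(3)])
  have cAB: "card (ind (A \<inter> B)) = card (A \<inter> B)" by (rule bij[OF AB(4)])
  have finBig: "finite Big" using finI BigI finite_subset by blast
  have "card (A \<inter> B) \<le> card Big" using card_mono[OF finBig sub] cAB by simp
  then have "(q - 1) * card (A \<inter> B) \<le> (q - 1) * card Big" by simp
  then show "2 * card (A \<union> B) + (length ys - 1) * card (A \<inter> B) \<le> length cs"
    using main cI unfolding q_def c_def by linarith
  assume u2: "2 \<le> card (A \<union> B)"
  have step: "\<exists>e. 0 < e \<and> e < c \<and> (i + e) mod c = j" if "i < c" "j < c" "i \<noteq> j" for i j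
  proof (cases "i < j")
    case True then show ?thesis using that by (intro exI[of _ "j - i"]) auto
  next
    case False
    then have "(i + (c - i + j)) mod c = j" using that by simp
    then show ?thesis using that False by (intro exI[of _ "c - i + j"]) auto
  qed
  have "2 \<le> card Big"
  proof (cases "2 \<le> card (A \<inter> B)")
    case True then show ?thesis using \<open>card (A \<inter> B) \<le> card Big\<close> by linarith
  next
    case small: False
    show ?thesis
    proof (cases "A \<inter> B = {}")
      case True
      \<comment> \<open>Choose a vertex of \<open>X\<close> and a later one of \<open>Y\<close> at
        least distance \<open>e\<close>. Within the first \<open>q\<close> steps there is no vertex
        of \<open>Y\<close> by the spacing and none of \<open>X\<close> by the minimality of
        \<open>e\<close>.\<close>
      have first: "\<exists>i\<in>Big. at i \<in> X" if XY: "X \<union> Y = A \<union> B" "X = A \<and> Y = B \<or> X = B \<and> Y = A" "X \<noteq> {}" "Y \<noteq> {}" for X Y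
      proof -
        have "\<exists>e i. 0 < e \<and> e < c \<and> i \<in> I \<and> at i \<in> X \<and> at (i + e) \<in> Y"
        proof -
          obtain a b where "a \<in> X" "b \<in> Y" using XY by blast
          then obtain i j where "i < c" "j < c" "at i = a" "at j = b" using XY AB in_cs_at c_def by (metis Un_iff subsetD)
          moreover have "a \<noteq> b" using \<open>a \<in> X\<close> \<open>b \<in> Y\<close> XY True by blast
          ultimately obtain e where "0 < e" "e < c" "(i + e) mod c = j" using step[of i j] by blast
          then have "at (i + e) = b" using \<open>at j = b\<close> by (metis at_mod c_def)
          moreover have "i \<in> I" using \<open>i < c\<close> \<open>at i = a\<close> \<open>a \<in> X\<close> XY(1) by (auto simp: I_def ind_def)
          ultimately show ?thesis using \<open>0 < e\<close> \<open>e < c\<close> \<open>at i = a\<close> \<open>a \<in> X\<close> \<open>b \<in> Y\<close> by blast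
        qed
        then obtain e where ex: "\<exists>i. 0 < e \<and> e < c \<and> i \<in> I \<and> at i \<in> X \<and> at (i + e) \<in> Y"
          and least: "\<And>f. f < e \<Longrightarrow> \<not> (\<exists>i. 0 < f \<and> f < c \<and> i \<in> I \<and> at i \<in> X \<and> at (i + f) \<in> Y)"
          using exists_least_iff[of "\<lambda>e. \<exists>i. 0 < e \<and> e < c \<and> i \<in> I \<and> at i \<in> X \<and> at (i + e) \<in> Y"] by blast
        then obtain i where i: "0 < e" "e < c" "i \<in> I" "at i \<in> X" "at (i + e) \<in> Y" by blast
        have qe: "q < e" using sp[of i e] i XY(2) by blast
        have "(i + f) mod c \<notin> I" if f: "0 < f" "f \<le> q" for f
        proof
          assume "(i + f) mod c \<in> I"
          then have "at (i + f) \<in> X \<union> Y" using Imem XY by blast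
          then show False
          proof
            assume "at (i + f) \<in> Y"
            then show False using sp[of i f] i XY(2) f qc by auto
          next
            assume fX: "at (i + f) \<in> X"
            have fI: "(i + f) mod c \<in> I" by fact
            obtain g where g: "e = f + g" "0 < g" using f qe less_imp_add_positive[of f e] by auto
            have "at ((i + f) mod c + g) = at (i + e)"
              unfolding g by (simp add: at_def c_def mod_add_left_eq add.assoc)
            moreover have "at ((i + f) mod c) = at (i + f)" by (simp add: c_def)
            ultimately have "\<exists>i. 0 < g \<and> g < c \<and> i \<in> I \<and> at i \<in> X \<and> at (i + g) \<in> Y"
              using f g i fX fI by (intro exI[of _ "(i + f) mod c"]) simp
            moreover have "g < e" using g f by simp
            ultimately show False using least[of g] by blast
          qed
        qed
        then have "i \<in> Big" using i by (simp add: Big_def)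
        then show ?thesis using i by blast
      qed
      have ne: "A \<noteq> {}" "B \<noteq> {}"
        using ear_touch_last[OF S e] ed(4) by (auto simp: A B touch_def)
      obtain i j where "i \<in> Big" "at i \<in> A" "j \<in> Big" "at j \<in> B"
        using first[of A B] first[of B A] ne by blast
      moreover have "i \<noteq> j" using calculation True by blast
      ultimately have "card {i, j} \<le> card Big" using finBig by (intro card_mono) auto
      then show ?thesis using \<open>i \<noteq> j\<close> by simp
    next
      case False
      \<comment> \<open>With a single common attachment \<open>x\<close>, the second large gap is
        the one that ends in \<open>x\<close>: it starts at the attachment \<open>u\<close> that
        precedes \<open>x\<close> most closely.\<close>
      then obtain x where x: "x < c" "at x \<in> A" "at x \<in> B" using AB in_cs_at c_def by (metis Int_iff equals0I subsetD)
      then have xB: "x \<in> Big" using sub by (auto simp: ind_def)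
      have "\<not> I \<subseteq> {x}"
      proof
        assume "I \<subseteq> {x}"
        then have "card I \<le> card {x}" by (intro card_mono) auto
        then show False using u2 cI by simp
      qed
      then obtain u0 where u0: "u0 \<in> I" "u0 \<noteq> x" by blast
      then obtain e0 where "0 < e0" "e0 < c" "(u0 + e0) mod c = x" using step[of u0 x] Ilt x by blast
      then have "\<exists>e u. 0 < e \<and> e < c \<and> u \<in> I \<and> u \<noteq> x \<and> (u + e) mod c = x" using u0 by blast
      then obtain e where ex: "\<exists>u. 0 < e \<and> e < c \<and> u \<in> I \<and> u \<noteq> x \<and> (u + e) mod c = x"
        and least: "\<And>f. f < e \<Longrightarrow> \<not> (\<exists>u. 0 < f \<and> f < c \<and> u \<in> I \<and> u \<noteq> x \<and> (u + f) mod c = x)"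
        using exists_least_iff[of "\<lambda>e. \<exists>u. 0 < e \<and> e < c \<and> u \<in> I \<and> u \<noteq> x \<and> (u + e) mod c = x"] by blast
      then obtain u where u: "0 < e" "e < c" "u \<in> I" "u \<noteq> x" "(u + e) mod c = x" by blast
      have atx: "at (u + e) = at x" using u(5) by (metis at_mod c_def)
      have qe: "q < e" using sp[of u e] Ilt[OF u(3)] x u atx by auto
      have "(u + f) mod c \<notin> I" if f: "0 < f" "f \<le> q" for f
      proof
        assume fI: "(u + f) mod c \<in> I"
        have "(u + f) mod c \<noteq> x"
        proof
          assume "(u + f) mod c = x"
          then have "at (u + f) = at x" by (metis at_mod c_def)
          then show False using sp[of u f] Ilt[OF u(3)] x f qc by auto
        qed
        moreover obtain g where g: "e = f + g" "0 < g" using f qe less_imp_add_positive[of f e] by auto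
        moreover have "((u + f) mod c + g) mod c = x" using u(5) unfolding g by (simp add: mod_add_left_eq add.assoc)
        ultimately show False using least[of g] f fI u by auto
      qed
      then have "u \<in> Big" using u by (simp add: Big_def)
      then have "card {u, x} \<le> card Big" using finBig xB by (intro card_mono) auto
      then show ?thesis using u by simp
    qed
  qed
  then have "(q - 1) * 2 \<le> (q - 1) * card Big" by simp
  then show "2 * card (A \<union> B) + 2 * (length ys - 1) \<le> length cs"
    using main cI unfolding q_def c_def by linarith
qed


section \<open>Ears on at least two vertices\<close>

lemma closedR_all: "closedR (V - set cs)"
  using adj_in2 by (auto simp: closedR_def)

lemma ear_last_nb:
  assumes "closedR S" "ear S ys"
  shows "nb (last ys) \<subseteq> (set ys - {last ys}) \<union> (nb (last ys) \<inter> set cs)"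
proof
  note e = earD[OF assms(2)]
  fix y assume y: "y \<in> nb (last ys)"
  have eS: "last ys \<in> set ys" using e(2) by simp
  show "y \<in> (set ys - {last ys}) \<union> (nb (last ys) \<inter> set cs)"
  proof (cases "y \<in> set cs")
    case False
    then have yS: "y \<in> S" using assms(1) eS e(3) y unfolding closedR_def by blast
    have "y \<in> set ys"
    proof (rule ccontr)
      assume "y \<notin> set ys"
      then have "pth (ys @ [y])" using e y adj_in2 by (auto simp: pth_append)
      then have "length (ys @ [y]) \<le> length ys" using e yS by (intro e(5)) auto
      then show False by simp
    qed
    then show ?thesis using y adj_irrefl by auto
  qed (use y in auto)
qed

text \<open>The only parameters for which the complement of a longest cycle can contain an edge.\<close>

definition sporadic :: "nat \<Rightarrow> nat \<Rightarrow> nat \<Rightarrow> nat \<Rightarrow> bool" where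
  "sporadic q d' r' c \<longleftrightarrow> (d', q, r', c) \<in> {(2,2,1,4), (3,2,1,6), (3,2,2,6), (3,2,2,7), (3,3,2,6),
     (4,2,2,9), (4,3,2,8), (5,2,3,12), (5,4,3,10)}"

text \<open>\<open>q\<close> is the order of the ear, \<open>al\<close> and \<open>be\<close> count
  the attachments of its ends, \<open>s\<close> the common ones and \<open>u\<close> all of them;
  \<open>I1\<close> and \<open>I2\<close> are the gap counts. A single attachment forces q = d.
  Otherwise \<open>I2\<close> gives s >= 2, then \<open>I1\<close> gives q <= 4 and d <= 5, and a
  few cases remain.\<close>

lemma sporadic_arith:
  fixes al be s u q c d' r' :: nat
  assumes q: "2 \<le> q" "q \<le> r' + 1" "c + q \<le> 2 * d' + 1 + r'" "2 * d' \<le> c" "2 * r' \<le> d' + 1" "r' < d'"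
    and ab: "d' + 1 \<le> q + al" "d' + 1 \<le> q + be" "s \<le> al" "s \<le> be" "al + be = u + s" "al \<le> u" "be \<le> u"
    and I1: "2 * u + (q - 1) * s \<le> c" and I2: "2 \<le> u \<Longrightarrow> 2 * u + 2 * (q - 1) \<le> c"
  shows "al = s \<and> be = s \<and> al + q = d' + 1 \<and> sporadic q d' r' c"
proof (cases "2 \<le> u")
  case False
  then have u1: "u = 1" "al = 1" "be = 1" "s = 1" using ab q by linarith+
  then have "d' = q" using ab q by linarith
  then have "d' \<le> 3" using q by linarith
  then have "d' = 2 \<or> d' = 3" using \<open>d' = q\<close> q by linarith
  then show ?thesis
  proof
    assume d2: "d' = 2"
    then have "r' = 1" "c = 4" using q \<open>d' = q\<close> by linarith+
    then show ?thesis using d2 \<open>d' = q\<close> u1 by (simp add: sporadic_def)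
  next
    assume d3: "d' = 3"
    then have "r' = 2" "c = 6" using q \<open>d' = q\<close> by linarith+
    then show ?thesis using d3 \<open>d' = q\<close> u1 by (simp add: sporadic_def)
  qed
next
  case True
  have i2: "2 * u + 2 * (q - 1) \<le> c" using I2[OF True] .
  have s2: "2 \<le> s"
  proof (rule ccontr)
    assume "\<not> 2 \<le> s"
    then show False using i2 q ab True by linarith
  qed
  have q4: "q \<le> 4"
  proof (rule ccontr)
    assume "\<not> q \<le> 4"
    then obtain k where k: "q = k + 5" using le_Suc_ex[of 5 q] by (auto simp: add.commute)
    have "(q - 1) * s = 2 * s + (k + 2) * s" using k by (simp add: algebra_simps)
    moreover have "(k + 2) * 2 \<le> (k + 2) * s" by (rule mult_le_mono2[OF s2])
    ultimately have "2 * u + 2 * s + (k + 2) * 2 \<le> c" using I1 by linarith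
    then have "2 * u + 2 * s + 2 * k + 4 \<le> c" by simp
    moreover have "5 \<le> q" using k by simp
    ultimately show False using q ab k by linarith
  qed
  consider "q = 2" | "q = 3" | "q = 4" using q4 q(1) by linarith
  then show ?thesis
  proof cases
    case 1
    then have i: "2 * u + s \<le> c" using I1 by simp
    then have d5: "d' \<le> 5" using q ab 1 by linarith
    have st: "al + q = d' + 1 \<and> be + q = d' + 1 \<and> s = al" using i q ab 1 True i2 d5 by linarith
    have "2 \<le> al" using st s2 by simp
    then consider "d' = 3" | "d' = 4" | "d' = 5" using st 1 d5 by linarith
    then show ?thesis
    proof cases
      case d: 1
      have "1 \<le> r'" "r' \<le> 2" "6 \<le> c" "c \<le> 5 + r'" using st i q ab 1 d by linarith+
      then have "r' = 1 \<and> c = 6 \<or> r' = 2 \<and> c = 6 \<or> r' = 2 \<and> c = 7" by arith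
      then show ?thesis using st 1 d by (auto simp: sporadic_def)
    next
      case d: 2
      have "r' = 2" "c = 9" using st i q ab 1 d by linarith+
      then show ?thesis using st 1 d by (auto simp: sporadic_def)
    next
      case d: 3
      have "r' = 3" "c = 12" using st i q ab 1 d by linarith+
      then show ?thesis using st 1 d by (auto simp: sporadic_def)
    qed
  next
    case 2
    then have i: "2 * u + 2 * s \<le> c" using I1 by simp
    have d4: "d' \<le> 4" using i q ab 2 by linarith
    have c8: "8 \<le> c" using i ab s2 by linarith
    have "4 \<le> d'" using c8 q 2 by linarith
    then have "d' = 4" using d4 by simp
    moreover have "r' = 2" "c = 8" using c8 q 2 calculation by linarith+
    moreover have "al = 2" "be = 2" "s = 2" using i ab s2 calculation by linarith+
    ultimately show ?thesis using 2 by (auto simp: sporadic_def)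
  next
    case 3
    then have i: "2 * u + 3 * s \<le> c" using I1 by simp
    have d5: "d' \<le> 5" using i q ab 3 s2 by linarith
    have c10: "10 \<le> c" using i ab s2 by linarith
    have "5 \<le> d'" using c10 q 3 by linarith
    then have "d' = 5" using d5 by simp
    moreover have "r' = 3" "c = 10" using c10 q 3 calculation by linarith+
    moreover have "al = 2" "be = 2" "s = 2" using i ab s2 calculation by linarith+
    ultimately show ?thesis using 3 by (auto simp: sporadic_def)
  qed
qed

text \<open>The arithmetic leaves only equality: both ends have as many attachments as they have in
  common, hence the same ones.\<close>

lemma ear_params:
  assumes S: "closedR S" and e: "ear S ys" and q: "2 \<le> length ys"
  shows "nb (hd ys) \<inter> set cs = nb (last ys) \<inter> set cs"
    and "card (nb (hd ys) \<inter> set cs) + length ys = d + 1"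
    and "sporadic (length ys) d r (length cs)"
proof -
  define A where "A = nb (hd ys) \<inter> set cs"
  define B where "B = nb (last ys) \<inter> set cs"
  have fin': "finite A" "finite B" by (auto simp: A_def B_def)
  have SR: "S \<subseteq> V - set cs" using S by (simp add: closedR_def)
  have main: "card A = card (A \<inter> B) \<and> card B = card (A \<inter> B) \<and> card A + length ys = d + 1 \<and> sporadic (length ys) d r (length cs)"
  proof (rule sporadic_arith[OF q ear_length_le[OF SR e] ear_length[OF SR e] c2d r2 rd])
    show "d + 1 \<le> length ys + card A" using ear_hd[OF S e] by (simp add: A_def)
    show "d + 1 \<le> length ys + card B" using ear_last[OF S e] by (simp add: B_def)
    show "card (A \<inter> B) \<le> card A" "card (A \<inter> B) \<le> card B" using fin' by (auto intro: card_mono)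
    show "card A + card B = card (A \<union> B) + card (A \<inter> B)" using fin' by (rule card_Un_Int)
    show "card A \<le> card (A \<union> B)" "card B \<le> card (A \<union> B)" using fin' by (auto intro: card_mono)
    show "2 * card (A \<union> B) + (length ys - 1) * card (A \<inter> B) \<le> length cs"
      by (rule ear_count(1)[OF S e A_def B_def])
    show "2 * card (A \<union> B) + 2 * (length ys - 1) \<le> length cs" if "2 \<le> card (A \<union> B)"
      by (rule ear_count(2)[OF S e A_def B_def that])
  qed
  have "A \<inter> B = A" by (rule card_subset_eq) (use main fin' in auto)
  moreover have "A \<inter> B = B" by (rule card_subset_eq) (use main fin' in auto)
  ultimately have "A = B" by simp
  then show "nb (hd ys) \<inter> set cs = nb (last ys) \<inter> set cs" unfolding A_def B_def .
  show "card (nb (hd ys) \<inter> set cs) + length ys = d + 1" "sporadic (length ys) d r (length cs)"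
    using main by (auto simp: A_def)
qed

text \<open>With q vertices on the ear, the last one has at most q - 1 neighbours there and d + 1 -
  q on the cycle, which together only just reach the degree bound.\<close>

lemma ear_last_full:
  assumes S: "closedR S" and e: "ear S ys" and q: "2 \<le> length ys"
  shows "nb (last ys) = (set ys - {last ys}) \<union> (nb (last ys) \<inter> set cs)"
proof (rule card_subset_eq)
  note ed = earD[OF e]
  show "finite ((set ys - {last ys}) \<union> (nb (last ys) \<inter> set cs))" by simp
  show sub: "nb (last ys) \<subseteq> (set ys - {last ys}) \<union> (nb (last ys) \<inter> set cs)" by (rule ear_last_nb[OF S e])
  have "card ((set ys - {last ys}) \<union> (nb (last ys) \<inter> set cs)) \<le> card (set ys - {last ys}) + card (nb (last ys) \<inter> set cs)"
    by (rule card_Un_le)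
  also have "card (set ys - {last ys}) = length ys - 1"
    using ed by (simp add: pth_def distinct_card card_Diff_singleton)
  finally have "card ((set ys - {last ys}) \<union> (nb (last ys) \<inter> set cs)) \<le> d"
    using ear_params(1,2)[OF S e q] q by simp
  moreover have "last ys \<in> V" using ed(1,2) by (auto simp: pth_def)
  moreover have "card (nb (last ys)) \<le> card ((set ys - {last ys}) \<union> (nb (last ys) \<inter> set cs))"
    using sub by (intro card_mono) auto
  ultimately show "card (nb (last ys)) = card ((set ys - {last ys}) \<union> (nb (last ys) \<inter> set cs))"
    using deg[of "last ys"] by linarith
qed

text \<open>The last vertex sees the first, so the ear closes up and may be started anywhere; each
  rotation is again a longest path with the same attachments.\<close>

lemma ear_rotate:
  assumes S: "closedR S" and e: "ear S ys" and q: "2 \<le> length ys"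
  shows "ear S (rotate k ys)" "nb (last (rotate k ys)) \<inter> set cs = nb (last ys) \<inter> set cs"
proof (induction k)
  case 0
  { case 1 then show ?case using e by simp }
  { case 2 then show ?case by simp }
next
  case (Suc k)
  define zs where "zs = rotate k ys"
  have ez: "ear S zs" and nz: "nb (last zs) \<inter> set cs = nb (last ys) \<inter> set cs" and lz: "length zs = length ys"
    using Suc by (auto simp: zs_def)
  note ed = earD[OF ez]
  have qz: "2 \<le> length zs" using q lz by simp
  obtain y ws where zc: "zs = y # ws" using ed(2) by (cases zs) auto
  have wne: "ws \<noteq> []" using q lz zc by auto
  have "last ws \<noteq> y" using ed(1) zc wne by (auto simp: pth_def)
  moreover have lw: "last zs = last ws" using zc wne by simp
  ultimately have "adj (last ws) y" using ear_last_full[OF S ez qz] zc by (metis DiffI UnCI list.set_intros(1) nb_iff singletonD)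
  then have p: "pth (ws @ [y])" using ed(1) zc wne by (auto simp: pth_Cons pth_append)
  have ty: "touch y" using ed(4) zc by simp
  have "ear S (ws @ [y])" by (rule ear_same[OF S ez p]) (use ed zc ty in auto)
  then have er: "ear S (rotate (Suc k) ys)" using zc by (simp add: zs_def[symmetric])
  { case 1 then show ?case by (rule er) }
  { case 2
    have "nb y \<inter> set cs = nb (last zs) \<inter> set cs" using ear_params(1)[OF S ez qz] zc by simp
    then show ?case using nz zc by (simp add: zs_def[symmetric]) }
qed

text \<open>Every vertex is the last one of some rotation. So the ear spans a clique, and this
  clique is a whole component off the cycle.\<close>

lemma ear_clique:
  assumes S: "closedR S" and e: "ear S ys" and q: "2 \<le> length ys" and y: "y \<in> set ys"
  shows "nb y = (set ys - {y}) \<union> (nb (hd ys) \<inter> set cs)"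
proof -
  note ed = earD[OF e]
  obtain us vs where uv: "ys = us @ y # vs" using y by (meson split_list)
  have r: "rotate (Suc (length us)) ys = vs @ us @ [y]"
    unfolding uv using rotate_append[of "us @ [y]" vs] by simp
  define zs where "zs = vs @ us @ [y]"
  have zs: "last zs = y" "set zs = set ys" "length zs = length ys" by (auto simp: zs_def uv)
  have er: "ear S zs" using ear_rotate(1)[OF S e q, of "Suc (length us)"] r by (simp add: zs_def)
  have n1: "nb (last zs) \<inter> set cs = nb (last ys) \<inter> set cs"
    using ear_rotate(2)[OF S e q, of "Suc (length us)"] r by (simp add: zs_def)
  have "nb (last zs) = (set zs - {last zs}) \<union> (nb (last zs) \<inter> set cs)"
    by (rule ear_last_full[OF S er]) (use q zs in simp)
  then show ?thesis using n1 ear_params(1)[OF S e q] unfolding zs(1,2) by metis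
qed

lemma ear_remove:
  assumes S: "closedR S" and e: "ear S ys" and q: "2 \<le> length ys"
  shows "closedR (S - set ys)"
proof -
  have "b \<in> (S - set ys) \<union> set cs" if a: "a \<in> S - set ys" "adj a b" for a b
  proof (cases "b \<in> set cs")
    case False
    then have "b \<in> S" using S a unfolding closedR_def by (metis DiffD1 UnE nb_iff subsetD)
    moreover have "b \<notin> set ys"
    proof
      assume "b \<in> set ys"
      then have "a \<in> (set ys - {b}) \<union> (nb (hd ys) \<inter> set cs)"
        using ear_clique[OF S e q] a(2) adj_sym by (metis nb_iff)
      then show False using a S by (auto simp: closedR_def)
    qed
    ultimately show ?thesis by blast
  qed simp
  then have "\<forall>x\<in>S - set ys. nb x \<subseteq> (S - set ys) \<union> set cs" by (metis nb_iff subsetI)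
  then show ?thesis using S unfolding closedR_def by blast
qed

text \<open>A vertex of \<open>S\<close> that sees the cycle has no neighbour in \<open>S\<close>,
  as that would start a longer ear. The vertices of \<open>S\<close> that do not see the cycle then
  form a closed set without access to it, which connectedness forbids unless it is empty.\<close>

lemma ear_single:
  assumes S: "closedR S" and e: "ear S ys" and q: "length ys = 1" and z: "z \<in> S"
  shows "nb z \<subseteq> set cs"
proof -
  note ed = earD[OF e]
  have SV: "S \<subseteq> V" using S by (auto simp: closedR_def)
  have lone: "\<not> adj x y" if "x \<in> S" "touch x" "y \<in> S" for x y
  proof
    assume "adj x y"
    then have "pth [x, y]" using that SV adj_irrefl by (auto simp: pth_Cons)
    then have "length [x, y] \<le> length ys" using that by (intro ed(5)) auto
    then show False using q by simp
  qed
  define T where "T = {x \<in> S. \<not> touch x}"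
  have "closedR T"
  proof -
    have "b \<in> T \<union> set cs" if a: "a \<in> T" "adj a b" for a b
    proof (cases "b \<in> set cs")
      case False
      have aS: "a \<in> S" using a by (simp add: T_def)
      then have "b \<in> S" using S a False unfolding closedR_def by (metis UnE nb_iff subsetD)
      moreover have "\<not> touch b" using lone[of b a] aS \<open>b \<in> S\<close> a(2) adj_sym by blast
      ultimately show ?thesis by (simp add: T_def)
    qed simp
    then have "\<forall>x\<in>T. nb x \<subseteq> T \<union> set cs" by (metis nb_iff subsetI)
    then show ?thesis using S unfolding closedR_def T_def by auto
  qed
  then have "T = {}" using closedR_touch[of T] unfolding T_def by (metis (mono_tags, lifting) mem_Collect_eq)
  then have "touch z" using z by (auto simp: T_def)
  then have "nb z \<inter> S = {}" using lone z by auto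
  then show ?thesis using S z unfolding closedR_def by blast
qed

lemma rot_Suc_last: "last (rotate (Suc j) cs) = at j"
proof -
  obtain m where m: "length cs = Suc m" using cs_pos by (cases "length cs") auto
  have "last (rotate (Suc j) cs) = rotate (Suc j) cs ! m"
    using cs_pos m by (simp add: last_conv_nth)
  also have "\<dots> = at (Suc j + m)" by (rule rot_nth) (simp add: m)
  also have "\<dots> = at j"
  proof -
    have eq: "Suc j + m = j + length cs" using m by simp
    show ?thesis unfolding eq by (simp add: at_def)
  qed
  finally show ?thesis .
qed

text \<open>When cycle and ear together reach the bound on paths, an outside vertex attached next to
  an attachment of the ear would prolong the path that consists of the opened cycle and the
  ear.\<close>

lemma no_touch_next:
  assumes ys: "pth ys" "ys \<noteq> []" "set ys \<inter> set cs = {}" and tight: "2 * d + 1 + r \<le> length cs + length ys"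
    and z: "z \<in> V" "z \<notin> set cs" "z \<notin> set ys"
  shows "adj (hd ys) (at i) \<Longrightarrow> \<not> adj z (at (Suc i))"
    and "adj (hd ys) (at (Suc i)) \<Longrightarrow> \<not> adj z (at i)"
proof -
  show "\<not> adj z (at (Suc i))" if "adj (hd ys) (at i)"
  proof
    assume a: "adj z (at (Suc i))"
    have "pth (z # rotate (Suc i) cs @ ys)"
      using ys z a that rot(2,4)[of "Suc i"] rot_Suc_last[of i] rot_hd[of "Suc i"] cs_pos
      by (auto simp: pth_Cons pth_append hd_append adj_commute)
    then show False using bound[of "z # rotate (Suc i) cs @ ys"] tight by simp
  qed
  show "\<not> adj z (at i)" if "adj (hd ys) (at (Suc i))"
  proof
    assume a: "adj z (at i)"
    have "pth (z # rev (rotate (Suc i) cs) @ ys)"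
      using ys z a that rot(2,4)[of "Suc i"] rot_Suc_last[of i] rot_hd[of "Suc i"] cs_pos
      by (auto simp: pth_Cons pth_append hd_append hd_rev last_rev adj_commute)
    then show False using bound[of "z # rev (rotate (Suc i) cs) @ ys"] tight by simp
  qed
qed

text \<open>If gaps of q + 1 steps already fill the whole cycle, no gap can be larger, so
  attachments follow each other at exactly this distance.\<close>

lemma tight_step:
  assumes S: "closedR S" and e: "ear S ys" and q: "2 \<le> length ys"
    and tight: "length cs = (length ys + 1) * card (nb (hd ys) \<inter> set cs)" "2 \<le> card (nb (hd ys) \<inter> set cs)"
    and i: "adj (hd ys) (at i)"
  shows "adj (hd ys) (at (i + length ys + 1))"
proof (rule ccontr)
  assume no: "\<not> ?thesis"
  note ed = earD[OF e]
  let ?q = "length ys" let ?c = "length cs"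
  have eqn: "adj (last ys) (at k) \<longleftrightarrow> adj (hd ys) (at k)" for k
    using ear_params(1)[OF S e q] at_in[of k] by (auto simp: set_eq_iff)
  define I where "I = {k. k < ?c \<and> adj (hd ys) (at k)}"
  have cI: "card I = card (nb (hd ys) \<inter> set cs)"
  proof -
    have "at ` I = nb (hd ys) \<inter> set cs"
    proof
      show "nb (hd ys) \<inter> set cs \<subseteq> at ` I"
      proof
        fix x assume x: "x \<in> nb (hd ys) \<inter> set cs"
        then obtain k where "k < length cs" "x = at k" using in_cs_at by blast
        then show "x \<in> at ` I" using x by (auto simp: I_def)
      qed
    qed (use at_in in \<open>auto simp: I_def\<close>)
    moreover have "inj_on at I" by (rule inj_onI) (simp add: I_def at_eq_iff)
    ultimately show ?thesis by (metis card_image)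
  qed
  \<comment> \<open>Were the gap after \<open>i\<close> larger, it could be counted with one step
    more, and the total would exceed the cycle by one.\<close>
  define w where "w = (\<lambda>k. if k = i mod ?c then ?q + 2 else ?q + 1)"
  have "2 * (?q + 1) \<le> ?c" using mult_le_mono2[OF tight(2), of "?q + 1"] unfolding tight(1) by (simp add: mult.commute)
  then have "2 * ?q + 2 \<le> ?c" by simp
  then have qc: "?q + 2 \<le> ?c" by linarith
  have iI: "i mod ?c \<in> I" using i cs_pos by (simp add: I_def)
  have "(\<Sum>k\<in>I. w k) \<le> ?c"
  proof (rule sum_gaps_le)
    show "(k + f) mod ?c \<notin> I" if k: "k \<in> I" "0 < f" "f < w k" for k f
    proof
      assume kI: "(k + f) mod ?c \<in> I"
      then have a: "adj (hd ys) (at (k + f))" by (simp add: I_def)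
      show False
      proof (cases "f \<le> ?q")
        case True
        have "?q < f" by (rule spacing[of ys k f])
          (use ed k a eqn S True qc in \<open>auto simp: I_def closedR_def\<close>)
        then show False using True by simp
      next
        case False
        then have "k = i mod ?c" "f = ?q + 1" using k by (auto simp: w_def split: if_splits)
        then have "at (k + f) = at (i + ?q + 1)" by (simp add: at_def mod_add_left_eq add.assoc) (metis mod_Suc_eq mod_add_left_eq add_Suc_right)
        then show False using a no by simp
      qed
    qed
  qed (use cs_pos qc in \<open>auto simp: I_def w_def\<close>)
  moreover have "(\<Sum>k\<in>I. w k) = (?q + 1) * card I + 1"
  proof -
    have fI: "finite I" by (simp add: I_def)
    have "(\<Sum>k\<in>I. w k) = w (i mod ?c) + (\<Sum>k\<in>I - {i mod ?c}. w k)" by (rule sum.remove[OF fI iI])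
    also have "(\<Sum>k\<in>I - {i mod ?c}. w k) = (\<Sum>k\<in>I - {i mod ?c}. ?q + 1)" by (rule sum.cong) (auto simp: w_def)
    also have "\<dots> = (card I - 1) * (?q + 1)" using fI iI by simp
    also have "w (i mod ?c) + (card I - 1) * (?q + 1) = (?q + 1) * card I + 1"
    proof -
      obtain m where "card I = Suc m" using fI iI by (metis card_gt_0_iff empty_iff gr0_conv_Suc)
      then show ?thesis by (simp add: w_def)
    qed
    finally show ?thesis .
  qed
  ultimately show False using tight(1) cI by simp
qed

text \<open>\<open>j\<close> may exceed the length of the cycle; the arc then wraps round, and the
  bound allows at most one full turn.\<close>

lemma arc:
  assumes "j \<le> i + length cs" shows "pth (map at [i..<j])"
proof -
  have "distinct (map at [i..<j])"
  proof -
    have "inj_on at {i..<j}"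
    proof (rule inj_onI)
      fix x y assume xy: "x \<in> {i..<j}" "y \<in> {i..<j}" "at x = at y"
      then have "x mod length cs = y mod length cs"
        using at_eq_iff[of "x mod length cs" "y mod length cs"] cs_pos by simp
      then have "(i + (x - i)) mod length cs = (i + (y - i)) mod length cs" using xy by simp
      then have "(x - i) mod length cs = (y - i) mod length cs" by (rule mod_add_left_cancel_nat)
      then show "x = y" using xy assms by auto
    qed
    then show ?thesis by (simp add: distinct_map)
  qed
  moreover have "successively adj (map at [i..<j])"
    unfolding successively_conv_nth using adj_at by auto
  moreover have "set (map at [i..<j]) \<subseteq> V" using at_in pth_cs(3) by auto
  ultimately show ?thesis by (simp add: pth_def)
qed

lemma arc_disjoint:
  assumes "j \<le> k" "l \<le> i + length cs" shows "set (map at [i..<j]) \<inter> set (map at [k..<l]) = {}"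
proof (cases "i < j \<and> k < l")
  case True
  have "pth (map at ([i..<j] @ [j..<k] @ [k..<l]))"
  proof -
    have app: "[a..<b] @ [b..<c] = [a..<c]" if "a \<le> b" "b \<le> c" for a b c :: nat
      using upt_add_eq_append[OF that(1), of "c - b"] that by simp
    have "[i..<j] @ [j..<k] @ [k..<l] = [i..<l]" using True assms by (simp add: app)
    then show ?thesis using arc[OF assms(2)] by metis
  qed
  then show ?thesis by (auto simp: pth_append)
qed auto

lemma arc_ear:
  assumes "i < j" "j \<le> i + length cs" "pth ys" "set ys \<inter> set cs = {}" "ys \<noteq> []" "adj (last ys) (at i)"
  shows "pth (ys @ map at [i..<j])"
proof -
  have "set (map at [i..<j]) \<subseteq> set cs" using at_in by auto
  moreover have "hd (map at [i..<j]) = at i" using assms(1) by (simp add: hd_map)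
  ultimately show ?thesis using assms arc[OF assms(2)] by (auto simp: pth_append)
qed

lemma ear_arc:
  assumes "i < j" "j \<le> i + length cs" "pth ys" "set ys \<inter> set cs = {}" "ys \<noteq> []" "adj (hd ys) (at (j - 1))"
  shows "pth (map at [i..<j] @ ys)"
proof -
  have "set (map at [i..<j]) \<subseteq> set cs" using at_in by auto
  moreover have "last (map at [i..<j]) = at (j - 1)" using assms(1) by (simp add: last_map)
  ultimately show ?thesis using assms arc[OF assms(2)] by (auto simp: pth_append adj_commute)
qed

lemma nb_card_le:
  assumes "\<And>i. i < length cs \<Longrightarrow> adj z (at i) \<Longrightarrow> i \<in> J" "finite J"
  shows "card (nb z \<inter> set cs) \<le> card J"
proof -
  have "nb z \<inter> set cs \<subseteq> at ` J" using in_cs_at assms(1) by fastforce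
  then have "card (nb z \<inter> set cs) \<le> card (at ` J)" using assms(2) by (intro card_mono) auto
  then show ?thesis using card_image_le[OF assms(2), of at] by linarith
qed

end

section \<open>Forests for the sporadic parameters and their packings\<close>

text \<open>The pairs of sum and number of odd parts are the values of (d + 1, r) in the tuples of
  \<open>sporadic\<close>. By \<open>length_plus_odd_le_halves\<close> only two or three components
  are possible, which leaves at most three forests each.\<close>

lemma small_forests:
  fixes ls :: "nat list"
  assumes len: "2 \<le> length ls" and so: "sorted_wrt (\<ge>) ls" and el: "\<forall>l\<in>set ls. 2 \<le> l \<and> l \<noteq> 3"
  shows "(\<Sum>l\<leftarrow>ls. l div 2) = 3 \<Longrightarrow> length (filter odd ls) = 1 \<Longrightarrow> ls = [5, 2]"
    and "(\<Sum>l\<leftarrow>ls. l div 2) = 4 \<Longrightarrow> length (filter odd ls) = 1 \<Longrightarrow> ls = [7, 2] \<or> ls = [5, 4] \<or> ls = [5, 2, 2]"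
    and "(\<Sum>l\<leftarrow>ls. l div 2) = 4 \<Longrightarrow> length (filter odd ls) = 2 \<Longrightarrow> ls = [5, 5]"
    and "(\<Sum>l\<leftarrow>ls. l div 2) = 5 \<Longrightarrow> length (filter odd ls) = 2 \<Longrightarrow> ls = [7, 5] \<or> ls = [5, 5, 2]"
    and "(\<Sum>l\<leftarrow>ls. l div 2) = 6 \<Longrightarrow> length (filter odd ls) = 3 \<Longrightarrow> ls = [5, 5, 5]"
proof -
  obtain a b rest where ab: "ls = a # b # rest" using len by (cases ls; cases "tl ls") auto
  have ord: "b \<le> a" "\<And>x. x \<in> set rest \<Longrightarrow> x \<le> b" using so ab by auto
  have par: "(\<exists>k\<ge>1. l = 2 * k) \<or> (\<exists>k\<ge>2. l = 2 * k + 1)" if "2 \<le> l" "l \<noteq> 3" for l :: nat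
    using that by (cases "even l") (auto elim!: evenE oddE)
  have pa: "(\<exists>k\<ge>1. a = 2 * k) \<or> (\<exists>k\<ge>2. a = 2 * k + 1)" and pb: "(\<exists>k\<ge>1. b = 2 * k) \<or> (\<exists>k\<ge>2. b = 2 * k + 1)"
    by (rule par; use el ab in simp)+
  note lb = length_plus_odd_le_halves[OF el]
  have two: "ls = [a, b]" if "length ls \<le> 2" using that ab by simp
  have three: "ls = [a, b] \<or> (\<exists>c. ls = [a, b, c] \<and> ((\<exists>k\<ge>1. c = 2 * k) \<or> (\<exists>k\<ge>2. c = 2 * k + 1)) \<and> c \<le> b)" if "length ls \<le> 3"
  proof (cases rest)
    case (Cons c xs)
    then have "xs = []" using that ab by simp
    then show ?thesis using Cons ab el ord par[of c] by auto
  qed (use ab in simp)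
  show "ls = [5, 2]" if h: "(\<Sum>l\<leftarrow>ls. l div 2) = 3" "length (filter odd ls) = 1"
  proof -
    have ls: "ls = [a, b]" using two lb h by simp
    show ?thesis using pa pb h ord(1) by (elim disjE exE conjE; auto simp: ls; presburger)
  qed
  show "ls = [7, 2] \<or> ls = [5, 4] \<or> ls = [5, 2, 2]" if h: "(\<Sum>l\<leftarrow>ls. l div 2) = 4" "length (filter odd ls) = 1"
  proof -
    have "length ls \<le> 3" using lb h by simp
    from three[OF this] show ?thesis
    proof (elim disjE[of "ls = [a, b]"] exE conjE)
      assume ls: "ls = [a, b]"
      show ?thesis using pa pb h ord(1) by (elim disjE exE conjE; auto simp: ls; presburger)
    next
      fix c assume ls: "ls = [a, b, c]" and c: "(\<exists>k\<ge>1. c = 2 * k) \<or> (\<exists>k\<ge>2. c = 2 * k + 1)" "c \<le> b"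
      show ?thesis using pa pb c h ord(1) by (elim disjE exE conjE; auto simp: ls; presburger)
    qed
  qed
  show "ls = [5, 5]" if h: "(\<Sum>l\<leftarrow>ls. l div 2) = 4" "length (filter odd ls) = 2"
  proof -
    have ls: "ls = [a, b]" using two lb h by simp
    show ?thesis using pa pb h ord(1) by (elim disjE exE conjE; auto simp: ls; presburger)
  qed
  show "ls = [7, 5] \<or> ls = [5, 5, 2]" if h: "(\<Sum>l\<leftarrow>ls. l div 2) = 5" "length (filter odd ls) = 2"
  proof -
    have "length ls \<le> 3" using lb h by simp
    from three[OF this] show ?thesis
    proof (elim disjE[of "ls = [a, b]"] exE conjE)
      assume ls: "ls = [a, b]"
      show ?thesis using pa pb h ord(1) by (elim disjE exE conjE; auto simp: ls; presburger)
    next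
      fix c assume ls: "ls = [a, b, c]" and c: "(\<exists>k\<ge>1. c = 2 * k) \<or> (\<exists>k\<ge>2. c = 2 * k + 1)" "c \<le> b"
      show ?thesis using pa pb c h ord(1) by (elim disjE exE conjE; auto simp: ls; presburger)
    qed
  qed
  show "ls = [5, 5, 5]" if h: "(\<Sum>l\<leftarrow>ls. l div 2) = 6" "length (filter odd ls) = 3"
  proof -
    have "length ls \<le> 3" using lb h by simp
    from three[OF this] show ?thesis
    proof (elim disjE[of "ls = [a, b]"] exE conjE)
      assume ls: "ls = [a, b]"
      show ?thesis using pa pb h ord(1) by (elim disjE exE conjE; auto simp: ls; presburger)
    next
      fix c assume ls: "ls = [a, b, c]" and c: "(\<exists>k\<ge>1. c = 2 * k) \<or> (\<exists>k\<ge>2. c = 2 * k + 1)" "c \<le> b"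
      show ?thesis using pa pb c h ord(1) by (elim disjE exE conjE; auto simp: ls; presburger)
    qed
  qed
qed

context graph
begin

lemma packs_two_paths:
  assumes "pth p" "pth q" "set p \<inter> set q = {}" "sum_list xs \<le> length p" "sum_list ys \<le> length q"
    "mset ls = mset (xs @ ys)"
  shows "packs ls V"
proof -
  have "packs (xs @ ys) (set p \<union> set q)" using assms(1-5) by (intro packs_append packs_path)
  then have "packs (xs @ ys) V" using assms packs_mono by (auto simp: pth_def)
  then show ?thesis using packs_perm assms(6) by metis
qed

lemma packs_three_paths:
  assumes "pth p" "pth q" "pth s" "set p \<inter> set q = {}" "set p \<inter> set s = {}" "set q \<inter> set s = {}"
    "a \<le> length p" "b \<le> length q" "c \<le> length s"
  shows "packs [a, b, c] V"
proof -
  have "packs ([b] @ [c]) (set q \<union> set s)" by (intro packs_append packs_path) (use assms in auto)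
  then have "packs (a # [b, c]) V"
    by (intro packs_Cons[OF assms(1,7), of _ "set q \<union> set s"]) (use assms in \<open>auto simp: pth_def\<close>)
  then show ?thesis by simp
qed

end

context lcyc
begin

text \<open>All embeddings below consist of arcs of the cycle prolonged by an ear.\<close>

lemma two_arcs:
  assumes ys: "pth ys" "ys \<noteq> []" "set ys \<inter> set cs = {}" "adj (last ys) (at i)"
    and zs: "pth zs" "zs \<noteq> []" "set zs \<inter> set cs = {}" "adj (last zs) (at k)"
    and dj: "set ys \<inter> set zs = {}" and ij: "i < j" "j \<le> k" "k < l" "l \<le> i + length cs"
    and len: "sum_list as \<le> length ys + (j - i)" "sum_list bs \<le> length zs + (l - k)" "mset ls = mset (as @ bs)"
  shows "packs ls V"
proof -
  have p: "pth (ys @ map at [i..<j])" by (rule arc_ear) (use ys ij in auto)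
  have p': "pth (zs @ map at [k..<l])" by (rule arc_ear) (use zs ij in auto)
  have dj': "set (ys @ map at [i..<j]) \<inter> set (zs @ map at [k..<l]) = {}"
  proof -
    have "set (map at [i..<j]) \<inter> set (map at [k..<l]) = {}" by (rule arc_disjoint) (use ij in auto)
    moreover have "set (map at [i..<j]) \<subseteq> set cs" "set (map at [k..<l]) \<subseteq> set cs" using at_in by auto
    ultimately show ?thesis using ys(3) zs(3) dj unfolding set_append by blast
  qed
  show ?thesis by (rule packs_two_paths[OF p p' dj' _ _ len(3)]) (use len in simp_all)
qed

lemma arc_and_path:
  assumes ys: "pth ys" "ys \<noteq> []" "set ys \<inter> set cs = {}" "adj (last ys) (at i)"
    and q: "pth q" "set q \<inter> set ys = {}" "set q \<inter> set (map at [i..<j]) = {}" and ij: "i < j" "j \<le> i + length cs"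
    and len: "sum_list as \<le> length ys + (j - i)" "sum_list bs \<le> length q" "mset ls = mset (as @ bs)"
  shows "packs ls V"
proof -
  have p: "pth (ys @ map at [i..<j])" by (rule arc_ear) (use ys ij in auto)
  have dj: "set (ys @ map at [i..<j]) \<inter> set q = {}" using q(2,3) unfolding set_append by blast
  show ?thesis by (rule packs_two_paths[OF p q(1) dj _ len(2,3)]) (use len in simp)
qed

lemma arc_and_free_path:
  assumes ys: "pth ys" "ys \<noteq> []" "set ys \<inter> set cs = {}" "adj (last ys) (at i)"
    and q: "pth q" "set q \<inter> set ys = {}" "set q \<inter> set cs = {}" and ij: "i < j" "j \<le> i + length cs"
    and len: "sum_list as \<le> length ys + (j - i)" "sum_list bs \<le> length q" "mset ls = mset (as @ bs)"
  shows "packs ls V"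
proof (rule arc_and_path[OF ys q(1,2) _ ij len])
  show "set q \<inter> set (map at [i..<j]) = {}" using q(3) at_in by auto
qed

lemma less_cases:
  fixes i :: nat
  shows "i < 4 \<Longrightarrow> i \<in> {0, 1, 2, 3}" "i < 6 \<Longrightarrow> i \<in> {0, 1, 2, 3, 4, 5}"
    "i < 7 \<Longrightarrow> i \<in> {0, 1, 2, 3, 4, 5, 6}" "i < 8 \<Longrightarrow> i \<in> {0, 1, 2, 3, 4, 5, 6, 7}"
    "i < 9 \<Longrightarrow> i \<in> {0, 1, 2, 3, 4, 5, 6, 7, 8}"
    "i < 10 \<Longrightarrow> i \<in> {0, 1, 2, 3, 4, 5, 6, 7, 8, 9}"
    "i < 12 \<Longrightarrow> i \<in> {0, 1, 2, 3, 4, 5, 6, 7, 8, 9, 10, 11}"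
  by (simp_all, (linarith | presburger)+)


lemma nb_outside:
  assumes "card J < card (nb z \<inter> set cs)" "finite J"
  shows "\<exists>k<length cs. adj z (at k) \<and> k \<notin> J"
  using nb_card_le[of z J] assms by (meson not_less)

text \<open>The clique of the first ear is removed and a second ear \<open>zs\<close> is taken from
  the rest. In all but one of the eight tuples the path bound is tight, so \<open>zs\<close> cannot
  attach next to an attachment of \<open>ys\<close>; few positions are left, and the two ears with
  suitable arcs of the cycle form F.\<close>

lemma outside_edge_packs_aligned:
  assumes ls: "2 \<le> length ls" "sorted_wrt (\<ge>) ls" "\<forall>l\<in>set ls. 2 \<le> l \<and> l \<noteq> 3"
      "(\<Sum>l\<leftarrow>ls. l div 2) = d + 1" "length (filter odd ls) = r"
    and e: "ear (V - set cs) ys" and q2: "2 \<le> length ys" and ne: "\<not> (d = 5 \<and> length ys = 4)"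
    and a0: "adj (hd ys) (at 0)"
  shows "packs ls V"
proof -
  note ed = earD[OF e]
  note par = ear_params[OF closedR_all e q2]
  define S where "S = V - set cs - set ys"
  have clS: "closedR S" unfolding S_def by (rule ear_remove[OF closedR_all e q2])
  have cV: "length cs + length ys + 3 \<le> card V" using ear_length[OF _ e] n by auto
  \<comment> \<open>Three spare vertices are needed for the pigeonhole argument in the case d = 3, r
    = 2 with a cycle of 6 vertices.\<close>
  have cardS: "3 \<le> card S"
  proof -
    have "V \<subseteq> S \<union> set (cs @ ys)" by (auto simp: S_def)
    then have "card V \<le> card (S \<union> set (cs @ ys))" using fin by (intro card_mono) (auto simp: S_def)
    also have "\<dots> \<le> card S + card (set (cs @ ys))" by (rule card_Un_le)
    also have "card (set (cs @ ys)) \<le> length cs + length ys" using card_length[of "cs @ ys"] by simp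
    finally show ?thesis using cV by linarith
  qed
  then have "S \<noteq> {}" by auto
  then obtain zs where ez: "ear S zs" using ear_exists[OF clS] by blast
  note zd = earD[OF ez]
  have zR: "set zs \<subseteq> V - set cs" "set zs \<inter> set cs = {}" "set ys \<inter> set zs = {}" using zd(3) by (auto simp: S_def)
  have zR': "set zs \<inter> set ys = {}" using zR(3) by blast
  have yR: "set ys \<inter> set cs = {}" using ed(3) by auto
  have atY: "at k \<notin> set ys" "at k \<notin> set zs" for k using yR zR(2) at_in[of k] by auto
  have qq: "length zs \<le> length ys" by (rule ed(5)[OF zd(1,2) zR(1) zd(4)])
  have yl: "adj (last ys) (at k) \<longleftrightarrow> adj (hd ys) (at k)" for k
    using par(1) at_in[of k] by (auto simp: set_eq_iff)
  have zl: "adj (last zs) (at k) \<longleftrightarrow> adj (hd zs) (at k)" if "2 \<le> length zs" for k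
    using ear_params(1)[OF clS ez that] at_in[of k] by (auto simp: set_eq_iff)
  have z1: "1 \<le> length zs" using zd(2) by (cases zs) auto
  have spor: "sporadic (length ys) d r (length cs)" by (rule par(3))
  have z1d: "d \<le> card (nb (hd zs) \<inter> set cs)" if "length zs = 1" using ear_hd[OF clS ez] that by simp
  have z1l: "last zs = hd zs" if "length zs = 1" using that by (cases zs) auto
  have zspor: "sporadic (length zs) d r (length cs)" "card (nb (hd zs) \<inter> set cs) + length zs = d + 1" if "2 \<le> length zs"
    using ear_params(2,3)[OF clS ez that] by auto
  have hz: "hd zs \<in> V" "hd zs \<notin> set cs" "hd zs \<notin> set ys" 
    using zd(3) hd_in_set[OF zd(2)] unfolding S_def by blast+
  \<comment> \<open>\<open>k + (length cs - 1)\<close> is the cyclic predecessor of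
    \<open>k\<close>, written so that no subtraction is cut off at 0.\<close>
  have ex: "\<not> adj (hd zs) (at (Suc k))" "\<not> adj (hd zs) (at (k + (length cs - 1)))"
    if "2 * d + 1 + r \<le> length cs + length ys" "adj (hd ys) (at k)" for k
  proof -
    show "\<not> adj (hd zs) (at (Suc k))" by (rule no_touch_next(1)[OF ed(1,2) yR that(1) hz that(2)])
    have eq: "Suc (k + (length cs - 1)) = k + length cs" using c3 by simp
    have "at (Suc (k + (length cs - 1))) = at k" unfolding eq by (simp add: at_def)
    then show "\<not> adj (hd zs) (at (k + (length cs - 1)))"
      using no_touch_next(2)[OF ed(1,2) yR that(1) hz, of "k + (length cs - 1)"] that(2) by simp
  qed
  have nonc: "\<not> (adj z (at k) \<and> adj z (at (Suc k)))" if "z \<in> V - set cs" for z k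
    using spacing1[of z k 1] that c3 by auto
  have tz: "adj (hd zs) (at j)" if "2 \<le> length zs" "adj (hd zs) (at k)"
      "length cs = (length zs + 1) * card (nb (hd zs) \<inter> set cs)" "2 \<le> card (nb (hd zs) \<inter> set cs)" "j = k + length zs + 1" for j k
    unfolding that(5) by (rule tight_step[OF clS ez that(1,3,4,2)])
  have ty: "adj (hd ys) (at j)" if "adj (hd ys) (at k)"
      "length cs = (length ys + 1) * card (nb (hd ys) \<inter> set cs)" "2 \<le> card (nb (hd ys) \<inter> set cs)" "j = k + length ys + 1" for j k
    unfolding that(4) by (rule tight_step[OF closedR_all e q2 that(2,3,1)])
  note arcs = two_arcs[OF ed(1,2) yR _ zd(1,2) zR(2) _ zR(3)]
  have zex: "\<exists>k<length cs. adj (hd zs) (at k) \<and> k \<notin> J" if "card J < card (nb (hd zs) \<inter> set cs)" "finite J" for J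
    using nb_card_le[of "hd zs" J] that by (meson not_less)
  have yex: "\<exists>k<length cs. adj (hd ys) (at k) \<and> k \<notin> J" if "card J < card (nb (hd ys) \<inter> set cs)" "finite J" for J
    using nb_card_le[of "hd ys" J] that by (meson not_less)
  consider (c4) "d = 2" "length ys = 2" "r = 1" "length cs = 4"
    | (c6a) "d = 3" "length ys = 2" "r = 1" "length cs = 6"
    | (c6b) "d = 3" "length ys = 2" "r = 2" "length cs = 6"
    | (c7) "d = 3" "length ys = 2" "r = 2" "length cs = 7"
    | (c6c) "d = 3" "length ys = 3" "r = 2" "length cs = 6"
    | (c9) "d = 4" "length ys = 2" "r = 2" "length cs = 9"
    | (c8) "d = 4" "length ys = 3" "r = 2" "length cs = 8"
    | (c12) "d = 5" "length ys = 2" "r = 3" "length cs = 12"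
    using spor ne unfolding sporadic_def by auto
  then show ?thesis
  proof cases
    \<comment> \<open>A single vertex \<open>zs\<close> must attach at index 0 and starts a P_5
      round the whole cycle, while \<open>ys\<close> contains the P_2. If \<open>zs\<close> has two
      vertices it is the P_2 itself.\<close>
    case c4
    have F: "ls = [5, 2]" using small_forests(1)[OF ls(1-3)] ls(4,5) c4 by simp
    show ?thesis
    proof (cases "length zs = 1")
      case True
      have x: "\<not> adj (hd zs) (at 1)" "\<not> adj (hd zs) (at 3)" using ex[of 0] c4 a0 by auto
      have "adj (hd zs) (at 0)"
      proof (rule ccontr)
        assume no: "\<not> adj (hd zs) (at 0)"
        have "card {2::nat} < card (nb (hd zs) \<inter> set cs)" using z1d[OF True] c4 by simp
        then obtain k where "k < 4" "adj (hd zs) (at k)" "k \<notin> {2}" using zex[of "{2}"] c4 by auto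
        then show False using less_cases(1)[of k] x no by auto
      qed
      then show ?thesis
        using arc_and_free_path[OF zd(1,2) zR(2), of 0 ys 4 "[5]" "[2]" ls] True z1l ed(1) yR zR F c4 by auto
    next
      case False
      then have l2: "length zs = 2" using z1 qq c4 by simp
      show ?thesis
        using arc_and_free_path[OF ed(1,2) yR, of 0 zs 3 "[5]" "[2]" ls] a0 yl l2 zd(1) zR zR' F c4 by auto
    qed
  next
    case c6a
    have F: "ls = [7, 2] \<or> ls = [5, 4] \<or> ls = [5, 2, 2]" using small_forests(2)[OF ls(1-3)] ls(4,5) c6a by simp
    have cA: "card (nb (hd ys) \<inter> set cs) = 2" using par(2) c6a by simp
    have a3: "adj (hd ys) (at 3)" by (rule ty[OF a0]) (use cA c6a in simp_all)
    have x: "\<not> adj (hd zs) (at 1)" "\<not> adj (hd zs) (at 5)" "\<not> adj (hd zs) (at 2)" "\<not> adj (hd zs) (at 4)"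
      using ex[of 0] ex[of 3] a0 a3 c6a by (auto simp: at_def)
    have nz: "k \<in> {0, 3}" if "k < length cs" "adj (hd zs) (at k)" for k using less_cases(2)[of k] that x c6a by auto
    have "card (nb (hd zs) \<inter> set cs) \<le> 2" using nb_card_le[of "hd zs" "{0, 3}"] nz by simp
    then have "length zs \<noteq> 1" using z1d c6a by linarith
    then have l2: "length zs = 2" using z1 qq c6a by simp
    have "adj (hd zs) (at 3)"
    proof (rule ccontr)
      assume no: "\<not> adj (hd zs) (at 3)"
      have "card {0::nat} < card (nb (hd zs) \<inter> set cs)" using zspor(2) l2 c6a by simp
      then obtain k where "k < length cs" "adj (hd zs) (at k)" "k \<notin> {0}" using zex[of "{0}"] by auto
      then show False using nz[of k] no by auto
    qed
    then have zk: "adj (last zs) (at 3)" using zl l2 by simp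
    have yk: "adj (last ys) (at 0)" using a0 yl by simp
    show ?thesis using F
    proof (elim disjE)
      assume l: "ls = [7, 2]"
      show ?thesis
        using arc_and_free_path[OF ed(1,2) yR yk zd(1), of 5 "[7]" "[2]" ls] l l2 zR zR' c6a by auto
    next
      assume l: "ls = [5, 4]"
      show ?thesis using arcs[OF yk zk, of 3 6 "[5]" "[4]" ls] l l2 c6a by auto
    next
      assume l: "ls = [5, 2, 2]"
      show ?thesis using arcs[OF yk zk, of 3 6 "[5]" "[2, 2]" ls] l l2 c6a by auto
    qed
  next
    \<comment> \<open>Here cycle and ear fall one short of the path bound, so \<open>ex\<close> does
      not apply and all positions of \<open>zs\<close> have to be treated.\<close>
    case c6b
    have F: "ls = [5, 5]" using small_forests(3)[OF ls(1-3)] ls(4,5) c6b by simp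
    have cA: "card (nb (hd ys) \<inter> set cs) = 2" using par(2) c6b by simp
    have a3: "adj (hd ys) (at 3)" by (rule ty[OF a0]) (use cA c6b in simp_all)
    have yk: "adj (last ys) (at 0)" "adj (last ys) (at 3)" using a0 a3 yl by auto
    show ?thesis
    proof (cases "length zs = 1")
      case False
      then have l2: "length zs = 2" using z1 qq c6b by simp
      have cz: "card (nb (hd zs) \<inter> set cs) = 2" using zspor(2) l2 c6b by simp
      have st: "adj (hd zs) (at (k + 3))" if "adj (hd zs) (at k)" for k
        by (rule tz[OF _ that]) (use l2 cz c6b in simp_all)
      have m6: "at (k + 6) = at k" for k using c6b by (simp add: at_def)
      obtain k where "k < length cs" "adj (hd zs) (at k)" using zex[of "{}"] cz by auto
      then have "adj (hd zs) (at 0) \<or> adj (hd zs) (at 1) \<or> adj (hd zs) (at 2)"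
        using less_cases(2)[of k] st[of k] m6[of 0] m6[of 1] m6[of 2] c6b by auto
      then show ?thesis
      proof (elim disjE)
        assume "adj (hd zs) (at 0)"
        then have zk: "adj (last zs) (at 3)" using st[of 0] zl l2 by simp
        show ?thesis using arcs[OF yk(1) zk, of 3 6 "[5]" "[5]" ls] F l2 c6b by auto
      next
        assume "adj (hd zs) (at 1)"
        then have zk: "adj (last zs) (at 1)" using zl l2 by simp
        have p: "pth (map at [4..<7] @ ys)"
          by (rule ear_arc) (use ed yR a0 c6b m6[of 0] in auto)
        have "set (map at [1..<4]) \<inter> set (map at [4..<7]) = {}" by (rule arc_disjoint) (use c6b in auto)
        then have "set (map at [4..<7] @ ys) \<inter> set (map at [1..<4]) = {}" using yR at_in atY by auto
        then show ?thesis
          using arc_and_path[OF zd(1,2) zR(2) zk p, of 4 "[5]" "[5]" ls] F l2 c6b zR at_in atY by auto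
      next
        assume z2: "adj (hd zs) (at 2)"
        have p: "pth (map at [0..<3] @ zs)"
          by (rule ear_arc) (use zd zR z2 c6b in auto)
        have "set (map at [0..<3]) \<inter> set (map at [3..<6]) = {}" by (rule arc_disjoint) (use c6b in auto)
        then have "set (map at [0..<3] @ zs) \<inter> set (map at [3..<6]) = {}" using zR at_in atY by auto
        moreover have "set (map at [0..<3] @ zs) \<inter> set ys = {}" using zR' atY by auto
        ultimately show ?thesis
          using arc_and_path[OF ed(1,2) yR yk(2) p, of 6 "[5]" "[5]" ls] F l2 c6b by auto
      qed
    next
      case True
      \<comment> \<open>Three pairwise nonconsecutive vertices of a 6-cycle have the same parity. Of
        three outside vertices two share a parity class and are the ends of a P_5 over three cycle
        vertices; \<open>ys\<close> with the other three forms the second P_5.\<close>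
      have parity: "adj z (at 0) \<and> adj z (at 2) \<or> adj z (at 3) \<and> adj z (at 5)" if z: "z \<in> S" for z
      proof -
        have zc: "nb z \<subseteq> set cs" by (rule ear_single[OF clS ez True z])
        have zV: "z \<in> V - set cs" using z by (simp add: S_def)
        have c3: "3 \<le> card (nb z \<inter> set cs)" using deg[of z] zV zc c6b by (simp add: Int_absorb2)
        note nc = nonc[OF zV, of 0] nonc[OF zV, of 1] nonc[OF zV, of 2] nonc[OF zV, of 3] nonc[OF zV, of 4] nonc[OF zV, of 5]
        have m6: "at 6 = at 0" using c6b by (simp add: at_def)
        have nc': "\<not> (adj z (at 0) \<and> adj z (at 1))" "\<not> (adj z (at 1) \<and> adj z (at 2))" "\<not> (adj z (at 2) \<and> adj z (at 3))"
          "\<not> (adj z (at 3) \<and> adj z (at 4))" "\<not> (adj z (at 4) \<and> adj z (at 5))" "\<not> (adj z (at 5) \<and> adj z (at 0))"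
          using nc m6 by (auto simp: eval_nat_numeral)
        have J: "\<exists>k<6. adj z (at k) \<and> k \<notin> {i, j}" for i j
        proof -
          have "card {i, j} < card (nb z \<inter> set cs)" using c3 by (simp add: card_insert_if)
          then show ?thesis using nb_outside[of "{i, j}" z] c6b by simp
        qed
        have Jm: "\<exists>k\<in>{0,1,2,3,4,5} - {i, j}. adj z (at k)" for i j
          using J[of i j] less_cases(2) by blast
        have D: "adj z (at 1) \<or> adj z (at 2) \<or> adj z (at 4) \<or> adj z (at 5)"
          "adj z (at 1) \<or> adj z (at 2) \<or> adj z (at 3) \<or> adj z (at 5)"
          "adj z (at 0) \<or> adj z (at 2) \<or> adj z (at 4) \<or> adj z (at 5)"
          "adj z (at 0) \<or> adj z (at 2) \<or> adj z (at 3) \<or> adj z (at 5)"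
          "adj z (at 0) \<or> adj z (at 2) \<or> adj z (at 3) \<or> adj z (at 4)"
          "adj z (at 0) \<or> adj z (at 1) \<or> adj z (at 3) \<or> adj z (at 5)"
          "adj z (at 0) \<or> adj z (at 1) \<or> adj z (at 3) \<or> adj z (at 4)"
          using Jm[of 0 3] Jm[of 0 4] Jm[of 1 3] Jm[of 1 4] Jm[of 1 5] Jm[of 2 4] Jm[of 2 5] by auto
        show ?thesis using nc' D by argo
      qed
      obtain T where T: "T \<subseteq> S" "card T = 3" using cardS by (meson obtain_subset_with_card_n)
      then obtain u v w where uvw: "T = {u, v, w}" "u \<noteq> v" "u \<noteq> w" "v \<noteq> w" by (auto simp: card_3_iff)
      have fin2: "packs ls V" if zz: "z \<in> S" "z' \<in> S" "z \<noteq> z'"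
        "(adj z (at 0) \<and> adj z' (at 2)) \<or> (adj z (at 3) \<and> adj z' (at 5))" for z z'
        using zz(4)
      proof (elim disjE conjE)
        have zV: "z \<in> V" "z \<notin> set cs" "z \<notin> set ys" "z' \<in> V" "z' \<notin> set cs" "z' \<notin> set ys" using zz by (auto simp: S_def)
        { assume a: "adj z (at 0)" "adj z' (at 2)"
          have "pth (map at [0..<3] @ [z'])" by (rule ear_arc) (use zV a c6b in auto)
          then have p: "pth (z # map at [0..<3] @ [z'])"
            using zV zz(3) a at_in c6b by (auto simp: pth_Cons hd_map)
          have "set (map at [0..<3]) \<inter> set (map at [3..<6]) = {}" by (rule arc_disjoint) (use c6b in auto)
          then have "set (z # map at [0..<3] @ [z']) \<inter> set (map at [3..<6]) = {}" using zV at_in atY by auto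
          then show ?thesis
            using arc_and_path[OF ed(1,2) yR yk(2) p, of 6 "[5]" "[5]" ls] F c6b zV yR at_in atY by auto }
        { assume a: "adj z (at 3)" "adj z' (at 5)"
          have "pth (map at [3..<6] @ [z'])" by (rule ear_arc) (use zV a c6b in auto)
          then have p: "pth (z # map at [3..<6] @ [z'])"
            using zV zz(3) a at_in c6b by (auto simp: pth_Cons hd_map)
          have "set (map at [0..<3]) \<inter> set (map at [3..<6]) = {}" by (rule arc_disjoint) (use c6b in auto)
          then have "set (z # map at [3..<6] @ [z']) \<inter> set (map at [0..<3]) = {}" using zV at_in atY by auto
          then show ?thesis
            using arc_and_path[OF ed(1,2) yR yk(1) p, of 3 "[5]" "[5]" ls] F c6b zV yR at_in atY by auto }
      qed
      have uS: "u \<in> S" "v \<in> S" "w \<in> S" using T uvw by auto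
      show ?thesis using parity[OF uS(1)] parity[OF uS(2)] parity[OF uS(3)] fin2[OF uS(1,2) uvw(2)] fin2[OF uS(1,3) uvw(3)] fin2[OF uS(2,3) uvw(4)]
        by blast
    qed
  next
    \<comment> \<open>The two attachments of \<open>ys\<close> cut the 7-cycle into gaps of 3 and 4,
      in one order or the other.\<close>
    case c7
    have F: "ls = [5, 5]" using small_forests(3)[OF ls(1-3)] ls(4,5) c7 by simp
    have cA: "card (nb (hd ys) \<inter> set cs) = 2" using par(2) c7 by simp
    have yk0: "adj (last ys) (at 0)" using a0 yl by simp
    have m7: "at (k + 7) = at k" for k using c7 by (simp add: at_def)
    have "card {0::nat} < card (nb (hd ys) \<inter> set cs)" using cA by simp
    then obtain k where k: "k < 7" "adj (hd ys) (at k)" "k \<noteq> 0" using yex[of "{0}"] c7 by auto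
    have "2 < k" using spacing[of ys 0 k] ed yR a0 k yl c7 by auto
    moreover have "2 < 7 - k" using spacing[of ys k "7 - k"] ed yR a0 k yl c7 m7[of 0] by auto
    ultimately have "k = 3 \<or> k = 4" by linarith
    then show ?thesis
    proof
      assume k3: "k = 3"
      then have a3: "adj (hd ys) (at 3)" using k by simp
      have x: "\<not> adj (hd zs) (at 1)" "\<not> adj (hd zs) (at 6)" "\<not> adj (hd zs) (at 2)" "\<not> adj (hd zs) (at 4)"
        using ex[of 0] ex[of 3] a0 a3 c7 m7[of 2] by auto
      have nz: "k \<in> {0, 3, 5}" if "k < length cs" "adj (hd zs) (at k)" for k using less_cases(3)[of k] that x c7 by auto
      have z3: "adj (hd zs) (at 3)"
      proof (rule ccontr)
        assume no: "\<not> adj (hd zs) (at 3)"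
        have n2: "card (nb (hd zs) \<inter> set cs) \<le> card {0, 5::nat}" by (rule nb_card_le) (use nz no in auto)
        then have "length zs \<noteq> 1" using z1d c7 by auto
        then have l2: "length zs = 2" using z1 qq c7 by simp
        then have cz: "card (nb (hd zs) \<inter> set cs) = 2" using zspor(2) c7 by simp
        have "card {5::nat} < card (nb (hd zs) \<inter> set cs)" "card {0::nat} < card (nb (hd zs) \<inter> set cs)" using cz by auto
        then obtain i j where "i < length cs" "adj (hd zs) (at i)" "i \<notin> {5}" "j < length cs" "adj (hd zs) (at j)" "j \<notin> {0}"
          using zex[of "{5}"] zex[of "{0}"] by blast
        then have a: "adj (hd zs) (at 0)" "adj (hd zs) (at 5)" using nz[of i] nz[of j] no by auto
        have "length zs < 2" by (rule spacing[of zs 5 2]) (use zd zR a zl l2 m7[of 0] c7 in auto)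
        then show False using l2 by simp
      qed
      then have zk: "adj (last zs) (at 3)" using zl z1l z1 by (metis One_nat_def Suc_1 le_antisym not_less_eq_eq)
      show ?thesis
      proof (cases "length zs = 1")
        case True then show ?thesis using arcs[OF yk0 zk, of 3 7 "[5]" "[5]" ls] F c7 by auto
      next
        case False
        then have "length zs = 2" using z1 qq c7 by simp
        then show ?thesis using arcs[OF yk0 zk, of 3 6 "[5]" "[5]" ls] F c7 by auto
      qed
    next
      assume k4: "k = 4"
      then have a4: "adj (hd ys) (at 4)" "adj (last ys) (at 4)" using k yl by auto
      have x: "\<not> adj (hd zs) (at 1)" "\<not> adj (hd zs) (at 6)" "\<not> adj (hd zs) (at 5)" "\<not> adj (hd zs) (at 3)"
        using ex[of 0] ex[of 4] a0 a4 c7 m7[of 3] by auto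
      have nz: "k \<in> {0, 2, 4}" if "k < length cs" "adj (hd zs) (at k)" for k using less_cases(3)[of k] that x c7 by auto
      have z3: "adj (hd zs) (at 0)"
      proof (rule ccontr)
        assume no: "\<not> adj (hd zs) (at 0)"
        have n2: "card (nb (hd zs) \<inter> set cs) \<le> card {2, 4::nat}" by (rule nb_card_le) (use nz no in auto)
        then have "length zs \<noteq> 1" using z1d c7 by auto
        then have l2: "length zs = 2" using z1 qq c7 by simp
        then have cz: "card (nb (hd zs) \<inter> set cs) = 2" using zspor(2) c7 by simp
        have "card {2::nat} < card (nb (hd zs) \<inter> set cs)" "card {4::nat} < card (nb (hd zs) \<inter> set cs)" using cz by auto
        then obtain i j where "i < length cs" "adj (hd zs) (at i)" "i \<notin> {2}" "j < length cs" "adj (hd zs) (at j)" "j \<notin> {4}"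
          using zex[of "{2}"] zex[of "{4}"] by blast
        then have a: "adj (hd zs) (at 2)" "adj (hd zs) (at 4)" using nz[of i] nz[of j] no by auto
        have "length zs < 2" by (rule spacing[of zs 2 2]) (use zd zR a zl l2 c7 in auto)
        then show False using l2 by simp
      qed
      have "at 7 = at 0" using m7[of 0] by simp
      then have zk: "adj (last zs) (at 7)" using z3 zl z1l z1 by (metis One_nat_def Suc_1 le_antisym not_less_eq_eq)
      show ?thesis
      proof (cases "length zs = 1")
        case True then show ?thesis using arcs[OF a4(2) zk, of 7 11 "[5]" "[5]" ls] F c7 by auto
      next
        case False
        then have "length zs = 2" using z1 qq c7 by simp
        then show ?thesis using arcs[OF a4(2) zk, of 7 10 "[5]" "[5]" ls] F c7 by auto
      qed
    qed
  next
    \<comment> \<open>An ear on three vertices has d + 1 - 3 = 1 attachment here.\<close>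
    case c6c
    have F: "ls = [5, 5]" using small_forests(3)[OF ls(1-3)] ls(4,5) c6c by simp
    have yk: "adj (last ys) (at 0)" using a0 yl by simp
    have x: "\<not> adj (hd zs) (at 1)" "\<not> adj (hd zs) (at 5)" using ex[of 0] c6c a0 by auto
    have nz: "k \<in> {0, 2, 3, 4}" if "k < length cs" "adj (hd zs) (at k)" for k using less_cases(2)[of k] that x c6c by auto
    have hzR: "hd zs \<in> V - set cs" using hz by simp
    have nc: "\<not> (adj (hd zs) (at 2) \<and> adj (hd zs) (at 3))" "\<not> (adj (hd zs) (at 3) \<and> adj (hd zs) (at 4))"
      using nonc[OF hzR, of 2] nonc[OF hzR, of 3] by (auto simp: eval_nat_numeral)
    consider "length zs = 1" | "length zs = 2" | "length zs = 3" using z1 qq c6c by linarith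
    then show ?thesis
    proof cases
      case 1
      have "adj (hd zs) (at 2)"
      proof (rule ccontr)
        assume no: "\<not> adj (hd zs) (at 2)"
        have "\<exists>j. \<forall>k<length cs. adj (hd zs) (at k) \<longrightarrow> k \<in> {0, j}"
          using nz no nc by (cases "adj (hd zs) (at 3)") (intro exI[of _ 3] exI[of _ 4]; fastforce)+
        then obtain j where j: "\<And>k. k < length cs \<Longrightarrow> adj (hd zs) (at k) \<Longrightarrow> k \<in> {0, j}" by blast
        have "card (nb (hd zs) \<inter> set cs) \<le> card {0, j}" by (rule nb_card_le[OF j]) auto
        also have "\<dots> \<le> 2" by (simp add: card_insert_if)
        finally show False using z1d[OF 1] c6c by simp
      qed
      then have zk: "adj (last zs) (at 2)" using z1l 1 by simp
      show ?thesis using arcs[OF yk zk, of 2 6 "[5]" "[5]" ls] F c6c 1 by auto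
    next
      case 2
      have cz: "card (nb (hd zs) \<inter> set cs) = 2" using zspor(2) 2 c6c by simp
      have st: "adj (hd zs) (at (k + 3))" if "adj (hd zs) (at k)" for k
        by (rule tz[OF _ that]) (use 2 cz c6c in simp_all)
      have m6: "at (k + 6) = at k" for k using c6c by (simp add: at_def)
      obtain k where k: "k < length cs" "adj (hd zs) (at k)" using zex[of "{}"] cz by auto
      then have "adj (hd zs) (at 3)" using nz[OF k] st[of k] x m6[of 1] by auto
      then have zk: "adj (last zs) (at 3)" using zl 2 by simp
      show ?thesis using arcs[OF yk zk, of 2 6 "[5]" "[5]" ls] F c6c 2 by auto
    next
      case 3
      have cz: "card (nb (hd zs) \<inter> set cs) = 1" using zspor(2) 3 c6c by simp
      obtain k where k: "k < length cs" "adj (hd zs) (at k)" using zex[of "{}"] cz by auto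
      have zk: "adj (last zs) (at k)" using zl 3 k by simp
      show ?thesis
      \<comment> \<open>With the common attachment \<open>at 0\<close>, one P_5 consists of
        \<open>ys\<close>, \<open>at 0\<close> and a vertex of \<open>zs\<close>, the other is the
        rest of the cycle.\<close>
      proof (cases "k = 0")
        case True
        have at0z: "at 0 \<noteq> hd zs" using atY(2)[of 0] hd_in_set[OF zd(2)] by metis
        have p1: "pth (ys @ [at 0])" using arc_ear[of 0 1 ys] ed yR yk c6c by simp
        have "pth (ys @ [at 0] @ [hd zs])"
          using p1 hz k True ed(1) at0z by (auto simp: pth_append pth_Cons adj_commute)
        moreover have "pth (map at [1..<6])" by (rule arc) (use c6c in auto)
        moreover have "set (map at [0..<1]) \<inter> set (map at [1..<6]) = {}" by (rule arc_disjoint) (use c6c in auto)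
        then have "set (ys @ [at 0] @ [hd zs]) \<inter> set (map at [1..<6]) = {}" using hz yR at_in atY by auto
        ultimately show ?thesis
          by (rule packs_two_paths[where xs = "[5]" and ys = "[5]"]) (use F c6c in auto)
      next
        case False
        then have "2 \<le> k" "k \<le> 4" using nz[OF k] by auto
        then show ?thesis using arcs[OF yk zk, of 2 "k + 2" "[5]" "[5]" ls] F c6c 3 by auto
      qed
    qed
  next
    case c9
    have F: "ls = [7, 5] \<or> ls = [5, 5, 2]" using small_forests(4)[OF ls(1-3)] ls(4,5) c9 by simp
    have cA: "card (nb (hd ys) \<inter> set cs) = 3" using par(2) c9 by simp
    have a3: "adj (hd ys) (at 3)" by (rule ty[OF a0]) (use cA c9 in simp_all)
    have a6: "adj (hd ys) (at 6)" by (rule ty[OF a3]) (use cA c9 in simp_all)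
    have m9: "at (k + 9) = at k" for k using c9 by (simp add: at_def)
    have x: "\<not> adj (hd zs) (at 1)" "\<not> adj (hd zs) (at 8)" "\<not> adj (hd zs) (at 2)" "\<not> adj (hd zs) (at 4)"
      "\<not> adj (hd zs) (at 5)" "\<not> adj (hd zs) (at 7)"
      using ex[of 0] ex[of 3] ex[of 6] a0 a3 a6 c9 m9[of 2] m9[of 5] by auto
    have nz: "k \<in> {0, 3, 6}" if "k < length cs" "adj (hd zs) (at k)" for k using less_cases(5)[of k] that x c9 by auto
    have "card (nb (hd zs) \<inter> set cs) \<le> card {0, 3, 6::nat}" by (rule nb_card_le) (use nz in auto)
    then have "length zs \<noteq> 1" using z1d c9 by auto
    then have l2: "length zs = 2" using z1 qq c9 by simp
    have "adj (hd zs) (at 6)"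
    proof (rule ccontr)
      assume no: "\<not> adj (hd zs) (at 6)"
      have "card (nb (hd zs) \<inter> set cs) \<le> card {0, 3::nat}" by (rule nb_card_le) (use nz no in auto)
      then show False using zspor(2) l2 c9 by simp
    qed
    then have zk: "adj (last zs) (at 6)" using zl l2 by simp
    have yk: "adj (last ys) (at 0)" using a0 yl by simp
    show ?thesis using F
    proof
      assume "ls = [7, 5]"
      then show ?thesis using arcs[OF yk zk, of 5 9 "[7]" "[5]" ls] l2 c9 by auto
    next
      assume "ls = [5, 5, 2]"
      then show ?thesis using arcs[OF yk zk, of 5 9 "[5, 2]" "[5]" ls] l2 c9 by auto
    qed
  next
    case c8
    have F: "ls = [7, 5] \<or> ls = [5, 5, 2]" using small_forests(4)[OF ls(1-3)] ls(4,5) c8 by simp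
    have cA: "card (nb (hd ys) \<inter> set cs) = 2" using par(2) c8 by simp
    have a4: "adj (hd ys) (at 4)" by (rule ty[OF a0]) (use cA c8 in simp_all)
    have m8: "at (k + 8) = at k" for k using c8 by (simp add: at_def)
    have x: "\<not> adj (hd zs) (at 1)" "\<not> adj (hd zs) (at 7)" "\<not> adj (hd zs) (at 3)" "\<not> adj (hd zs) (at 5)"
      using ex[of 0] ex[of 4] a0 a4 c8 m8[of 3] by auto
    have nz: "k \<in> {0, 2, 4, 6}" if "k < length cs" "adj (hd zs) (at k)" for k using less_cases(4)[of k] that x c8 by auto
    have yk: "adj (last ys) (at 0)" using a0 yl by simp
    consider "length zs = 1" | "length zs = 2" | "length zs = 3" using z1 qq c8 by linarith
    then show ?thesis
    proof cases
      case 1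
      have "adj (hd zs) (at 4)"
      proof (rule ccontr)
        assume no: "\<not> adj (hd zs) (at 4)"
        have "card (nb (hd zs) \<inter> set cs) \<le> card {0, 2, 6::nat}" by (rule nb_card_le) (use nz no in auto)
        then show False using z1d[OF 1] c8 by simp
      qed
      then have zk: "adj (last zs) (at 4)" using z1l 1 by simp
      show ?thesis using F
      proof
        assume "ls = [7, 5]"
        then show ?thesis using arcs[OF yk zk, of 4 8 "[7]" "[5]" ls] 1 c8 by auto
      next
        assume "ls = [5, 5, 2]"
        then show ?thesis using arcs[OF yk zk, of 4 8 "[5, 2]" "[5]" ls] 1 c8 by auto
      qed
    next
      case 2
      \<comment> \<open>For d = 4 an ear on two vertices occurs only with a cycle of 9
        vertices.\<close>
      then show ?thesis using zspor(1) c8 by (simp add: sporadic_def)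
    next
      case 3
      have cz: "card (nb (hd zs) \<inter> set cs) = 2" using zspor(2) 3 c8 by simp
      have st: "adj (hd zs) (at (k + 4))" if "adj (hd zs) (at k)" for k
        by (rule tz[OF _ that]) (use 3 cz c8 in simp_all)
      obtain k where k: "k < length cs" "adj (hd zs) (at k)" using zex[of "{}"] cz by auto
      then have "adj (hd zs) (at 4) \<or> adj (hd zs) (at 2)" using nz[OF k] st[of k] m8[of 2] by auto
      then show ?thesis
      proof
        assume "adj (hd zs) (at 4)"
        then have zk: "adj (last zs) (at 4)" using zl 3 by simp
        show ?thesis using F
        proof
          assume "ls = [7, 5]"
          then show ?thesis using arcs[OF yk zk, of 4 6 "[7]" "[5]" ls] 3 c8 by auto
        next
          assume "ls = [5, 5, 2]"
          then show ?thesis using arcs[OF yk zk, of 4 6 "[5, 2]" "[5]" ls] 3 c8 by auto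
        qed
      next
        assume "adj (hd zs) (at 2)"
        then have zk: "adj (last zs) (at 2)" using zl 3 by simp
        show ?thesis using F
        proof
          assume "ls = [7, 5]"
          then show ?thesis using arcs[OF yk zk, of 2 6 "[5]" "[7]" ls] 3 c8 by auto
        next
          assume "ls = [5, 5, 2]"
          then show ?thesis using arcs[OF yk zk, of 2 6 "[5]" "[5, 2]" ls] 3 c8 by auto
        qed
      qed
    qed
  next
    case c12
    \<comment> \<open>Every third vertex is an attachment. Arcs of 3, 3 and 5 vertices, the first
      two prolonged by the ears, will give 3P_5.\<close>
    have F: "ls = [5, 5, 5]" using small_forests(5)[OF ls(1-3)] ls(4,5) c12 by simp
    have cA: "card (nb (hd ys) \<inter> set cs) = 4" using par(2) c12 by simp
    have a3: "adj (hd ys) (at 3)" by (rule ty[OF a0]) (use cA c12 in simp_all)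
    have a6: "adj (hd ys) (at 6)" by (rule ty[OF a3]) (use cA c12 in simp_all)
    have a9: "adj (hd ys) (at 9)" by (rule ty[OF a6]) (use cA c12 in simp_all)
    have m12: "at (k + 12) = at k" for k using c12 by (simp add: at_def)
    have x: "\<not> adj (hd zs) (at 1)" "\<not> adj (hd zs) (at 11)" "\<not> adj (hd zs) (at 2)" "\<not> adj (hd zs) (at 4)"
      "\<not> adj (hd zs) (at 5)" "\<not> adj (hd zs) (at 7)" "\<not> adj (hd zs) (at 8)" "\<not> adj (hd zs) (at 10)"
      using ex[of 0] ex[of 3] ex[of 6] ex[of 9] a0 a3 a6 a9 c12 m12[of 2] m12[of 5] m12[of 8] by auto
    have nz: "k \<in> {0, 3, 6, 9}" if "k < length cs" "adj (hd zs) (at k)" for k using less_cases(7)[of k] that x c12 by auto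
    have "card (nb (hd zs) \<inter> set cs) \<le> card {0, 3, 6, 9::nat}" by (rule nb_card_le) (use nz in auto)
    then have "length zs \<noteq> 1" using z1d c12 by auto
    then have l2: "length zs = 2" using z1 qq c12 by simp
    have "adj (hd zs) (at 3)"
    proof (rule ccontr)
      assume no: "\<not> adj (hd zs) (at 3)"
      have "card (nb (hd zs) \<inter> set cs) \<le> card {0, 6, 9::nat}" by (rule nb_card_le) (use nz no in auto)
      then show False using zspor(2) l2 c12 by simp
    qed
    then have zk: "adj (last zs) (at 3)" using zl l2 by simp
    have yk: "adj (last ys) (at 0)" using a0 yl by simp
    have p: "pth (ys @ map at [0..<3])" "pth (zs @ map at [3..<6])" "pth (map at [6..<11])"
      using arc_ear[of 0 3 ys] arc_ear[of 3 6 zs] arc[of 11 6] ed zd yR zR yk zk c12 by auto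
    have dj: "set (map at [0..<3]) \<inter> set (map at [3..<6]) = {}" "set (map at [0..<3]) \<inter> set (map at [6..<11]) = {}"
      "set (map at [3..<6]) \<inter> set (map at [6..<11]) = {}"
      by (rule arc_disjoint; use c12 in simp)+
    have sub: "set (map at [i..<j]) \<subseteq> set cs" for i j using at_in atY by auto
    have "packs [5, 5, 5] V"
    proof (rule packs_three_paths[OF p])
      show "set (ys @ map at [0..<3]) \<inter> set (zs @ map at [3..<6]) = {}"
        using dj(1) sub[of 0 3] sub[of 3 6] yR zR unfolding set_append by blast
      show "set (ys @ map at [0..<3]) \<inter> set (map at [6..<11]) = {}"
        using dj(2) sub[of 6 11] yR unfolding set_append by blast
      show "set (zs @ map at [3..<6]) \<inter> set (map at [6..<11]) = {}"
        using dj(3) sub[of 6 11] zR unfolding set_append by blast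
    qed (use c12 l2 in auto)
    then show ?thesis using F by simp
  qed
qed

lemma ear_rot_iff: "lcyc.ear V adj (rotate k cs) S ys \<longleftrightarrow> ear S ys"
  unfolding lcyc.ear_def[OF lcyc_rot] ear_def lcyc.touch_def[OF lcyc_rot] touch_def by simp

theorem outside_edge_packs:
  assumes ls: "2 \<le> length ls" "sorted_wrt (\<ge>) ls" "\<forall>l\<in>set ls. 2 \<le> l \<and> l \<noteq> 3"
      "(\<Sum>l\<leftarrow>ls. l div 2) = d + 1" "length (filter odd ls) = r"
    and e: "ear (V - set cs) ys" and q2: "2 \<le> length ys" and ne: "\<not> (d = 5 \<and> length ys = 4)"
  shows "packs ls V"
proof -
  obtain a where "adj (hd ys) a" "a \<in> set cs" using earD(4)[OF e] by (auto simp: touch_def)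
  then obtain k where k: "adj (hd ys) (at k)" using in_cs_at by blast
  interpret L: lcyc V adj d "rotate k cs" r by (rule lcyc_rot)
  have "L.at 0 = at k" using rot_nth[of 0 k] cs_pos by (simp add: L.at_def)
  moreover have "L.ear (V - set (rotate k cs)) ys" using e ear_rot_iff rot(4) by simp
  ultimately show ?thesis using L.outside_edge_packs_aligned[OF ls _ q2 ne] k by simp
qed

end

section \<open>The exceptional forest\<close>

context lcyc
begin

text \<open>The attachments of \<open>ys\<close> are \<open>at 0\<close> and \<open>at 5\<close>.
  Those of \<open>zs\<close> avoid the four cycle neighbours of these two and are invariant under a
  shift by 5, and an attachment at index 2 or 3 would complete 3P_5.\<close>

lemma exceptional_ear_aligned:
  assumes c: "d = 5" "r = 3" "length cs = 10" and e: "ear (V - set cs) ys" and l4: "length ys = 4"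
    and a0: "adj (hd ys) (at 0)" and free: "\<not> packs [5, 5, 5] V"
    and S: "closedR S" "S \<subseteq> V - set cs - set ys" and ez: "ear S zs"
  shows "length zs = 4 \<and> nb (hd zs) \<inter> set cs = nb (hd ys) \<inter> set cs"
proof -
  have q2: "2 \<le> length ys" using l4 by simp
  note ed = earD[OF e]
  note par = ear_params[OF closedR_all e q2]
  note zd = earD[OF ez]
  have zR: "set zs \<subseteq> V - set cs" "set zs \<inter> set cs = {}" "set ys \<inter> set zs = {}" using zd(3) S(2) by auto
  have yR: "set ys \<inter> set cs = {}" using ed(3) by auto
  have qq: "length zs \<le> 4" using ed(5)[OF zd(1,2) zR(1) zd(4)] l4 by simp
  have cA: "card (nb (hd ys) \<inter> set cs) = 2" using par(2) c l4 by simp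
  have m10: "at (k + 10) = at k" for k using c by (simp add: at_def)
  have tight10: "length cs = (length ys + 1) * card (nb (hd ys) \<inter> set cs)" using cA c l4 by simp
  have a5: "adj (hd ys) (at 5)" using tight_step[OF closedR_all e q2 tight10 _ a0] cA l4 by simp
  have yl: "adj (last ys) (at k) \<longleftrightarrow> adj (hd ys) (at k)" for k
    using par(1) at_in[of k] by (auto simp: set_eq_iff)
  have hz: "hd zs \<in> V" "hd zs \<notin> set cs" "hd zs \<notin> set ys" using zR hd_in_set[OF zd(2)] by blast+
  have tt: "2 * d + 1 + r \<le> length cs + length ys" using c l4 by simp
  have x: "\<not> adj (hd zs) (at 1)" "\<not> adj (hd zs) (at 9)" "\<not> adj (hd zs) (at 4)" "\<not> adj (hd zs) (at 6)"
    using no_touch_next(1)[OF ed(1,2) yR tt hz, of 0] no_touch_next(2)[OF ed(1,2) yR tt hz, of 9]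
      no_touch_next(1)[OF ed(1,2) yR tt hz, of 5] no_touch_next(2)[OF ed(1,2) yR tt hz, of 4] a0 a5 m10[of 0] by auto
  have nz: "k \<in> {0, 5, 2, 3, 7, 8}" if "k < length cs" "adj (hd zs) (at k)" for k using less_cases(6)[of k] that x c by auto
  have z1: "1 \<le> length zs" using zd(2) by (cases zs) auto
  \<comment> \<open>A single vertex would need five attachments, but it has at most one of 2, 3 and
    at most one of 7, 8.\<close>
  have not1: "length zs \<noteq> 1"
  proof
    assume "length zs = 1"
    then have d5: "5 \<le> card (nb (hd zs) \<inter> set cs)" using ear_hd[OF S(1) ez] c by simp
    have nc: "\<not> (adj (hd zs) (at 2) \<and> adj (hd zs) (at 3))" "\<not> (adj (hd zs) (at 7) \<and> adj (hd zs) (at 8))"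
      using spacing1[of "hd zs" 2 1] spacing1[of "hd zs" 7 1] hz c by auto
    define i where "i = (if adj (hd zs) (at 2) then 2 else 3::nat)"
    define j where "j = (if adj (hd zs) (at 7) then 7 else 8::nat)"
    have "k \<in> {0, 5, i, j}" if "k < length cs" "adj (hd zs) (at k)" for k
      using nz[OF that] nc that(2) by (auto simp: i_def j_def)
    then have "card (nb (hd zs) \<inter> set cs) \<le> card {0, 5, i, j}" by (intro nb_card_le) auto
    also have "\<dots> \<le> 4" by (simp add: card_insert_if)
    finally show False using d5 by simp
  qed
  then have z2: "2 \<le> length zs" using z1 by simp
  have l4z: "length zs = 4" using ear_params(3)[OF S(1) ez z2] c by (auto simp: sporadic_def)
  have cz: "card (nb (hd zs) \<inter> set cs) = 2" using ear_params(2)[OF S(1) ez z2] c l4z by simp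
  have zl: "adj (last zs) (at k) \<longleftrightarrow> adj (hd zs) (at k)" for k
    using ear_params(1)[OF S(1) ez z2] at_in[of k] by (auto simp: set_eq_iff)
  have st: "adj (hd zs) (at (k + 5))" if "adj (hd zs) (at k)" for k
    using tight_step[OF S(1) ez z2 _ _ that] cz c l4z by (simp add: eval_nat_numeral)
  have sub: "set (map at [i..<j]) \<subseteq> set cs" for i j using at_in by auto
  \<comment> \<open>The three paths are \<open>ys\<close> with \<open>at 0\<close>,
    \<open>zs\<close> with \<open>at i\<close>, and the five cycle vertices after
    \<open>at i\<close>.\<close>
  have no23: "\<not> adj (hd zs) (at i)" if i: "i = 2 \<or> i = 3" for i
  proof
    assume a: "adj (hd zs) (at i)"
    have p: "pth (ys @ map at [0..<1])" "pth (zs @ map at [i..<i + 1])" "pth (map at [i + 1..<i + 6])"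
      using arc_ear[of 0 1 ys] arc_ear[of i "i + 1" zs] arc[of "i + 6" "i + 1"] ed zd yR zR a0 a yl zl c by auto
    have dj: "set (map at [0..<1]) \<inter> set (map at [i..<i + 1]) = {}" "set (map at [0..<1]) \<inter> set (map at [i + 1..<i + 6]) = {}"
      "set (map at [i..<i + 1]) \<inter> set (map at [i + 1..<i + 6]) = {}"
      by (rule arc_disjoint; use c i in auto)+
    have "packs [5, 5, 5] V"
    proof (rule packs_three_paths[OF p])
      show "set (ys @ map at [0..<1]) \<inter> set (zs @ map at [i..<i + 1]) = {}"
        using dj(1) sub[of 0 1] sub[of i "i + 1"] yR zR unfolding set_append by blast
      show "set (ys @ map at [0..<1]) \<inter> set (map at [i + 1..<i + 6]) = {}"
        using dj(2) sub[of "i + 1" "i + 6"] yR unfolding set_append by blast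
      show "set (zs @ map at [i..<i + 1]) \<inter> set (map at [i + 1..<i + 6]) = {}"
        using dj(3) sub[of "i + 1" "i + 6"] zR unfolding set_append by blast
    qed (use l4 l4z in auto)
    then show False using free by blast
  qed
  have no: "\<not> adj (hd zs) (at 2)" "\<not> adj (hd zs) (at 3)" "\<not> adj (hd zs) (at 7)" "\<not> adj (hd zs) (at 8)"
    using no23[of 2] no23[of 3] st[of 7] st[of 8] m10[of 2] m10[of 3] by auto
  have "nb (hd zs) \<inter> set cs \<subseteq> nb (hd ys) \<inter> set cs"
  proof
    fix a assume a: "a \<in> nb (hd zs) \<inter> set cs"
    then obtain k where k: "k < length cs" "a = at k" using in_cs_at by blast
    then have "k \<in> {0, 5}" using nz[of k] a no by auto
    then show "a \<in> nb (hd ys) \<inter> set cs" using a k a0 a5 by auto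
  qed
  then have "nb (hd zs) \<inter> set cs = nb (hd ys) \<inter> set cs" using cz cA by (intro card_subset_eq) auto
  then show ?thesis using l4z by simp
qed

text \<open>A K_4 that is a component of G - A and is completely joined to \<open>A\<close>; whether
  the vertices of \<open>A\<close> are adjacent to each other is left open.\<close>

definition good_K4 :: "'a set \<Rightarrow> 'a set \<Rightarrow> bool" where
  "good_K4 A K \<longleftrightarrow> card K = 4 \<and> (\<forall>y\<in>K. nb y = (K - {y}) \<union> A)"

text \<open>The uncovered outside vertices form a closed set, and a longest ear in it would have to
  span another K_4 with the attachments \<open>A\<close>.\<close>

lemma exceptional_cover:
  assumes c: "d = 5" "r = 3" "length cs = 10" and e: "ear (V - set cs) ys" and l4: "length ys = 4"
    and free: "\<not> packs [5, 5, 5] V" and A: "A = nb (hd ys) \<inter> set cs" and x: "x \<in> V - set cs"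
  shows "\<exists>K. x \<in> K \<and> K \<subseteq> V - set cs \<and> good_K4 A K"
proof -
  define T where "T = {x \<in> V - set cs. \<exists>K. x \<in> K \<and> K \<subseteq> V - set cs \<and> good_K4 A K}"
  have q2: "2 \<le> length ys" using l4 by simp
  have good_ear: "set zs \<subseteq> T" if "closedR S" "ear S zs" "length zs = 4" "nb (hd zs) \<inter> set cs = A" for S zs
  proof -
    have zR: "set zs \<subseteq> V - set cs" using earD(3)[OF that(2)] that(1) by (auto simp: closedR_def)
    have "card (set zs) = 4" using earD(1)[OF that(2)] that(3) by (simp add: pth_def distinct_card)
    moreover have "nb y = (set zs - {y}) \<union> A" if "y \<in> set zs" for y
      using ear_clique[OF \<open>closedR S\<close> \<open>ear S zs\<close> _ that] \<open>length zs = 4\<close> \<open>nb (hd zs) \<inter> set cs = A\<close> by simp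
    ultimately have "good_K4 A (set zs)" by (simp add: good_K4_def)
    then show ?thesis using zR by (auto simp: T_def)
  qed
  have ysT: "set ys \<subseteq> T" using good_ear[OF closedR_all e l4] A by simp
  define S where "S = V - set cs - T"
  have clS: "closedR S"
  proof -
    have "b \<in> S \<union> set cs" if ab: "a \<in> S" "adj a b" for a b
    proof (rule ccontr)
      assume "b \<notin> S \<union> set cs"
      then have "b \<in> T" using ab adj_in2 by (auto simp: S_def)
      then obtain K where K: "b \<in> K" "K \<subseteq> V - set cs" "good_K4 A K" by (auto simp: T_def)
      have "a \<in> nb b" using ab adj_sym by simp
      moreover have "nb b = (K - {b}) \<union> A" using K by (simp add: good_K4_def)
      ultimately have "a \<in> (K - {b}) \<union> A" by argo
      moreover have "a \<notin> set cs" "a \<in> V" using ab by (auto simp: S_def)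
      ultimately have "a \<in> K" using A by blast
      then have "a \<in> T" using K by (auto simp: T_def)
      then show False using ab by (simp add: S_def)
    qed
    then have "\<forall>a\<in>S. nb a \<subseteq> S \<union> set cs" by (metis nb_iff subsetI)
    then show ?thesis unfolding closedR_def S_def by blast
  qed
  have "S = {}"
  proof (rule ccontr)
    assume "S \<noteq> {}"
    then obtain zs where ez: "ear S zs" using ear_exists[OF clS] by blast
    have SS: "S \<subseteq> V - set cs - set ys" using ysT by (auto simp: S_def)
    obtain a where "adj (hd ys) a" "a \<in> set cs" using earD(4)[OF e] by (auto simp: touch_def)
    then obtain k where k: "adj (hd ys) (at k)" using in_cs_at by blast
    interpret L: lcyc V adj d "rotate k cs" r by (rule lcyc_rot)
    have at0: "L.at 0 = at k" using rot_nth[of 0 k] cs_pos by (simp add: L.at_def)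
    have Lc: "L.closedR S" using clS unfolding L.closedR_def closedR_def by simp
    have "length zs = 4 \<and> nb (hd zs) \<inter> set (rotate k cs) = nb (hd ys) \<inter> set (rotate k cs)"
      by (rule L.exceptional_ear_aligned[OF c(1,2) _ _ l4 _ free Lc])
        (use c e ez ear_rot_iff at0 k SS in auto)
    then have "set zs \<subseteq> T" using good_ear[OF clS ez] A by simp
    moreover have "hd zs \<in> set zs" using earD(2)[OF ez] by simp
    ultimately show False using earD(3)[OF ez] by (auto simp: S_def)
  qed
  then show ?thesis using x by (auto simp: S_def T_def)
qed

lemma clique_path:
  assumes "distinct ws" "set ws \<subseteq> V" "\<And>x y. x \<in> set ws \<Longrightarrow> y \<in> set ws \<Longrightarrow> x \<noteq> y \<Longrightarrow> adj x y"
  shows "pth ws"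
  using assms by (auto simp: pth_def successively_conv_nth nth_eq_iff_index_eq)

text \<open>\<open>exceptional_cover\<close> reaches only vertices off the cycle. A vertex of the
  cycle other than \<open>a\<close> and \<open>b\<close> lies off a second cycle of the same length
  through \<open>a\<close> and \<open>b\<close>, obtained by exchanging one half of the first for
  \<open>ys\<close>.\<close>

theorem exceptional_structure:
  assumes c: "d = 5" "r = 3" and e: "ear (V - set cs) ys" and l4: "length ys = 4"
    and free: "\<not> packs [5, 5, 5] V"
  shows "\<exists>a b. a \<noteq> b \<and> a \<in> V \<and> b \<in> V \<and> (\<forall>x\<in>V - {a, b}. \<exists>K. x \<in> K \<and> K \<subseteq> V - {a, b} \<and> good_K4 {a, b} K)"
proof -
  have q2: "2 \<le> length ys" using l4 by simp
  note ed = earD[OF e]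
  note par = ear_params[OF closedR_all e q2]
  have c10: "length cs = 10" using par(3) c l4 by (auto simp: sporadic_def)
  have cA: "card (nb (hd ys) \<inter> set cs) = 2" using par(2) c l4 by simp
  obtain a0 where "adj (hd ys) a0" "a0 \<in> set cs" using ed(4) by (auto simp: touch_def)
  then obtain i where i: "adj (hd ys) (at i)" using in_cs_at by blast
  have tight10: "length cs = (length ys + 1) * card (nb (hd ys) \<inter> set cs)" using cA c10 l4 by simp
  have i5: "adj (hd ys) (at (i + 5))" using tight_step[OF closedR_all e q2 tight10 _ i] cA l4 by (simp add: eval_nat_numeral)
  define a where "a = at i"
  define b where "b = at (i + 5)"
  have "set (map at [i..<i + 1]) \<inter> set (map at [i + 5..<i + 6]) = {}" by (rule arc_disjoint) (use c10 in auto)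
  then have ab: "a \<noteq> b" by (auto simp: a_def b_def)
  have abc: "a \<in> set cs" "b \<in> set cs" using at_in by (auto simp: a_def b_def)
  have A: "nb (hd ys) \<inter> set cs = {a, b}"
    by (rule card_subset_eq[symmetric]) (use cA ab abc i i5 in \<open>auto simp: a_def b_def\<close>)
  have yl: "adj (last ys) (at k) \<longleftrightarrow> adj (hd ys) (at k)" for k
    using par(1) at_in[of k] by (auto simp: set_eq_iff)
  have yR: "set ys \<inter> set cs = {}" using ed(3) by auto
  have outer: "\<exists>K. x \<in> K \<and> K \<subseteq> V - {a, b} \<and> good_K4 {a, b} K" if "x \<in> V - set cs" for x
    using exceptional_cover[OF c c10 e l4 free A[symmetric] that] abc by blast
  have "V - set cs - set ys \<noteq> {}"
  proof
    assume "V - set cs - set ys = {}"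
    then have "card V \<le> card (set (cs @ ys))" by (intro card_mono) auto
    then show False using card_length[of "cs @ ys"] n c c10 l4 by simp
  qed
  then obtain x0 where x0: "x0 \<in> V - set cs" "x0 \<notin> set ys" by blast
  \<comment> \<open>The new cycles use up \<open>ys\<close>, so another K_4 has to serve as their
    ear.\<close>
  obtain K0 where K0: "x0 \<in> K0" "K0 \<subseteq> V - set cs" "good_K4 {a, b} K0"
    using exceptional_cover[OF c c10 e l4 free A[symmetric] x0(1)] by blast
  have nbK0: "nb y = (K0 - {y}) \<union> {a, b}" if "y \<in> K0" for y using K0(3) that by (simp add: good_K4_def)
  have K0ys: "K0 \<inter> set ys = {}"
  proof (rule ccontr)
    assume "K0 \<inter> set ys \<noteq> {}"
    then obtain y where y: "y \<in> K0" "y \<in> set ys" by blast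
    have "x0 \<noteq> y" using x0 y by auto
    then have "x0 \<in> nb y" using nbK0[OF y(1)] K0(1) by blast
    then show False using ear_clique[OF closedR_all e q2 y(2)] x0 by blast
  qed
  have cK0: "card K0 = 4" using K0(3) by (simp add: good_K4_def)
  then have "finite K0" by (metis card.infinite zero_neq_numeral)
  then obtain ws where ws: "set ws = K0" "distinct ws" using finite_distinct_list by blast
  have lw: "length ws = 4" using ws cK0 distinct_card by metis
  have wne: "ws \<noteq> []" using lw by auto
  have pw: "pth ws"
  proof (rule clique_path[OF ws(2)])
    show "set ws \<subseteq> V" using ws K0 by auto
    show "adj x y" if "x \<in> set ws" "y \<in> set ws" "x \<noteq> y" for x y
      using nbK0[of x] that ws(1) by (metis DiffI UnI1 nb_iff singletonD)
  qed
  have hw: "hd ws \<in> K0" using ws(1) wne by auto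
  have inner: "\<exists>K. x \<in> K \<and> K \<subseteq> V - {a, b} \<and> good_K4 {a, b} K"
    if cy: "cyc ds" "length ds = 10" "set ds \<subseteq> set cs \<union> set ys" "a \<in> set ds" "b \<in> set ds" and x: "x \<in> V - set ds" for ds x
  proof -
    interpret L: lcyc V adj d ds r by (rule lcyc_same_length) (use cy c10 in auto)
    have wsR: "set ws \<subseteq> V - set ds" using ws K0 K0ys cy(3) by blast
    have tw: "L.touch (hd ws)" using nbK0[OF hw] cy(4) by (auto simp: L.touch_def)
    have ne: "V - set ds \<noteq> {}" using x by blast
    \<comment> \<open>A longest ear has at least four vertices, since \<open>ws\<close> is a
      candidate, and by \<open>sporadic\<close> not more; hence \<open>ws\<close> itself is an
      ear.\<close>
    obtain es where es: "L.ear (V - set ds) es" using L.ear_exists[OF L.closedR_all ne] by blast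
    have "4 \<le> length es" using L.earD(5)[OF es pw wne wsR tw] lw by simp
    moreover from this have "L.sporadic (length es) d r (length ds)"
      by (intro L.ear_params(3)[OF L.closedR_all es]) simp
    ultimately have "length es = 4" using c cy(2) by (auto simp: L.sporadic_def)
    then have ew: "L.ear (V - set ds) ws"
      unfolding L.ear_def using pw wne wsR tw L.earD(5)[OF es] lw by simp
    have Aw: "{a, b} = nb (hd ws) \<inter> set ds" using nbK0[OF hw] wsR ws(1) cy by auto
    obtain K where K: "x \<in> K" "K \<subseteq> V - set ds" "L.good_K4 {a, b} K"
      using L.exceptional_cover[OF c cy(2) ew lw free Aw x] by blast
    have "good_K4 {a, b} K" using K(3) by (simp add: L.good_K4_def good_K4_def)
    moreover have "K \<subseteq> V - {a, b}" using K(2) cy(4,5) by blast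
    ultimately show ?thesis using K(1) by blast
  qed
  \<comment> \<open>\<open>ds1\<close> keeps the half of the cycle from \<open>b\<close> round to
    \<open>a\<close>, \<open>ds2\<close> the half from \<open>a\<close> to \<open>b\<close>.\<close>
  define ds1 where "ds1 = ys @ map at [i + 5..<i + 11]"
  define ds2 where "ds2 = ys @ map at [i..<i + 6]"
  have m10: "at (k + 10) = at k" for k using c10 by (simp add: at_def)
  have "pth ds1" unfolding ds1_def by (rule arc_ear) (use ed yR yl i5 c10 in auto)
  moreover have "last ds1 = at (i + 10)" by (simp add: ds1_def last_map add.commute)
  ultimately have cy1: "cyc ds1" using i m10[of i] ed(2) l4 by (auto simp: cyc_def ds1_def adj_commute)
  have "pth ds2" unfolding ds2_def by (rule arc_ear) (use ed yR yl i c10 in auto)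
  moreover have "last ds2 = at (i + 5)" by (simp add: ds2_def last_map add.commute)
  ultimately have cy2: "cyc ds2" using i5 ed(2) l4 by (auto simp: cyc_def ds2_def adj_commute)
  have len: "length ds1 = 10" "length ds2 = 10" using l4 by (auto simp: ds1_def ds2_def)
  have sub: "set ds1 \<subseteq> set cs \<union> set ys" "set ds2 \<subseteq> set cs \<union> set ys" using at_in by (auto simp: ds1_def ds2_def)
  have abd: "a \<in> set ds1" "b \<in> set ds1" "a \<in> set ds2" "b \<in> set ds2"
  proof -
    have "at (i + 10) \<in> set ds1" "at (i + 5) \<in> set ds1" "at i \<in> set ds2" "at (i + 5) \<in> set ds2"
      by (auto simp: ds1_def ds2_def)
    then show "a \<in> set ds1" "b \<in> set ds1" "a \<in> set ds2" "b \<in> set ds2" using m10[of i] by (auto simp: a_def b_def)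
  qed
  have "\<exists>K. x \<in> K \<and> K \<subseteq> V - {a, b} \<and> good_K4 {a, b} K" if x: "x \<in> V - {a, b}" for x
  proof (cases "x \<in> set cs")
    case False then show ?thesis using outer x by blast
  next
    case True
    have xys: "x \<notin> set ys" using True yR by blast
    have "x \<notin> set ds1 \<or> x \<notin> set ds2"
    proof (rule ccontr)
      assume "\<not> ?thesis"
      then have "x \<in> set (map at [i + 5..<i + 11])" "x \<in> set (map at [i..<i + 6])"
        using xys by (auto simp: ds1_def ds2_def)
      moreover have "set (map at [i + 5..<i + 11]) \<subseteq> insert a (insert b (set (map at [i + 6..<i + 10])))"
      proof
        fix w assume "w \<in> set (map at [i + 5..<i + 11])"
        then obtain k where k: "i + 5 \<le> k" "k < i + 11" "w = at k" by auto
        then consider "k = i + 5" | "k = i + 10" | "i + 6 \<le> k" "k < i + 10" by linarith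
        then show "w \<in> insert a (insert b (set (map at [i + 6..<i + 10])))"
          by cases (use k m10[of i] in \<open>auto simp: a_def b_def\<close>)
      qed
      moreover have "set (map at [i..<i + 6]) \<inter> set (map at [i + 6..<i + 10]) = {}"
        by (rule arc_disjoint) (use c10 in auto)
      ultimately show False using x by blast
    qed
    then show ?thesis using inner[OF cy1 len(1) sub(1) abd(1,2)] inner[OF cy2 len(2) sub(2) abd(3,4)] x by blast
  qed
  then show ?thesis using ab abc pth_cs(3) by blast
qed

end

section \<open>Longest cycles with independent complement\<close>

lemma split_into_blocks:
  assumes "xs \<noteq> []" "P (hd xs)"
  shows "\<exists>bs. concat bs = xs \<and> (\<forall>b\<in>set bs. b \<noteq> [] \<and> P (hd b) \<and> (\<forall>x\<in>set (tl b). \<not> P x))"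
  using assms
proof (induction "length xs" arbitrary: xs rule: less_induct)
  case less
  obtain x ys where xs: "xs = x # ys" using less.prems by (cases xs) auto
  define u where "u = takeWhile (\<lambda>x. \<not> P x) ys"
  define v where "v = dropWhile (\<lambda>x. \<not> P x) ys"
  have uv: "ys = u @ v" by (simp add: u_def v_def)
  have u: "\<forall>x\<in>set u. \<not> P x" unfolding u_def by (auto dest: set_takeWhileD)
  show ?case
  proof (cases "v = []")
    case True
    then show ?thesis using xs uv u less.prems by (intro exI[of _ "[x # ys]"]) auto
  next
    case False
    then have "P (hd v)" unfolding v_def using hd_dropWhile by blast
    moreover have "length v < length xs" using xs uv by simp
    ultimately obtain bs where "concat bs = v" "\<forall>b\<in>set bs. b \<noteq> [] \<and> P (hd b) \<and> (\<forall>x\<in>set (tl b). \<not> P x)"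
      using less.hyps[of v] False by blast
    then show ?thesis using xs uv u less.prems by (intro exI[of _ "(x # u) # bs"]) auto
  qed
qed

text \<open>Used with one more hub than common neighbours, so that the resulting path begins and
  ends in a hub.\<close>

fun alt :: "'a list \<Rightarrow> 'a list \<Rightarrow> 'a list" where
  "alt (h # h' # hs) (x # xs) = h # x # alt (h' # hs) xs"
| "alt hs xs = hs"

lemma disjoint_mono_left: "B \<inter> C = {} \<Longrightarrow> A \<subseteq> B \<Longrightarrow> A \<inter> C = {}"
  by blast

context graph
begin

lemma alt_path:
  assumes "hs \<noteq> []" "length hs = Suc (length xs)" "distinct (hs @ xs)" "set (hs @ xs) \<subseteq> V"
    "\<And>h x. h \<in> set hs \<Longrightarrow> x \<in> set xs \<Longrightarrow> adj h x"
  shows "pth (alt hs xs) \<and> set (alt hs xs) = set hs \<union> set xs \<and> hd (alt hs xs) = hd hs \<and>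
    last (alt hs xs) = last hs \<and> length (alt hs xs) = length hs + length xs \<and> alt hs xs \<noteq> []"
  using assms
proof (induction hs xs rule: alt.induct)
  case (1 h h' hs x xs)
  have IH: "pth (alt (h' # hs) xs) \<and> set (alt (h' # hs) xs) = set (h' # hs) \<union> set xs \<and> hd (alt (h' # hs) xs) = hd (h' # hs) \<and>
    last (alt (h' # hs) xs) = last (h' # hs) \<and> length (alt (h' # hs) xs) = length (h' # hs) + length xs \<and> alt (h' # hs) xs \<noteq> []"
    by (rule "1.IH") (use "1.prems" in auto)
  have "adj h x" "adj x h'" using "1.prems"(5) adj_sym by auto
  then show ?case using IH "1.prems"(3,4) by (auto simp: pth_Cons)
qed (auto simp: length_Suc_conv)

text \<open>P_l is laid out as \<open>l div 2\<close> hubs alternating with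
  \<open>l div 2 - 1\<close> common neighbours. The private partner of the last hub completes it for
  even \<open>l\<close>, and that of the first hub is added for odd \<open>l\<close>; these two hubs
  differ because \<open>l\<close> is not 3.\<close>

lemma alt_packs:
  assumes "distinct hs" "distinct xs" "set hs \<inter> set xs = {}" "set hs \<union> set xs \<subseteq> V"
    and full: "\<And>h x. h \<in> set hs \<Longrightarrow> x \<in> set xs \<Longrightarrow> adj h x"
    and mu: "inj_on mu (set hs)" "\<And>h. h \<in> set hs \<Longrightarrow> adj h (mu h)" "mu ` set hs \<inter> (set hs \<union> set xs) = {}"
    and ls: "\<forall>l\<in>set ls. 2 \<le> l \<and> l \<noteq> 3" "(\<Sum>l\<leftarrow>ls. l div 2) \<le> length hs" "(\<Sum>l\<leftarrow>ls. l div 2 - 1) \<le> length xs"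
  shows "packs ls (set hs \<union> set xs \<union> mu ` set hs)"
  using assms
proof (induction ls arbitrary: hs xs)
  case Nil then show ?case by simp
next
  case (Cons l ls)
  define k where "k = l div 2"
  have k1: "1 \<le> k" "odd l \<Longrightarrow> 2 \<le> k" using Cons.prems(9) by (auto simp: k_def, presburger+)
  define h1 where "h1 = take k hs" define h2 where "h2 = drop k hs"
  define x1 where "x1 = take (k - 1) xs" define x2 where "x2 = drop (k - 1) xs"
  have hh: "hs = h1 @ h2" "xs = x1 @ x2" by (auto simp: h1_def h2_def x1_def x2_def)
  have kl: "k \<le> length hs" "k - 1 \<le> length xs" using Cons.prems(10,11) by (auto simp: k_def)
  have len: "length h1 = k" "length x1 = k - 1" using kl by (auto simp: h1_def x1_def)
  have h1ne: "h1 \<noteq> []" using len k1 by auto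
  have IH: "packs ls (set h2 \<union> set x2 \<union> mu ` set h2)"
  proof (rule Cons.IH)
    show "inj_on mu (set h2)" using Cons.prems(6) hh by (auto simp: inj_on_def)
    show "mu ` set h2 \<inter> (set h2 \<union> set x2) = {}" using Cons.prems(8) hh by auto
    show "(\<Sum>l\<leftarrow>ls. l div 2) \<le> length h2" "(\<Sum>l\<leftarrow>ls. l div 2 - 1) \<le> length x2"
      using Cons.prems(10,11) by (auto simp: h2_def x2_def k_def)
  qed (use Cons.prems hh in auto)
  define q where "q = alt h1 x1"
  have q: "pth q" "set q = set h1 \<union> set x1" "hd q = hd h1" "last q = last h1" "length q = 2 * k - 1" "q \<noteq> []"
  proof -
    have "pth (alt h1 x1) \<and> set (alt h1 x1) = set h1 \<union> set x1 \<and> hd (alt h1 x1) = hd h1 \<and>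
      last (alt h1 x1) = last h1 \<and> length (alt h1 x1) = length h1 + length x1 \<and> alt h1 x1 \<noteq> []"
      by (rule alt_path[OF h1ne]) (use Cons.prems(1-5) len k1 hh in auto)
    then show "pth q" "set q = set h1 \<union> set x1" "hd q = hd h1" "last q = last h1" "length q = 2 * k - 1" "q \<noteq> []"
      using len k1 by (auto simp: q_def)
  qed
  have inh: "hd h1 \<in> set hs" "last h1 \<in> set hs" "hd h1 \<in> set h1" "last h1 \<in> set h1" using h1ne hh by auto
  have muV: "mu h \<in> V" if "h \<in> set hs" for h using Cons.prems(7)[OF that] adj_in2 by blast
  have mun: "mu h \<notin> set hs" "mu h \<notin> set xs" if "h \<in> set hs" for h using Cons.prems(8) that by auto
  have p1: "pth (q @ [mu (last h1)])"
    using q inh muV mun Cons.prems(7) hh by (auto simp: pth_append)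
  define p where "p = (if odd l then mu (hd h1) # q @ [mu (last h1)] else q @ [mu (last h1)])"
  have pp: "pth p"
  proof (cases "odd l")
    case True
    have "hd h1 \<noteq> last h1"
    proof -
      have "distinct h1" using Cons.prems(1) hh by simp
      then show ?thesis using len k1(2)[OF True] h1ne by (auto simp: hd_conv_nth last_conv_nth nth_eq_iff_index_eq)
    qed
    then have "mu (hd h1) \<noteq> mu (last h1)" using Cons.prems(6) inh by (auto simp: inj_on_def)
    then show ?thesis using True p1 q inh muV mun Cons.prems(7)[OF inh(1)] hh
      by (auto simp: p_def pth_Cons adj_commute)
  qed (simp add: p_def p1)
  have lp: "length p = l"
  proof (cases "odd l")
    case True then show ?thesis using q(5) k1 by (auto simp: p_def k_def)
  next
    case False then show ?thesis using q(5) k1 by (auto simp: p_def k_def)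
  qed
  have sp: "set p \<subseteq> set h1 \<union> set x1 \<union> mu ` set h1" using q inh by (auto simp: p_def)
  show ?case
  proof (rule packs_Cons[OF pp _ IH])
    show "l \<le> length p" using lp by simp
    have "set h1 \<inter> set h2 = {}" using Cons.prems(1) hh by auto
    then have "mu ` set h1 \<inter> mu ` set h2 = {}"
      using inj_on_image_Int[OF Cons.prems(6), of "set h1" "set h2"] hh by auto
    moreover have "mu ` set h1 \<inter> (set h2 \<union> set x2) = {}" "mu ` set h2 \<inter> (set h1 \<union> set x1) = {}" using Cons.prems(8) hh by auto
    moreover have "(set h1 \<union> set x1) \<inter> (set h2 \<union> set x2) = {}" using Cons.prems(1-3) hh by auto
    ultimately have "(set h1 \<union> set x1 \<union> mu ` set h1) \<inter> (set h2 \<union> set x2 \<union> mu ` set h2) = {}"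
      unfolding Int_Un_distrib Int_Un_distrib2 by (simp add: Int_commute)
    then show "set p \<inter> (set h2 \<union> set x2 \<union> mu ` set h2) = {}" using sp by (rule disjoint_mono_left)
    show "set p \<union> (set h2 \<union> set x2 \<union> mu ` set h2) \<subseteq> set hs \<union> set xs \<union> mu ` set hs"
      using sp hh by auto
  qed
qed

text \<open>One path may start with an arbitrary piece \<open>p0\<close>, which saves hubs.\<close>

lemma special_packs:
  assumes hx: "distinct hs" "distinct xs" "set hs \<inter> set xs = {}" "set hs \<union> set xs \<subseteq> V"
    and full: "\<And>h x. h \<in> set hs \<Longrightarrow> x \<in> set xs \<Longrightarrow> adj h x"
    and mu: "inj_on mu (set hs)" "\<And>h. h \<in> set hs \<Longrightarrow> adj h (mu h)" "mu ` set hs \<inter> (set hs \<union> set xs) = {}"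
    and p0: "pth p0" "p0 \<noteq> []" "set p0 \<inter> (set hs \<union> set xs \<union> mu ` set hs) = {}" "hs \<noteq> [] \<Longrightarrow> adj (last p0) (hd hs)"
    and l: "l = length p0 + 2 * j" "j \<le> length hs"
    and ls: "\<forall>l\<in>set ls. 2 \<le> l \<and> l \<noteq> 3" "(\<Sum>l\<leftarrow>ls. l div 2) + j \<le> length hs" "(\<Sum>l\<leftarrow>ls. l div 2 - 1) + (j - 1) \<le> length xs"
  shows "packs (l # ls) V"
proof -
  define h1 where "h1 = take j hs" define h2 where "h2 = drop j hs"
  define x1 where "x1 = take (j - 1) xs" define x2 where "x2 = drop (j - 1) xs"
  have hh: "hs = h1 @ h2" "xs = x1 @ x2" by (auto simp: h1_def h2_def x1_def x2_def)
  have len: "length h1 = j" "length x1 = j - 1" using l ls(3) by (auto simp: h1_def x1_def)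
  have IH: "packs ls (set h2 \<union> set x2 \<union> mu ` set h2)"
  proof (rule alt_packs)
    show "inj_on mu (set h2)" using mu(1) hh by (auto simp: inj_on_def)
    show "mu ` set h2 \<inter> (set h2 \<union> set x2) = {}" using mu(3) hh by auto
    show "(\<Sum>l\<leftarrow>ls. l div 2) \<le> length h2" "(\<Sum>l\<leftarrow>ls. l div 2 - 1) \<le> length x2"
      using ls by (auto simp: h2_def x2_def)
  qed (use hx full mu ls hh in auto)
  have YV: "set h2 \<union> set x2 \<union> mu ` set h2 \<subseteq> V" using hx(4) mu(2) adj_in2 hh by auto
  have dj: "mu ` set h1 \<inter> mu ` set h2 = {}" "mu ` set h1 \<inter> (set h2 \<union> set x2) = {}" "mu ` set h2 \<inter> (set h1 \<union> set x1) = {}"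
    "(set h1 \<union> set x1) \<inter> (set h2 \<union> set x2) = {}"
  proof -
    have "set h1 \<inter> set h2 = {}" using hx(1) hh by auto
    then show "mu ` set h1 \<inter> mu ` set h2 = {}"
      using inj_on_image_Int[OF mu(1), of "set h1" "set h2"] hh by auto
    show "mu ` set h1 \<inter> (set h2 \<union> set x2) = {}" "mu ` set h2 \<inter> (set h1 \<union> set x1) = {}" using mu(3) hh by auto
    show "(set h1 \<union> set x1) \<inter> (set h2 \<union> set x2) = {}" using hx(1-3) hh by auto
  qed
  have dj12: "(set h1 \<union> set x1 \<union> mu ` set h1) \<inter> (set h2 \<union> set x2 \<union> mu ` set h2) = {}"
    using dj unfolding Int_Un_distrib Int_Un_distrib2 by (simp add: Int_commute)
  show ?thesis
  proof (cases "j = 0")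
    case True
    show ?thesis
      by (rule packs_Cons[OF p0(1) _ IH]) (use True l p0 hh YV in \<open>auto simp: pth_def\<close>)
  next
    case False
    then have h1ne: "h1 \<noteq> []" "hs \<noteq> []" using len hh by auto
    \<comment> \<open>After \<open>p0\<close> come \<open>j\<close> hubs, \<open>j - 1\<close>
      common neighbours and one partner, that is \<open>2 * j\<close> vertices.\<close>
    define q where "q = alt h1 x1"
    have q: "pth q" "set q = set h1 \<union> set x1" "hd q = hd h1" "last q = last h1" "length q = 2 * j - 1" "q \<noteq> []"
    proof -
      have "pth (alt h1 x1) \<and> set (alt h1 x1) = set h1 \<union> set x1 \<and> hd (alt h1 x1) = hd h1 \<and>
        last (alt h1 x1) = last h1 \<and> length (alt h1 x1) = length h1 + length x1 \<and> alt h1 x1 \<noteq> []"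
        by (rule alt_path[OF h1ne(1)]) (use hx full len False hh in auto)
      then show "pth q" "set q = set h1 \<union> set x1" "hd q = hd h1" "last q = last h1" "length q = 2 * j - 1" "q \<noteq> []"
        using len False by (auto simp: q_def)
    qed
    have lh: "last h1 \<in> set h1" "hd h1 = hd hs" using h1ne hh by auto
    have muV: "mu (last h1) \<in> V" "mu (last h1) \<notin> set h1" "mu (last h1) \<notin> set x1" "adj (last h1) (mu (last h1))"
      using mu(2)[of "last h1"] mu(3) adj_in2 lh hh by auto
    have p1: "pth (q @ [mu (last h1)])" using q muV by (auto simp: pth_append)
    have "set p0 \<inter> set (q @ [mu (last h1)]) = {}" using p0(3) q(2) lh hh by auto
    then have pp: "pth (p0 @ q @ [mu (last h1)])"
      using p0 p1 q lh h1ne by (subst pth_append) (auto simp: hd_append)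
    have sp: "set (p0 @ q @ [mu (last h1)]) \<subseteq> set p0 \<union> (set h1 \<union> set x1 \<union> mu ` set h1)" using q lh by auto
    show ?thesis
    proof (rule packs_Cons[OF pp _ IH])
      show "l \<le> length (p0 @ q @ [mu (last h1)])" using l q False by simp
      have "set p0 \<inter> (set h2 \<union> set x2 \<union> mu ` set h2) = {}" using p0(3) hh by auto
      then have "(set p0 \<union> (set h1 \<union> set x1 \<union> mu ` set h1)) \<inter> (set h2 \<union> set x2 \<union> mu ` set h2) = {}"
        using dj12 by (simp add: Int_Un_distrib2)
      then show "set (p0 @ q @ [mu (last h1)]) \<inter> (set h2 \<union> set x2 \<union> mu ` set h2) = {}"
        using sp by (rule disjoint_mono_left)
      show "set (p0 @ q @ [mu (last h1)]) \<union> (set h2 \<union> set x2 \<union> mu ` set h2) \<subseteq> V"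
        using pp YV unfolding pth_def by blast
    qed
  qed
qed

text \<open>P_l takes \<open>l div 2\<close> consecutive blocks of at least two vertices; for odd
  \<open>l\<close> the partner of the first hub supplies the missing vertex.\<close>

lemma blocks_pack:
  assumes "pth (concat bs)" "\<And>b. b \<in> set bs \<Longrightarrow> 2 \<le> length b \<and> adj (hd b) (mu (hd b))"
    "inj_on mu (hd ` set bs)" "mu ` hd ` set bs \<inter> set (concat bs) = {}"
    "(\<Sum>l\<leftarrow>ls. l div 2) \<le> length bs" "\<forall>l\<in>set ls. 2 \<le> l"
  shows "packs ls (set (concat bs) \<union> mu ` hd ` set bs)"
  using assms
proof (induction ls arbitrary: bs)
  case Nil then show ?case by simp
next
  case (Cons l ls)
  define k where "k = l div 2"
  define b1 where "b1 = take k bs" define b2 where "b2 = drop k bs"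
  have bb: "bs = b1 @ b2" by (simp add: b1_def b2_def)
  have len: "length b1 = k" "(\<Sum>l\<leftarrow>ls. l div 2) \<le> length b2" using Cons.prems(5) by (auto simp: b1_def b2_def k_def)
  have pc: "pth (concat b1)" "pth (concat b2)" "set (concat b1) \<inter> set (concat b2) = {}"
    using Cons.prems(1) unfolding bb concat_append pth_append by auto
  have heads: "hd ` set b1 \<subseteq> set (concat b1)" "hd ` set b2 \<subseteq> set (concat b2)"
  proof -
    have "hd b \<in> set b" if "b \<in> set bs" for b using Cons.prems(2)[OF that] by (cases b) auto
    then show "hd ` set b1 \<subseteq> set (concat b1)" "hd ` set b2 \<subseteq> set (concat b2)" using bb by auto
  qed
  have IH: "packs ls (set (concat b2) \<union> mu ` hd ` set b2)"
  proof (rule Cons.IH[OF pc(2)])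
    show "2 \<le> length b \<and> adj (hd b) (mu (hd b))" if "b \<in> set b2" for b using Cons.prems(2) that bb by auto
    show "inj_on mu (hd ` set b2)" using Cons.prems(3) bb by (auto simp: inj_on_def)
    show "mu ` hd ` set b2 \<inter> set (concat b2) = {}" using Cons.prems(4) bb by auto
    show "\<forall>l\<in>set ls. 2 \<le> l" using Cons.prems(6) by simp
  qed (rule len)
  have "2 * length us \<le> length (concat us)" if "\<forall>b\<in>set us. 2 \<le> length b" for us :: "'a list list"
    using that by (induction us) auto
  then have "2 * length b1 \<le> length (concat b1)" using Cons.prems(2) bb by auto
  then have l2k: "2 * k \<le> length (concat b1)" using len by simp
  have k1: "1 \<le> k" using Cons.prems(6) div_le_mono[of 2 l 2] by (simp add: k_def)
  define p where "p = (if odd l then mu (hd (hd b1)) # concat b1 else concat b1)"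
  have pp: "pth p"
  proof (cases "odd l")
    case True
    have b1ne: "b1 \<noteq> []" using len k1 by auto
    then have hb: "hd b1 \<in> set b1" by simp
    then have h: "2 \<le> length (hd b1)" "adj (hd (hd b1)) (mu (hd (hd b1)))" using Cons.prems(2) bb by auto
    have "hd (concat b1) = hd (hd b1)" using b1ne h(1) by (cases b1) (auto simp: hd_append)
    moreover have "mu (hd (hd b1)) \<notin> set (concat b1)" using Cons.prems(4) hb bb by auto
    ultimately show ?thesis using True pc(1) h adj_in2 by (auto simp: p_def pth_Cons adj_commute)
  qed (use pc in \<open>auto simp: p_def\<close>)
  have lp: "l \<le> length p"
  proof (cases "odd l")
    case True
    then have "l = 2 * k + 1" by (simp add: k_def)
    then show ?thesis using l2k True by (simp add: p_def)
  next
    case False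
    then have "l = 2 * k" by (simp add: k_def)
    then show ?thesis using l2k False by (simp add: p_def)
  qed
  have sp: "set p \<subseteq> set (concat b1) \<union> mu ` hd ` set b1"
    using len k1 by (cases b1) (auto simp: p_def)
  have dj: "mu ` hd ` set b1 \<inter> mu ` hd ` set b2 = {}"
  proof -
    have "hd ` set b1 \<inter> hd ` set b2 = {}" using heads pc(3) by blast
    then show ?thesis using Cons.prems(3) bb by (auto simp: inj_on_def)
  qed
  have dj2: "mu ` hd ` set b1 \<inter> set (concat b2) = {}" "mu ` hd ` set b2 \<inter> set (concat b1) = {}" using Cons.prems(4) bb by auto
  show ?case
  proof (rule packs_Cons[OF pp lp IH])
    have "P \<inter> (C \<union> D) = {}" if "P \<subseteq> A \<union> B" "A \<inter> C = {}" "B \<inter> C = {}" "B \<inter> D = {}" "D \<inter> A = {}"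
      for P A B C D :: "'a set" using that by blast
    from this[OF sp pc(3) dj2(1) dj dj2(2)]
    show "set p \<inter> (set (concat b2) \<union> mu ` hd ` set b2) = {}" .
    show "set p \<union> (set (concat b2) \<union> mu ` hd ` set b2) \<subseteq> set (concat bs) \<union> mu ` hd ` set bs"
      using sp bb by auto
  qed
qed

end

section \<open>Splitting the cycle at the neighbours of an outside vertex\<close>

context lcyc
begin

text \<open>An outside vertex missed by a maximum matching from the cycle into its complement has only
  matched neighbours, so all its neighbours have private partners outside the cycle.\<close>

lemma private_partners:
  assumes out: "\<And>x y. x \<notin> set cs \<Longrightarrow> y \<notin> set cs \<Longrightarrow> \<not> adj x y"
  obtains y mu where "y \<in> V - set cs" "nb y \<subseteq> set cs" "inj_on mu (nb y)" "\<And>a. a \<in> nb y \<Longrightarrow> adj a (mu a)"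
    "\<And>a. a \<in> nb y \<Longrightarrow> mu a \<in> V - set cs - {y}"
proof -
  define R where "R = V - set cs"
  have finR: "finite R" using fin by (simp add: R_def)
  \<comment> \<open>The cycle has at most 2d + 1 + r vertices, and the order of G exceeds twice that
    number.\<close>
  have cR: "length cs < card R"
  proof -
    have "R \<noteq> {}"
    proof
      assume "R = {}"
      then have "card V \<le> card (set cs)" by (intro card_mono) (auto simp: R_def)
      then have "card V \<le> length cs" using card_length[of cs] by linarith
      moreover have "length cs < 2 * d + 2 + r" using bound[OF pth_cs(1)] .
      ultimately show False using n by linarith
    qed
    then obtain ys where e: "ear R ys" using ear_exists[OF closedR_all] unfolding R_def by blast
    have "length cs + length ys \<le> 2 * d + 1 + r" by (rule ear_length[OF _ e]) (simp add: R_def)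
    moreover have "card R = card V - card (set cs)" unfolding R_def using pth_cs(3) by (intro card_Diff_subset) auto
    moreover have "card (set cs) = length cs" using pth_cs(2) by (simp add: distinct_card)
    ultimately show ?thesis using n by linarith
  qed
  define P where "P = {D. D \<subseteq> set cs \<and> (\<exists>mu. inj_on mu D \<and> (\<forall>a\<in>D. mu a \<in> R \<and> adj a (mu a)))}"
  have finP: "finite P" unfolding P_def by (rule finite_subset[of _ "Pow (set cs)"]) auto
  have "{} \<in> P" by (simp add: P_def)
  then have "Max (card ` P) \<in> card ` P" using finP by (intro Max_in) auto
  then obtain D where D: "D \<in> P" "card D = Max (card ` P)" by auto
  have Dmax: "card D' \<le> card D" if "D' \<in> P" for D' using that finP D by simp
  obtain mu where mu: "inj_on mu D" "\<forall>a\<in>D. mu a \<in> R \<and> adj a (mu a)" and Dc: "D \<subseteq> set cs" using D by (auto simp: P_def)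
  have finD: "finite D" using Dc finite_subset by blast
  have "card (mu ` D) \<le> length cs"
  proof -
    have "card (mu ` D) \<le> card D" by (rule card_image_le[OF finD])
    also have "\<dots> \<le> card (set cs)" using Dc by (intro card_mono) auto
    also have "\<dots> \<le> length cs" by (rule card_length)
    finally show ?thesis .
  qed
  then have "\<not> R \<subseteq> mu ` D" using cR card_mono[of "mu ` D" R] finD by auto
  then obtain y where y: "y \<in> R" "y \<notin> mu ` D" by blast
  have nby: "nb y \<subseteq> set cs"
  proof
    fix x assume "x \<in> nb y"
    then show "x \<in> set cs" using out[of y x] y by (auto simp: R_def)
  qed
  have sub: "nb y \<subseteq> D"
  proof
    fix a assume a: "a \<in> nb y"
    show "a \<in> D"
    proof (rule ccontr)
      assume aD: "a \<notin> D"
      \<comment> \<open>Pairing \<open>a\<close> with the unmatched vertex \<open>y\<close> would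
        enlarge the matching.\<close>
      let ?mu = "mu(a := y)"
      have "inj_on ?mu (insert a D)" using mu(1) y(2) aD by (auto simp: inj_on_def)
      moreover have "\<forall>b\<in>insert a D. ?mu b \<in> R \<and> adj b (?mu b)" using mu(2) y(1) a aD adj_sym by auto
      moreover have "insert a D \<subseteq> set cs" using Dc a nby by auto
      ultimately have "insert a D \<in> P" unfolding P_def by blast
      then show False using Dmax[of "insert a D"] aD finD by simp
    qed
  qed
  show ?thesis
  proof (rule that[of y mu])
    show "y \<in> V - set cs" using y by (simp add: R_def)
    show "nb y \<subseteq> set cs" by (rule nby)
    show "inj_on mu (nb y)" using mu(1) sub inj_on_subset by blast
    show "adj a (mu a)" if "a \<in> nb y" for a using mu(2) sub that by blast
    show "mu a \<in> V - set cs - {y}" if "a \<in> nb y" for a using mu(2) sub that y(2) by (auto simp: R_def)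
  qed
qed

lemma no_longer_cycle: "cyc zs \<Longrightarrow> length zs = Suc (length cs) \<Longrightarrow> False"
  using longest by fastforce

text \<open>Otherwise there is a longer cycle: from \<open>y\<close> to \<open>hd b'\<close>,
  backwards to \<open>b ! 1\<close>, across to \<open>b' ! 1\<close>, onwards to \<open>hd b\<close>
  and back to \<open>y\<close>.\<close>

lemma succ_nonadj:
  assumes cy: "cyc (b @ P @ b' @ Q)" "length (b @ P @ b' @ Q) = length cs" and y: "y \<in> V" "y \<notin> set (b @ P @ b' @ Q)"
    and a: "adj y (hd b)" "adj y (hd b')" and l: "2 \<le> length b" "2 \<le> length b'"
  shows "\<not> adj (b ! 1) (b' ! 1)"
proof
  assume ad: "adj (b ! 1) (b' ! 1)"
  obtain h t where b: "b = h # t" using l by (cases b) auto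
  obtain h' t' where b': "b' = h' # t'" using l by (cases b') auto
  have tne: "t \<noteq> []" "t' \<noteq> []" using l b b' by auto
  have hd1: "hd t = b ! 1" "hd t' = b' ! 1" using tne b b' by (auto simp: hd_conv_nth)
  have p: "pth ((h # t) @ P @ (h' # t') @ Q)" using cy b b' by (auto simp: cyc_def)
  have "cyc (((h' # t') @ Q) @ ((h # t) @ P))" using cyc_rotate[of "(h # t) @ P" "(h' # t') @ Q"] cy b b' by simp
  then have p2: "pth ((h' # t') @ Q @ (h # t) @ P)" by (simp add: cyc_def)
  have q1: "pth (t @ P @ [h'])"
  proof -
    have "pth ([h] @ (t @ P @ [h']) @ t' @ Q)" using p by simp
    then show ?thesis unfolding pth_append[of "[h]"] pth_append[of "t @ P @ [h']"] by blast
  qed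
  have q2: "pth (t' @ Q @ [h])"
  proof -
    have "pth ([h'] @ (t' @ Q @ [h]) @ t @ P)" using p2 by simp
    then show ?thesis unfolding pth_append[of "[h']"] pth_append[of "t' @ Q @ [h]"] by blast
  qed
  have dj: "set (t @ P @ [h']) \<inter> set (t' @ Q @ [h]) = {}" using p by (auto simp: pth_def)
  have "pth (rev (t @ P @ [h']) @ (t' @ Q @ [h]))"
    unfolding pth_append[of "rev (t @ P @ [h'])"]
    using q1 q2 dj ad hd1 tne by (auto simp: last_rev hd_append simp del: rev_append)
  then have "cyc (y # rev (t @ P @ [h']) @ (t' @ Q @ [h]))"
    using y a b b' by (auto simp: cyc_def pth_Cons adj_commute)
  then show False by (rule no_longer_cycle) (use cy(2) b b' in simp)
qed

text \<open>The mirror image of \<open>succ_nonadj\<close>: here \<open>y\<close> sees the vertices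
  that follow the two blocks, \<open>hd (P @ b')\<close> and \<open>hd (Q @ b)\<close>.\<close>

lemma pred_nonadj:
  assumes cy: "cyc (b @ P @ b' @ Q)" "length (b @ P @ b' @ Q) = length cs" and y: "y \<in> V" "y \<notin> set (b @ P @ b' @ Q)"
    and a: "adj y (hd (P @ b'))" "adj y (hd (Q @ b))" and l: "b \<noteq> []" "b' \<noteq> []"
  shows "\<not> adj (last b) (last b')"
proof
  assume ad: "adj (last b) (last b')"
  have p: "pth (b @ (P @ b') @ Q)" using cy by (simp add: cyc_def)
  then have q1: "pth (P @ b')" unfolding pth_append[of b] pth_append[of "P @ b'"] by blast
  have "cyc (Q @ b @ P @ b')" using cyc_rotate[of "b @ P @ b'" Q] cy by simp
  then have "pth ((Q @ b) @ P @ b')" by (simp add: cyc_def)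
  then have q2: "pth (Q @ b)" and dj: "set (Q @ b) \<inter> set (P @ b') = {}" unfolding pth_append[of "Q @ b"] by blast+
  have "pth ((P @ b') @ rev (Q @ b))"
    unfolding pth_append[of "P @ b'"] using q1 q2 dj ad l by (auto simp: hd_rev adj_commute simp del: rev_append)
  then have "pth (y # (P @ b') @ rev (Q @ b))"
    using y a l by (auto simp: pth_Cons hd_append simp del: rev_append)
  moreover have "last (y # (P @ b') @ rev (Q @ b)) = hd (Q @ b)" using l by (simp add: last_rev del: rev_append)
  ultimately have "cyc (y # (P @ b') @ rev (Q @ b))"
    using a l cy(2) c3 by (auto simp: cyc_def adj_commute simp del: rev_append)
  then show False by (rule no_longer_cycle) (use cy(2) in simp)
qed

lemma length_eq_2_or_3:
  "length b = 2 \<longleftrightarrow> (\<exists>h m. b = [h, m])" "length b = 3 \<longleftrightarrow> (\<exists>h t t'. b = [h, t, t'])"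
  by (auto simp: eval_nat_numeral length_Suc_conv)

text \<open>The neighbours \<open>A\<close> of \<open>y\<close> are hubs with private partners, and
  the cycle splits into blocks headed by them. F takes d + 1 hubs; this forces |A| = d and forbids
  every piece of path that saves a hub. The hypothesis \<open>out\<close> ranges over all cycles of
  the same length because exchanging a cycle vertex for \<open>y\<close> produces another
  one.\<close>

theorem independent_complement:
  assumes ls: "2 \<le> length ls" "\<forall>l\<in>set ls. 2 \<le> l \<and> l \<noteq> 3" "(\<Sum>l\<leftarrow>ls. l div 2) = d + 1" "length (filter odd ls) = r"
    and out: "\<And>ds x y. cyc ds \<Longrightarrow> length ds = length cs \<Longrightarrow> x \<notin> set ds \<Longrightarrow> y \<notin> set ds \<Longrightarrow> \<not> adj x y"
    and free: "\<not> packs ls V"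
  shows "(\<exists>A\<subseteq>V. card A = d \<and> (\<forall>x y. adj x y \<longrightarrow> x \<in> A \<or> y \<in> A)) \<or>
    ((\<forall>l\<in>set ls. odd l) \<and> (\<exists>A\<subseteq>V. card A = d \<and> (\<exists>t\<in>V - A. \<exists>t'\<in>V - A. t \<noteq> t' \<and>
      (\<forall>x y. adj x y \<longrightarrow> x \<in> A \<or> y \<in> A \<or> {x, y} = {t, t'}))))"
proof -
  obtain y mu where y: "y \<in> V - set cs" "nb y \<subseteq> set cs" and mu: "inj_on mu (nb y)" "\<And>a. a \<in> nb y \<Longrightarrow> adj a (mu a)"
    "\<And>a. a \<in> nb y \<Longrightarrow> mu a \<in> V - set cs - {y}"
    using private_partners[OF out[OF cs refl]] by blast
  define A where "A = nb y"
  have yV: "y \<in> V" "y \<notin> set cs" "y \<notin> A" using y adj_irrefl by (auto simp: A_def)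
  have AV: "A \<subseteq> V" "A \<subseteq> set cs" "finite A" using y pth_cs(3) by (auto simp: A_def)
  have dA: "d \<le> card A" using deg yV by (simp add: A_def)
  then obtain a0 where "a0 \<in> A" using d_pos by fastforce
  then obtain k where k: "at k \<in> A" using AV(2) in_cs_at by blast
  \<comment> \<open>The cycle, rotated to begin in \<open>A\<close>, is cut before each vertex of
    \<open>A\<close>.\<close>
  obtain bs where bs: "concat bs = rotate k cs" "\<And>b. b \<in> set bs \<Longrightarrow> b \<noteq> [] \<and> hd b \<in> A \<and> (\<forall>x\<in>set (tl b). x \<notin> A)"
    using split_into_blocks[of "rotate k cs" "\<lambda>x. x \<in> A"] rot_hd[of k] k cs_pos by auto
  have cB: "cyc (concat bs)" "set (concat bs) = set cs" "length (concat bs) = length cs" "distinct (concat bs)"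
    using bs(1) rot[of k] by (auto simp: pth_def)
  have rotB: "cyc (concat (vs @ us))" "set (concat (vs @ us)) = set cs" "length (concat (vs @ us)) = length cs" if "bs = us @ vs" for us vs
    using cyc_rotate[of "concat us" "concat vs"] cB that by auto
  have dbs: "distinct bs" "\<And>b b'. b \<in> set bs \<Longrightarrow> b' \<in> set bs \<Longrightarrow> b \<noteq> b' \<Longrightarrow> set b \<inter> set b' = {}"
  proof -
    have "removeAll [] bs = bs" using bs(2) by (metis removeAll_id)
    then show "distinct bs" "\<And>b b'. b \<in> set bs \<Longrightarrow> b' \<in> set bs \<Longrightarrow> b \<noteq> b' \<Longrightarrow> set b \<inter> set b' = {}"
      using cB(4) unfolding distinct_concat_iff by metis+
  qed
  have setb: "set b = insert (hd b) (set (tl b))" if "b \<in> set bs" for b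
    using bs(2)[OF that] by (metis list.exhaust_sel list.simps(15))
  have hdB: "hd ` set bs = A"
  proof
    show "hd ` set bs \<subseteq> A" using bs(2) by blast
    show "A \<subseteq> hd ` set bs"
    proof
      fix a assume a: "a \<in> A"
      then obtain b where b: "b \<in> set bs" "a \<in> set b" using AV(2) cB(2) by auto
      then have "a = hd b" using bs(2)[OF b(1)] setb[OF b(1)] a by blast
      then show "a \<in> hd ` set bs" using b by blast
    qed
  qed
  have injhd: "inj_on hd (set bs)"
  proof (rule inj_onI)
    fix b b' assume b: "b \<in> set bs" "b' \<in> set bs" "hd b = hd b'"
    have "hd b \<in> set b" "hd b' \<in> set b'" using setb[OF b(1)] setb[OF b(2)] by blast+
    then show "b = b'" using dbs(2)[OF b(1,2)] b(3) by auto
  qed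
  have lenbs: "length bs = card A" using card_image[OF injhd] hdB distinct_card[OF dbs(1)] by simp
  have nxt: "\<exists>g\<in>A. adj (last b) g" if b: "b \<in> set bs" for b
  proof -
    obtain us vs where uv: "bs = us @ b # vs" using b by (meson split_list)
    have cy: "cyc (concat (vs @ us @ [b]))" using rotB(1)[of "us @ [b]" vs] uv by simp
    have bne: "b \<noteq> []" using bs(2) b by blast
    have "hd (concat (vs @ us @ [b])) \<in> A"
    proof -
      have all: "c \<noteq> [] \<and> hd c \<in> A" if "c \<in> set (vs @ us @ [b])" for c using that uv bs(2) by auto
      obtain c ds where c: "vs @ us @ [b] = c # ds" by (cases "vs @ us @ [b]") auto
      then have "c \<noteq> [] \<and> hd c \<in> A" using all by (metis list.set_intros(1))
      then show ?thesis unfolding c by (simp add: hd_append)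
    qed
    moreover have "last (concat (vs @ us @ [b])) = last b" using bne by simp
    ultimately show ?thesis using cy by (auto simp: cyc_def)
  qed
  have arrange: "\<exists>P Q. cyc (b @ P @ b' @ Q) \<and> length (b @ P @ b' @ Q) = length cs \<and> set (b @ P @ b' @ Q) = set cs \<and>
      hd (P @ b') \<in> A \<and> hd (Q @ b) \<in> A" if b: "b \<in> set bs" "b' \<in> set bs" "b \<noteq> b'" for b b'
  proof -
    obtain us vs where uv: "bs = us @ b # vs" using b by (meson split_list)
    have "b' \<in> set (vs @ us)" using b uv by auto
    then obtain X Y where XY: "vs @ us = X @ b' # Y" by (meson split_list)
    have "concat ((b # vs) @ us) = b @ concat X @ b' @ concat Y" using arg_cong[OF XY, of concat] by simp
    then have cy: "cyc (b @ concat X @ b' @ concat Y)" "length (b @ concat X @ b' @ concat Y) = length cs"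
      "set (b @ concat X @ b' @ concat Y) = set cs" using rotB[of us "b # vs"] uv by metis+
    have inbs: "set (vs @ us) \<subseteq> set bs" using uv by auto
    have hdX: "hd (concat Z @ c) \<in> A" if "set Z \<subseteq> set bs" "c \<in> set bs" for Z c
    proof (cases Z)
      case Nil then show ?thesis using bs(2) that by simp
    next
      case (Cons z zs)
      then show ?thesis using bs(2)[of z] that by (auto simp: hd_append)
    qed
    have "set X \<subseteq> set bs" "set Y \<subseteq> set bs" using inbs XY by auto
    then show ?thesis using cy hdX b(1,2) by blast
  qed
  \<comment> \<open>A block of one vertex would be followed at once by another neighbour of
    \<open>y\<close>, and \<open>y\<close> could be inserted between them.\<close>
  have len2: "2 \<le> length b" if b: "b \<in> set bs" for b
  proof (rule ccontr)
    assume "\<not> 2 \<le> length b"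
    then obtain h where h: "b = [h]" using bs(2)[OF b] by (cases b; cases "tl b") auto
    obtain us vs where uv: "bs = us @ b # vs" using b by (meson split_list)
    have cy: "cyc (concat (vs @ us @ [b]))" "set (concat (vs @ us @ [b])) = set cs" "length (concat (vs @ us @ [b])) = length cs"
      using rotB[of "us @ [b]" vs] uv by simp_all
    define zs where "zs = concat (vs @ us @ [b])"
    have "hd zs \<in> A"
    proof -
      have all: "c \<noteq> [] \<and> hd c \<in> A" if "c \<in> set (vs @ us @ [b])" for c using that uv bs(2) by auto
      obtain c ds where c: "vs @ us @ [b] = c # ds" by (cases "vs @ us @ [b]") auto
      then have "c \<noteq> [] \<and> hd c \<in> A" using all by (metis list.set_intros(1))
      then show ?thesis unfolding zs_def c by (simp add: hd_append)
    qed
    moreover have "last zs = h" using h by (simp add: zs_def)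
    moreover have "h \<in> A" using bs(2)[OF b] h by simp
    moreover have zne: "zs \<noteq> []" using cy(3) cs_pos unfolding zs_def[symmetric] by auto
    ultimately have "cyc (y # zs)"
      using cy yV by (auto simp: cyc_def pth_Cons zs_def A_def adj_commute)
    then show False by (rule no_longer_cycle) (use cy in \<open>simp add: zs_def\<close>)
  qed
  have muB: "2 \<le> length b \<and> adj (hd b) (mu (hd b))" if "b \<in> set bs" for b
    using len2[OF that] bs(2)[OF that] mu(2) by (auto simp: A_def)
  have muout: "mu a \<in> V" "mu a \<notin> set cs" "mu a \<noteq> y" "adj a (mu a)" if "a \<in> A" for a using mu(2,3) that by (auto simp: A_def)
  have muinj: "inj_on mu A" using mu(1) by (simp add: A_def)
  have XV: "set (concat us) \<union> mu ` hd ` set us \<subseteq> V" if "set us \<subseteq> set bs" for us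
  proof -
    have "set (concat us) \<subseteq> set (concat bs)" using that by auto
    moreover have "hd ` set us \<subseteq> A" using that hdB by blast
    ultimately show ?thesis using cB(2) pth_cs(3) muout(1) by blast
  qed
  have bp: "packs ks (set (concat us) \<union> mu ` hd ` set us)"
    if us: "pth (concat us)" "set us \<subseteq> set bs" "(\<Sum>l\<leftarrow>ks. l div 2) \<le> length us" "\<forall>l\<in>set ks. 2 \<le> l" for us ks
  proof (rule blocks_pack[OF us(1) _ _ _ us(3,4)])
    have hA: "hd ` set us \<subseteq> A" using us(2) hdB by blast
    show "inj_on mu (hd ` set us)" using muinj hA inj_on_subset by blast
    have "set (concat us) \<subseteq> set cs" using us(2) cB(2) by auto
    then show "mu ` hd ` set us \<inter> set (concat us) = {}" using hA muout(2) by blast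
  qed (use muB us(2) in blast)
  have l2: "\<forall>l\<in>set ls. 2 \<le> l" using ls(2) by blast
  \<comment> \<open>With d + 1 blocks \<open>blocks_pack\<close> would produce F.\<close>
  have cAd: "card A = d"
  proof (rule ccontr)
    assume "card A \<noteq> d"
    then have "d + 1 \<le> length bs" using dA lenbs by simp
    then have "packs ls (set (concat bs) \<union> mu ` hd ` set bs)"
      using bp[of bs ls] cB(1) ls(3) l2 by (simp add: cyc_def)
    then show False using packs_mono XV[of bs] free by blast
  qed
  have lbs: "length bs = d" using lenbs cAd by simp
  have cr: "length cs \<le> 2 * d + r"
  proof -
    have "V - set cs \<noteq> {}" using yV by blast
    then obtain ys where e: "ear (V - set cs) ys" using ear_exists[OF closedR_all] by blast
    then have "length cs + length ys \<le> 2 * d + 1 + r" by (intro ear_length) auto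
    moreover have "1 \<le> length ys" using earD(2)[OF e] by (cases ys) auto
    ultimately show ?thesis by linarith
  qed
  have concat_ge: "2 * length us \<le> length (concat us)" if "set us \<subseteq> set bs" for us
    using that
  proof (induction us)
    case (Cons b us) then show ?case using len2[of b] by simp
  qed simp
  \<comment> \<open>A block \<open>b\<close> of four or more vertices counts for two: an odd
    component on 2a + 1 vertices needs only \<open>b\<close>, the a - 2 blocks before it and one
    partner, and the remaining blocks suffice for the rest of F. An odd component exists because
    such a block forces r >= 2.\<close>
  have le3: "length b \<le> 3" if b: "b \<in> set bs" for b
  proof (rule ccontr)
    assume "\<not> length b \<le> 3"
    then have b4: "4 \<le> length b" by simp
    obtain us vs where uv: "bs = us @ b # vs" using b by (meson split_list)
    have "length (concat bs) = length (concat (us @ vs)) + length b" using uv by simp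
    moreover have "2 * length (us @ vs) \<le> length (concat (us @ vs))" using concat_ge[of "us @ vs"] uv by auto
    ultimately have "2 * d + 2 \<le> length cs" using cB(3) b4 lbs uv by simp
    then have "2 \<le> r" using cr by simp
    then have "filter odd ls \<noteq> []" using ls(4) by auto
    then obtain l where l: "l \<in> set ls" "odd l" by (metis filter_False)
    then obtain l1 l3 where ll: "ls = l1 @ l # l3" by (meson split_list)
    define a where "a = l div 2"
    have a2: "2 \<le> a" "l = 2 * a + 1" using l ls(2) by (auto simp: a_def elim!: oddE)
    have sum: "(\<Sum>l\<leftarrow>l1 @ l3. l div 2) + a = d + 1" using ls(3) ll by (simp add: a_def)
    define ws where "ws = vs @ us"
    have lw: "length ws + 1 = d" using lbs uv by (simp add: ws_def)
    define w1 where "w1 = take (d + 1 - a) ws"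
    define w2 where "w2 = drop (d + 1 - a) ws"
    have w12: "ws = w1 @ w2" by (simp add: w1_def w2_def)
    have lw1: "length w1 = d + 1 - a" "length w2 + 2 = a" using lw sum a2 by (auto simp: w1_def w2_def)
    have "cyc (concat (vs @ us @ [b]))" using rotB(1)[of "us @ [b]" vs] uv by simp
    moreover have "concat (vs @ us @ [b]) = concat w1 @ (concat w2 @ b)"
      using arg_cong[OF w12, of concat] by (simp add: ws_def)
    ultimately have "pth (concat w1 @ (concat w2 @ b))" unfolding cyc_def by metis
    then have pw: "pth (concat w1)" "pth (concat w2 @ b)" "set (concat w1) \<inter> set (concat w2 @ b) = {}"
      unfolding pth_append[of "concat w1"] by blast+
    have "set ws \<subseteq> set bs" using uv by (auto simp: ws_def)
    then have wsub: "set w1 \<subseteq> set bs" "set w2 \<subseteq> set bs" unfolding w12 by auto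
    define q where "q = concat (w2 @ [b])"
    have q: "pth q" "set (concat w1) \<inter> set q = {}" using pw by (auto simp: q_def)
    have lq: "2 * a \<le> length q" using concat_ge[OF wsub(2)] lw1 b4 by (simp add: q_def)
    have hq: "hd q \<in> hd ` set (w2 @ [b])"
    proof (cases w2)
      case Nil then show ?thesis by (simp add: q_def)
    next
      case (Cons z zs)
      then have "z \<noteq> []" using wsub bs(2) by auto
      then show ?thesis using Cons by (simp add: q_def hd_append)
    qed
    then have hqA: "hd q \<in> A" using hdB wsub b by auto
    have qcs: "set q \<subseteq> set cs" using wsub b cB(2) by (auto simp: q_def)
    have qne: "q \<noteq> []" using lq a2 by auto
    have pq: "pth (mu (hd q) # q)"
      using q(1) muout[OF hqA] qcs qne by (auto simp: pth_Cons adj_commute)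
    have "packs (l1 @ l3) (set (concat w1) \<union> mu ` hd ` set w1)"
      by (rule bp) (use pw wsub sum lw1 l2 ll in auto)
    then have "packs (l # l1 @ l3) V"
    proof (rule packs_Cons[OF pq _, rotated])
      have "hd q \<notin> hd ` set w1"
      proof
        assume "hd q \<in> hd ` set w1"
        then obtain z where z: "z \<in> set w1" "hd q = hd z" by blast
        have "hd z \<in> set z" using setb z(1) wsub(1) by blast
        then have "hd z \<in> set (concat w1)" using z(1) by auto
        moreover have "hd q \<in> set q" using qne by simp
        ultimately show False using q(2) z by auto
      qed
      then have "mu (hd q) \<notin> mu ` hd ` set w1"
        using inj_on_image_mem_iff[OF muinj hqA, of "hd ` set w1"] hdB wsub(1) by blast
      moreover have "mu (hd q) \<notin> set (concat w1)" using muout(2)[OF hqA] wsub(1) cB(2) by auto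
      moreover have "set q \<inter> mu ` hd ` set w1 = {}"
      proof -
        have "hd ` set w1 \<subseteq> A" using hdB wsub by blast
        then show ?thesis using qcs muout(2) by blast
      qed
      ultimately show "set (mu (hd q) # q) \<inter> (set (concat w1) \<union> mu ` hd ` set w1) = {}" using q(2) by auto
      show "l \<le> length (mu (hd q) # q)" using a2 lq by simp
      show "set (mu (hd q) # q) \<union> (set (concat w1) \<union> mu ` hd ` set w1) \<subseteq> V"
        using XV[OF wsub(1)] pq unfolding pth_def by blast
    qed
    then have "packs ls V" by (rule packs_perm[rotated]) (simp add: ll)
    then show False using free by blast
  qed
  define B2 where "B2 = filter (\<lambda>b. length b = 2) bs"
  define B3 where "B3 = filter (\<lambda>b. length b = 3) bs"
  define E where "E = length B3"
  have b23: "length b = 2 \<or> length b = 3" if "b \<in> set bs" for b using len2[OF that] le3[OF that] by linarith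
  have cnt: "length B2 + E = d" "length cs = 2 * length B2 + 3 * E"
  proof -
    have "length us = length (filter (\<lambda>b. length b = 2) us) + length (filter (\<lambda>b. length b = 3) us) \<and>
      length (concat us) = 2 * length (filter (\<lambda>b. length b = 2) us) + 3 * length (filter (\<lambda>b. length b = 3) us)"
      if "\<forall>b\<in>set us. length b = 2 \<or> length b = 3" for us :: "'a list list"
      using that by (induction us) auto
    then show "length B2 + E = d" "length cs = 2 * length B2 + 3 * E"
      using b23 lbs cB(3) unfolding B2_def B3_def E_def by metis+
  qed
  have Er: "E \<le> r" using cnt cr by linarith
  \<comment> \<open>The second vertices of the blocks of two; like \<open>y\<close> they will turn
    out to have the neighbourhood \<open>A\<close>, so they serve as common neighbours of all
    hubs.\<close>
  define M where "M = map (\<lambda>b. b ! 1) B2"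
  have lM: "length M + E = d" using cnt by (simp add: M_def)
  have nth1: "b ! 1 \<in> set b" "b ! 1 \<notin> A" "b ! 1 \<in> set cs" if "b \<in> set bs" for b
  proof -
    show in1: "b ! 1 \<in> set b" using len2[OF that] by simp
    have "b ! 1 \<in> set (tl b)" using len2[OF that] by (cases b; cases "tl b") auto
    then show "b ! 1 \<notin> A" using bs(2)[OF that] by blast
    show "b ! 1 \<in> set cs" using in1 that cB(2) by auto
  qed
  have dM: "distinct M"
  proof -
    have "inj_on (\<lambda>b. b ! 1) (set B2)"
    proof (rule inj_onI)
      fix b b' assume b: "b \<in> set B2" "b' \<in> set B2" "b ! 1 = b' ! 1"
      then have "b \<in> set bs" "b' \<in> set bs" by (auto simp: B2_def)
      then show "b = b'" using nth1(1)[of b] nth1(1)[of b'] dbs(2)[of b b'] b(3) by auto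
    qed
    then show ?thesis using dbs(1) by (simp add: M_def B2_def distinct_map)
  qed
  have Mprop: "m \<in> set cs" "m \<notin> A" "m \<in> V" if "m \<in> set M" for m
    using that nth1 pth_cs(3) by (auto simp: M_def B2_def)
  have nbM: "nb m = A" if m: "m \<in> set M" for m
  proof (rule card_subset_eq[OF AV(3)])
    obtain b where b: "b \<in> set bs" "length b = 2" "m = b ! 1" using m by (auto simp: M_def B2_def)
    then obtain h where bh: "b = [h, m]" by (auto simp: length_eq_2_or_3)
    have hA: "h \<in> A" using bs(2)[OF b(1)] bh by simp
    show "nb m \<subseteq> A"
    proof
      fix x assume x: "x \<in> nb m"
      show "x \<in> A"
      proof (rule ccontr)
        assume xA: "x \<notin> A"
        show False
        proof (cases "x \<in> set cs")
          case True
          then obtain b' where b': "b' \<in> set bs" "x \<in> set b'" using cB(2) by auto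
          have xm: "x \<noteq> m" using x adj_irrefl by auto
          have "x \<noteq> hd b'" using bs(2)[OF b'(1)] xA by blast
          \<comment> \<open>\<open>m\<close> is both second and last in its block, so
            \<open>x\<close>, which is second or last in its own, is excluded by
            \<open>succ_nonadj\<close> or \<open>pred_nonadj\<close>.\<close>
          then have "x = b' ! 1 \<or> x = last b'"
            using b'(2) b23[OF b'(1)] by (auto simp: length_eq_2_or_3)
          moreover have bb': "b' \<noteq> b"
          proof
            assume "b' = b"
            then show False using b'(2) bh xm xA hA by auto
          qed
          obtain P Q where PQ: "cyc (b @ P @ b' @ Q)" "length (b @ P @ b' @ Q) = length cs"
            "set (b @ P @ b' @ Q) = set cs" "hd (P @ b') \<in> A" "hd (Q @ b) \<in> A"
            using arrange[OF b(1) b'(1)] bb' by metis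
          moreover have "\<not> adj (b ! 1) (b' ! 1)"
            by (rule succ_nonadj[OF PQ(1,2) yV(1)]) (use PQ(3) yV bs(2)[OF b(1)] bs(2)[OF b'(1)] len2[OF b(1)] len2[OF b'(1)] in \<open>auto simp: A_def\<close>)
          moreover have "\<not> adj (last b) (last b')"
            by (rule pred_nonadj[OF PQ(1,2) yV(1)]) (use PQ(3-5) yV bs(2)[OF b(1)] bs(2)[OF b'(1)] in \<open>auto simp: A_def\<close>)
          moreover have "b ! 1 = m" "last b = m" "adj m x" using x bh by auto
          ultimately show False by metis
        next
          case False
          have xy: "x \<noteq> y" using x Mprop(2)[OF m] adj_sym by (auto simp: A_def)
          obtain us vs where uv: "bs = us @ b # vs" using b by (meson split_list)
          have cy: "cyc (concat (vs @ us @ [b]))" "set (concat (vs @ us @ [b])) = set cs" "length (concat (vs @ us @ [b])) = length cs"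
            using rotB[of "us @ [b]" vs] uv by simp_all
          \<comment> \<open>\<open>y\<close> takes the place of \<open>m\<close> in the cycle; then
            \<open>m\<close> and \<open>x\<close> would be adjacent off a cycle of the same
            length.\<close>
          define zs where "zs = concat (vs @ us) @ [h]"
          have zz: "cyc (zs @ [m])" "set (zs @ [m]) = set cs" "length (zs @ [m]) = length cs" using cy bh by (auto simp: zs_def)
          have hz: "hd zs \<in> A"
          proof -
            have all: "c \<noteq> [] \<and> hd c \<in> A" if "c \<in> set (vs @ us @ [b])" for c using that uv bs(2) by auto
            show ?thesis
            proof (cases "vs @ us")
              case Nil then show ?thesis using hA by (simp add: zs_def del: append_is_Nil_conv)
            next
              case (Cons c ds)
              then have "c \<in> set (vs @ us @ [b])" by (metis Un_iff append_assoc list.set_intros(1) set_append)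
              then have "c \<noteq> [] \<and> hd c \<in> A" by (rule all)
              then show ?thesis unfolding zs_def Cons by (simp add: hd_append)
            qed
          qed
          have "pth (zs @ [m])" using zz(1) by (simp add: cyc_def)
          then have pz: "pth zs" "zs \<noteq> []" "last zs = h" unfolding pth_append[of zs] by (auto simp: zs_def)
          have mz: "m \<notin> set zs" using zz(1) by (auto simp: cyc_def pth_def)
          have "cyc (zs @ [y])"
            using zz pz hz hA yV unfolding cyc_def by (auto simp: pth_append A_def adj_commute)
          moreover have "length (zs @ [y]) = length cs" using zz by simp
          moreover have "m \<notin> set (zs @ [y])" using mz Mprop(1)[OF m] yV by auto
          moreover have "x \<notin> set (zs @ [y])" using xy False zz(2) by auto
          ultimately have "\<not> adj m x" by (rule out)
          then show False using x by simp
        qed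
      qed
    qed
    then show "card (nb m) = card A" using deg[OF Mprop(3)[OF m]] cAd card_mono[OF AV(3)] by (metis le_antisym)
  qed
  obtain hs where hs: "set hs = A" "distinct hs" using AV(3) finite_distinct_list by blast
  have lhs: "length hs = d" using hs cAd distinct_card by metis
  have klen: "(\<Sum>l\<leftarrow>ks. l div 2 - 1) + length ks = (\<Sum>l\<leftarrow>ks. l div 2)" if "\<forall>l\<in>set ks. 2 \<le> l" for ks :: "nat list"
    using that by (induction ks) (auto simp: add.assoc)
  have rk: "r \<le> length ls" using ls(4) by auto
  have front: "\<exists>hs'. set hs' = A \<and> distinct hs' \<and> hs' \<noteq> [] \<and> hd hs' = g" if "g \<in> A" for g
  proof -
    have "set (g # remove1 g hs) = A" "distinct (g # remove1 g hs)" using hs that by (auto simp: set_remove1_eq)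
    then show ?thesis by (intro exI[of _ "g # remove1 g hs"]) simp
  qed
  have MA: "A \<inter> set M = {}" "y \<notin> set M" using Mprop yV by auto
  have fullM: "adj h x" if "h \<in> A" "x \<in> set M" for h x using nbM[OF that(2)] that(1) adj_sym by auto
  have fully: "adj h y" if "h \<in> A" for h using that adj_sym by (simp add: A_def)
  have block3: "\<exists>h t t'. b = [h, t, t'] \<and> h \<in> A \<and> t \<notin> A \<and> t' \<notin> A \<and> t \<noteq> t' \<and> adj h t \<and> adj t t' \<and> t \<in> set cs \<and> t' \<in> set cs \<and>
      t \<notin> set M \<and> t' \<notin> set M" if b: "b \<in> set B3" for b
  proof -
    have bb: "b \<in> set bs" "length b = 3" using b by (auto simp: B3_def)
    then obtain h t t' where bh: "b = [h, t, t']" by (auto simp: length_eq_2_or_3)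
    have "pth b"
    proof -
      obtain us vs where "bs = us @ b # vs" using bb by (meson split_list)
      then have "pth (concat us @ b @ concat vs)" using cB(1) by (simp add: cyc_def)
      then show ?thesis unfolding pth_append[of "concat us"] pth_append[of b] by blast
    qed
    then have "adj h t" "adj t t'" "t \<noteq> t'" using bh by (auto simp: pth_Cons)
    moreover have "h \<in> A" "t \<notin> A" "t' \<notin> A" using bs(2)[OF bb(1)] bh by auto
    moreover have "set b \<subseteq> set cs" using bb(1) cB(2) by auto
    then have tin: "t \<in> set cs" "t' \<in> set cs" using bh by auto
    moreover note tin
    moreover have "u \<notin> set M" if u: "u \<in> {t, t'}" for u
    proof
      assume "u \<in> set M"
      then have nu: "nb u = A" by (rule nbM)
      show False using u nu calculation adj_sym by auto
    qed
    ultimately show ?thesis using bh by blast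
  qed
  \<comment> \<open>A starting piece \<open>p0\<close>, followed by \<open>j\<close> hubs in the
    component of order \<open>l\<close>, must not complete F. By \<open>one\<close>, either
    \<open>y\<close> serves as a common neighbour, or at most one vertex of \<open>p0\<close> is off
    the cycle and \<open>y\<close> is free to replace a partner.\<close>
  have special: False
    if P: "pth p0" "p0 \<noteq> []" "set p0 \<inter> set M = {}"
      and H: "set hs' \<subseteq> A" "distinct hs'" "hs' \<noteq> [] \<longrightarrow> adj (last p0) (hd hs')" "set p0 \<inter> set hs' = {}"
      and X: "distinct xs" "set xs \<subseteq> insert y (set M)" "y \<in> set xs \<longrightarrow> set p0 \<subseteq> set cs \<union> A" "set p0 \<inter> set xs = {}" "y \<notin> set p0"
      and one: "y \<in> set xs \<or> (\<exists>x. set p0 \<subseteq> insert x (set cs))"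
      and L: "ls = l1 @ l # l3" "l = length p0 + 2 * j" "j \<le> length hs'"
        "(\<Sum>l\<leftarrow>l1 @ l3. l div 2) + j \<le> length hs'" "(\<Sum>l\<leftarrow>l1 @ l3. l div 2 - 1) + (j - 1) \<le> length xs"
    for p0 hs' xs l l1 l3 j
  proof -
    obtain nu where nu: "inj_on nu (set hs')" "\<And>h. h \<in> set hs' \<Longrightarrow> adj h (nu h)"
      "nu ` set hs' \<inter> (set hs' \<union> set xs) = {}" "nu ` set hs' \<inter> set p0 = {}"
    proof (cases "y \<in> set xs")
      case True
      have "inj_on mu (set hs')" using muinj H(1) inj_on_subset by blast
      moreover have "mu ` set hs' \<inter> (set hs' \<union> set xs) = {}"
      proof -
        have "mu h \<notin> set hs' \<union> set xs" if "h \<in> set hs'" for h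
          using muout[of h] that H(1) X(2) Mprop(1) AV(2) by blast
        then show ?thesis by blast
      qed
      moreover have "mu ` set hs' \<inter> set p0 = {}"
      proof -
        have "mu h \<notin> set p0" if "h \<in> set hs'" for h
          using muout[of h] that H(1) X(3) True AV(2) by blast
        then show ?thesis by blast
      qed
      ultimately show ?thesis using that[of mu] muout(4) H(1) by blast
    next
      case False
      then obtain x where x: "set p0 \<subseteq> insert x (set cs)" using one by blast
      \<comment> \<open>If \<open>p0\<close> uses up the outside vertex \<open>x\<close>, the hub
        whose partner it was takes the spare vertex \<open>y\<close>.\<close>
      define nu where "nu = (\<lambda>h. if mu h = x then y else mu h)"
      have "inj_on nu (set hs')"
      proof (rule inj_onI)
        fix a b assume ab: "a \<in> set hs'" "b \<in> set hs'" "nu a = nu b"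
        then have "a \<in> A" "b \<in> A" using H(1) by auto
        then show "a = b" using ab(3) muout(3)[of a] muout(3)[of b] muinj by (auto simp: nu_def inj_on_def split: if_splits)
      qed
      moreover have "adj h (nu h)" if "h \<in> set hs'" for h
        using muout(4)[of h] fully[of h] H(1) that by (auto simp: nu_def)
      moreover have "nu h \<notin> set hs' \<union> set xs \<and> nu h \<notin> set p0" if "h \<in> set hs'" for h
      proof -
        have hA: "h \<in> A" using that H(1) by blast
        have "nu h \<notin> set cs" using muout(2)[OF hA] yV by (simp add: nu_def)
        moreover have "set hs' \<subseteq> set cs" using H(1) AV(2) by blast
        moreover have "set xs \<subseteq> set cs" using X(2) False Mprop(1) by blast
        moreover have "nu h \<noteq> x \<or> nu h = y" by (simp add: nu_def)
        ultimately show ?thesis using x X(5) by blast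
      qed
      ultimately show ?thesis using that[of nu] by blast
    qed
    have "packs (l # l1 @ l3) V"
    proof (rule special_packs[OF H(2) X(1) _ _ _ nu(1,2,3) P(1,2) _ _ L(2,3) _ L(4,5)])
      show "set hs' \<inter> set xs = {}" using H(1) X(2) MA yV by blast
      show "set hs' \<union> set xs \<subseteq> V" using H(1) X(2) AV(1) Mprop(3) yV by blast
      show "adj h x" if "h \<in> set hs'" "x \<in> set xs" for h x using that H(1) X(2) fullM fully by blast
      show "set p0 \<inter> (set hs' \<union> set xs \<union> nu ` set hs') = {}" using H(4) X(4) nu(4) by blast
      show "adj (last p0) (hd hs')" if "hs' \<noteq> []" using H(3) that by blast
      show "\<forall>l\<in>set (l1 @ l3). 2 \<le> l \<and> l \<noteq> 3" using ls(2) L(1) by auto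
    qed
    then have "packs ls V" by (rule packs_perm[rotated]) (simp add: L(1))
    then show False using free by blast
  qed
  show ?thesis
  proof (cases "B3 = []")
    \<comment> \<open>Without blocks of three every vertex of the cycle is in \<open>A\<close> or in
      \<open>M\<close>, and the outside is independent.\<close>
    case True
    have "x \<in> A \<or> z \<in> A" if xz: "adj x z" for x z
    proof (rule ccontr)
      assume no: "\<not> ?thesis"
      have notM: "u \<notin> set M" if "adj u v" "v \<notin> A" for u v using nbM[of u] that by auto
      have "u \<notin> set cs" if "u \<notin> A" "u \<notin> set M" for u
      proof
        assume "u \<in> set cs"
        then obtain b where b: "b \<in> set bs" "u \<in> set b" using cB(2) by auto
        have "length b = 2" using b23[OF b(1)] b(1) True by (auto simp: B3_def filter_empty_conv)
        moreover from this have "u = b ! 1" using b(2) bs(2)[OF b(1)] \<open>u \<notin> A\<close> by (auto simp: length_eq_2_or_3)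
        ultimately show False using b(1) \<open>u \<notin> set M\<close> by (auto simp: M_def B2_def)
      qed
      then have "x \<notin> set cs" "z \<notin> set cs" using no notM[of x z] notM[of z x] xz adj_sym by blast+
      then show False using out[OF cs refl] xz by blast
    qed
    then show ?thesis using AV(1) cAd by blast
  next
    case False
    then obtain b where b: "b \<in> set B3" by (cases B3) auto
    have E1: "1 \<le> E" using False by (cases B3) (auto simp: E_def)
    obtain h t t' where bt: "b = [h, t, t']" "h \<in> A" "t \<notin> A" "t' \<notin> A" "t \<noteq> t'" "adj h t" "adj t t'" "t \<in> set cs" "t' \<in> set cs"
      "t \<notin> set M" "t' \<notin> set M" using block3[OF b] by blast
    \<comment> \<open>For l = 2a the piece t', t from a block of three, followed by a - 1 hubs
      beginning with \<open>h\<close>, replaces one hub, so that \<open>d\<close> hubs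
      suffice.\<close>
    have odd: "odd l" if l: "l \<in> set ls" for l
    proof (rule ccontr)
      assume "\<not> odd l"
      then obtain a where a: "l = 2 * a" by (auto elim!: evenE)
      obtain l1 l3 where ll: "ls = l1 @ l # l3" using l by (meson split_list)
      have a1: "1 \<le> a" using ls(2) l a by auto
      obtain hs' where hs': "set hs' = A" "distinct hs'" "hs' \<noteq> []" "hd hs' = h" using front[OF bt(2)] by blast
      have lh: "length hs' = d" using hs' cAd distinct_card by metis
      have sum: "(\<Sum>l\<leftarrow>l1 @ l3. l div 2) + a = d + 1" using ls(3) ll a by simp
      have sum1: "(\<Sum>l\<leftarrow>l1 @ l3. l div 2 - 1) + length (l1 @ l3) = (\<Sum>l\<leftarrow>l1 @ l3. l div 2)"
        by (rule klen) (use ls(2) ll in auto)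
      have ll': "length (l1 @ l3) + 1 = length ls" using ll by simp
      show False
      proof (rule special[of "[t', t]" hs' "y # M" l1 l l3 "a - 1"])
        show "pth [t', t]" using bt adj_sym pth_cs(3) by (auto simp: pth_Cons)
        show "(\<Sum>l\<leftarrow>l1 @ l3. l div 2) + (a - 1) \<le> length hs'" using sum lh a1 by linarith
        show "(\<Sum>l\<leftarrow>l1 @ l3. l div 2 - 1) + (a - 1 - 1) \<le> length (y # M)"
        proof -
          have "(\<Sum>l\<leftarrow>l1 @ l3. l div 2 - 1) + (a - 1 - 1) + length ls \<le> d + 1" using sum sum1 ll' a1 by linarith
          then show ?thesis using rk Er lM by simp
        qed
        show "l = length [t', t] + 2 * (a - 1)" using a a1 by simp
        show "a - 1 \<le> length hs'" using sum lh by linarith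
      qed (use bt hs' MA yV dM ll adj_sym in auto)
    qed
    have d3: "3 \<le> d"
    proof -
      have "filter odd ls = ls" using odd by (simp add: filter_id_conv)
      then have "length ls = r" using ls(4) by simp
      then show ?thesis using length_plus_odd_le_halves[OF ls(2)] ls(1,3,4) by simp
    qed
    have rlen: "length ls = r"
    proof -
      have "filter odd ls = ls" using odd by (simp add: filter_id_conv)
      then show ?thesis using ls(4) by simp
    qed
    obtain l l3 where ll: "ls = [] @ l # l3" using ls(1) by (cases ls) auto
    define a where "a = l div 2"
    have a2: "2 \<le> a" "l = 2 * a + 1" using odd[of l] ls(2) ll by (auto simp: a_def elim!: oddE)
    have sum: "(\<Sum>l\<leftarrow>[] @ l3. l div 2) + a = d + 1" using ls(3) ll by (simp add: a_def)
    have sum1: "(\<Sum>l\<leftarrow>[] @ l3. l div 2 - 1) + length l3 = (\<Sum>l\<leftarrow>[] @ l3. l div 2)"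
      using klen[of l3] ls(2) ll by auto
    have l3r: "length l3 + 1 = r" using rlen ll by simp
    \<comment> \<open>For l = 2a + 1 a start x, u, v without hubs is followed by a - 1 hubs, which
      again saves one.\<close>
    have piece: "False" if xu: "adj x u" "x \<notin> A" "x \<noteq> v" "u \<noteq> v" "u \<in> set cs" "v \<in> set cs" "u \<notin> A" "v \<notin> A" "u \<notin> set M" "v \<notin> set M"
      "adj u v" "adj v g" "g \<in> A" for x u v g
    proof -
      obtain hs' where hs': "set hs' = A" "distinct hs'" "hs' \<noteq> []" "hd hs' = g" using front[OF xu(13)] by blast
      have lh: "length hs' = d" using hs' cAd distinct_card by metis
      have xV: "x \<in> V" using xu adj_in by blast
      have xM: "x \<notin> set M" using nbM[of x] xu by auto
      have xy: "x \<noteq> y" using xu by (auto simp: A_def)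
      have xu': "x \<noteq> u" using xu adj_irrefl by auto
      show False
      proof (rule special[of "[x, u, v]" hs' M "[]" l l3 "a - 1"])
        show "pth [x, u, v]" using xu xV xu' pth_cs(3) by (auto simp: pth_Cons)
        show "(\<Sum>l\<leftarrow>[] @ l3. l div 2) + (a - 1) \<le> length hs'" using sum lh a2 by linarith
        show "(\<Sum>l\<leftarrow>[] @ l3. l div 2 - 1) + (a - 1 - 1) \<le> length M" using sum sum1 l3r a2 Er lM by linarith
        show "l = length [x, u, v] + 2 * (a - 1)" using a2 by simp
        show "a - 1 \<le> length hs'" using sum lh by linarith
      qed (use xu hs' MA yV dM ll xM xy in auto)
    qed
    have closed3: "(\<forall>x. adj x (b ! 1) \<longrightarrow> x \<in> A \<or> x = b ! 2) \<and> (\<forall>x. adj x (b ! 2) \<longrightarrow> x \<in> A \<or> x = b ! 1)"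
      if b: "b \<in> set B3" for b
    proof -
      obtain h t t' where bt: "b = [h, t, t']" "h \<in> A" "t \<notin> A" "t' \<notin> A" "t \<noteq> t'" "adj h t" "adj t t'" "t \<in> set cs" "t' \<in> set cs"
        "t \<notin> set M" "t' \<notin> set M" using block3[OF b] by blast
      obtain g where g: "g \<in> A" "adj (last b) g" using nxt[of b] b by (auto simp: B3_def)
      have g': "adj t' g" using g bt by simp
      have "x \<in> A \<or> x = t'" if "adj x t" for x
        using piece[of x t t' g] that bt g g' by blast
      moreover have "x \<in> A \<or> x = t" if "adj x t'" for x
        using piece[of x t' t h] that bt adj_sym by blast
      ultimately show ?thesis using bt by simp
    qed
    \<comment> \<open>Two blocks of three would give the piece t', t, g, s, s' on five vertices with
      the single hub \<open>g\<close>, to be followed by a - 2 further hubs.\<close>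
    have "B3 = [b]"
    proof (rule ccontr)
      assume "B3 \<noteq> [b]"
      moreover have dB3: "distinct B3" using dbs(1) by (simp add: B3_def)
      ultimately obtain b' where b': "b' \<in> set B3" "b' \<noteq> b"
        using b by (metis distinct.simps(2) distinct_singleton list.set_cases list.set_intros(1) list.set_intros(2) neq_Nil_conv)
      have E2: "2 \<le> E"
      proof -
        have "card {b, b'} \<le> card (set B3)" using b b' by (intro card_mono) auto
        then show ?thesis using b' card_length[of B3] by (simp add: E_def)
      qed
      obtain h2 s s' where bs': "b' = [h2, s, s']" "h2 \<in> A" "s \<notin> A" "s' \<notin> A" "s \<noteq> s'" "adj h2 s" "adj s s'" "s \<in> set cs" "s' \<in> set cs"
        "s \<notin> set M" "s' \<notin> set M" using block3[OF b'(1)] by blast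
      have dj: "set b \<inter> set b' = {}" using dbs(2)[of b b'] b b' by (auto simp: B3_def)
      have hub: "d \<le> Suc (card (nb u \<inter> A))" if u: "u \<in> V" "nb u \<subseteq> insert v A" for u v
      proof -
        have "nb u \<subseteq> insert v (nb u \<inter> A)" using u by blast
        then have "card (nb u) \<le> card (insert v (nb u \<inter> A))" by (intro card_mono) auto
        also have "\<dots> \<le> Suc (card (nb u \<inter> A))" by (rule card_insert_le_m1) auto
        finally show ?thesis using deg[OF u(1)] by linarith
      qed
      have csV: "t \<in> V" "t' \<in> V" "s \<in> V" "s' \<in> V" using bt bs' pth_cs(3) by auto
      have "nb u \<subseteq> insert v A" if "\<forall>x. adj x u \<longrightarrow> x \<in> A \<or> x = v" for u v
        using that adj_sym by (metis insert_iff nb_iff subsetI)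
      then have nbt: "nb t \<subseteq> insert t' A" "nb s \<subseteq> insert s' A" "nb s' \<subseteq> insert s A"
        using closed3[OF b] closed3[OF b'(1)] bt(1) bs'(1) by simp_all
      \<comment> \<open>Each of \<open>t\<close> and \<open>s\<close> has at least d - 1 neighbours
        in \<open>A\<close>, and 2(d - 1) > d since d >= 3.\<close>
      have "nb t \<inter> nb s \<inter> A \<noteq> {}"
      proof
        assume e: "nb t \<inter> nb s \<inter> A = {}"
        have "card (nb t \<inter> A) + card (nb s \<inter> A) = card ((nb t \<inter> A) \<union> (nb s \<inter> A))"
          using e AV(3) by (intro card_Un_disjoint[symmetric]) auto
        also have "\<dots> \<le> card A" using AV(3) by (intro card_mono) auto
        finally show False using hub[OF csV(1) nbt(1)] hub[OF csV(3) nbt(2)] cAd d3 by linarith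
      qed
      then obtain g where g: "adj t g" "adj s g" "g \<in> A" by auto
      \<comment> \<open>The path has to continue from \<open>s'\<close> to a hub other than
        \<open>g\<close>.\<close>
      have "\<not> nb s' \<inter> A \<subseteq> {g}"
      proof
        assume "nb s' \<inter> A \<subseteq> {g}"
        then have "card (nb s' \<inter> A) \<le> card {g}" by (intro card_mono) auto
        then show False using hub[OF csV(4) nbt(3)] d3 by simp
      qed
      then obtain g2 where "g2 \<in> nb s' \<inter> A" "g2 \<noteq> g" by blast
      then have g2: "adj s' g2" "g2 \<in> A" "g2 \<noteq> g" by auto
      obtain hs0 where hs0: "set hs0 = A" "distinct hs0" "hs0 \<noteq> []" "hd hs0 = g2" using front[OF g2(2)] by blast
      define hs' where "hs' = remove1 g hs0"
      have "length hs0 = d" using hs0 cAd distinct_card by metis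
      then have lh: "length hs' + 1 = d" using hs0 g(3) d3 by (auto simp: hs'_def length_remove1)
      have sh: "set hs' = A - {g}" "distinct hs'" using hs0 by (auto simp: hs'_def set_remove1_eq)
      have hh: "hd hs' = g2" using hs0 g2(3) by (cases hs0) (auto simp: hs'_def)
      show False
      proof (rule special[of "[t', t, g, s, s']" hs' M "[]" l l3 "a - 2"])
        show "pth [t', t, g, s, s']"
          using bt bs' g dj csV AV(1) adj_sym by (auto simp: pth_Cons)
        show "(\<Sum>l\<leftarrow>[] @ l3. l div 2) + (a - 2) \<le> length hs'" using sum lh a2 by linarith
        show "(\<Sum>l\<leftarrow>[] @ l3. l div 2 - 1) + (a - 2 - 1) \<le> length M" using sum sum1 l3r a2 Er lM by linarith
        show "l = length [t', t, g, s, s'] + 2 * (a - 2)" using a2 by simp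
        show "a - 2 \<le> length hs'" using sum lh by linarith
        show "y \<in> set M \<or> (\<exists>x. set [t', t, g, s, s'] \<subseteq> insert x (set cs))" using bt bs' g AV(2) by auto
      qed (use bt bs' g g2 sh hh MA yV dM ll AV(2) in auto)
    qed
    then have B3b: "set B3 = {b}" by simp
    have "x \<in> A \<or> z \<in> A \<or> {x, z} = {t, t'}" if xz: "adj x z" for x z
    proof (rule ccontr)
      assume no: "\<not> ?thesis"
      have notM: "u \<notin> set M" if "adj u v" "v \<notin> A" for u v using nbM[of u] that by auto
      have ut: "u = t \<or> u = t'" if u: "u \<notin> A" "u \<notin> set M" "u \<in> set cs" for u
      proof -
        obtain c where c: "c \<in> set bs" "u \<in> set c" using cB(2) u(3) by auto
        show ?thesis
        proof (cases "length c = 3")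
          case True
          then have "c = b" using c B3b by (auto simp: B3_def)
          then show ?thesis using c(2) bt(1,2) u(1) by auto
        next
          case False
          then have "length c = 2" using b23[OF c(1)] by simp
          moreover from this have "u = c ! 1" using c(2) bs(2)[OF c(1)] u(1) by (auto simp: length_eq_2_or_3)
          ultimately show ?thesis using c(1) u(2) by (auto simp: M_def B2_def)
        qed
      qed
      have nM: "x \<notin> set M" "z \<notin> set M" using notM[of x z] notM[of z x] no xz adj_sym by blast+
      have cl: "(\<forall>x. adj x t \<longrightarrow> x \<in> A \<or> x = t') \<and> (\<forall>x. adj x t' \<longrightarrow> x \<in> A \<or> x = t)" using closed3[OF b] bt(1) by simp
      show False
      proof (cases "x \<in> set cs")
        case True
        then have "x = t \<or> x = t'" using ut nM no by blast
        then show False using cl xz no adj_sym by blast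
      next
        case xc: False
        show False
        proof (cases "z \<in> set cs")
          case True
          then have "z = t \<or> z = t'" using ut nM no by blast
          then show False using cl xz no by blast
        next
          case False then show False using out[OF cs refl xc] xz by blast
        qed
      qed
    qed
    moreover have "t \<in> V - A" "t' \<in> V - A" using bt pth_cs(3) by auto
    ultimately have "\<exists>t\<in>V - A. \<exists>t'\<in>V - A. t \<noteq> t' \<and> (\<forall>x y. adj x y \<longrightarrow> x \<in> A \<or> y \<in> A \<or> {x, y} = {t, t'})"
      using bt(5) by blast
    then show ?thesis using odd AV(1) cAd by blast
  qed
qed

end

section \<open>Embeddings into the extremal graphs\<close>

lemma doubleton_eq_image: "inj f \<Longrightarrow> {f a, f b} = f ` e \<longleftrightarrow> {a, b} = e"
  by (metis image_empty image_insert inj_image_eq_iff)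

lemmas doubleton_eq_Inl_Inr = doubleton_eq_image[OF inj_Inl] doubleton_eq_image[OF inj_Inr]

lemma join_edge_iff [simp]:
  "{Inl a, Inl b} \<in> edges (join G H) \<longleftrightarrow> {a, b} \<in> edges G"
  "{Inr c, Inr e} \<in> edges (join G H) \<longleftrightarrow> {c, e} \<in> edges H"
  "{Inl a, Inr c} \<in> edges (join G H) \<longleftrightarrow> a \<in> verts G \<and> c \<in> verts H"
  "{Inr c, Inl a} \<in> edges (join G H) \<longleftrightarrow> a \<in> verts G \<and> c \<in> verts H"
proof -
  show "{Inl a, Inl b} \<in> edges (join G H) \<longleftrightarrow> {a, b} \<in> edges G"
    "{Inr c, Inr e} \<in> edges (join G H) \<longleftrightarrow> {c, e} \<in> edges H"
    unfolding join_def disj_union_def by (auto simp: image_iff doubleton_eq_Inl_Inr doubleton_eq_iff)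
  have nl: "{Inl a, Inr c} \<noteq> Inl ` e1" "{Inl a, Inr c} \<noteq> Inr ` e2" for e1 :: "'a set" and e2 :: "'b set" by auto
  show lr: "{Inl a, Inr c} \<in> edges (join G H) \<longleftrightarrow> a \<in> verts G \<and> c \<in> verts H"
    unfolding join_def disj_union_def using nl by (auto simp: doubleton_eq_iff)
  show "{Inr c, Inl a} \<in> edges (join G H) \<longleftrightarrow> a \<in> verts G \<and> c \<in> verts H"
    using lr by (simp add: insert_commute)
qed

lemma disj_union_edge_iff [simp]:
  "{Inl a, Inl b} \<in> edges (disj_union G H) \<longleftrightarrow> {a, b} \<in> edges G"
  "{Inr c, Inr e} \<in> edges (disj_union G H) \<longleftrightarrow> {c, e} \<in> edges H"
  unfolding disj_union_def by (auto simp: image_iff doubleton_eq_Inl_Inr)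

lemma complete_edge_iff [simp]: "{a, b} \<in> edges (complete m) \<longleftrightarrow> a < m \<and> b < m \<and> a \<noteq> b"
  unfolding complete_def by (auto simp: doubleton_eq_iff)

lemma copies_edge_iff [simp]:
  "{(i, a), (j, b)} \<in> edges (copies t G) \<longleftrightarrow> i = j \<and> i < t \<and> {a, b} \<in> edges G"
proof
  assume "{(i, a), (j, b)} \<in> edges (copies t G)"
  then obtain k e where k: "{(i, a), (j, b)} = (\<lambda>x. (k, x)) ` e" "k < t" "e \<in> edges G" by (auto simp: copies_def)
  have "(i, a) \<in> (\<lambda>x. (k, x)) ` e" "(j, b) \<in> (\<lambda>x. (k, x)) ` e" using k(1) by blast+
  then have ij: "i = k" "j = k" by auto
  have "inj (\<lambda>x. (k, x))" by (simp add: inj_on_def)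
  from doubleton_eq_image[OF this, of a b e] have "{a, b} = e" using k(1) unfolding ij by (rule iffD1)
  then show "i = j \<and> i < t \<and> {a, b} \<in> edges G" using k ij by simp
next
  assume h: "i = j \<and> i < t \<and> {a, b} \<in> edges G"
  then have "{(i, a), (j, b)} = (\<lambda>x. (i, x)) ` {a, b}" by auto
  then show "{(i, a), (j, b)} \<in> edges (copies t G)" using h unfolding copies_def snd_conv by blast
qed

lemma verts_simps [simp]:
  "verts (join G H) = Inl ` verts G \<union> Inr ` verts H" "verts (disj_union G H) = Inl ` verts G \<union> Inr ` verts H"
  "verts (complete m) = {0..<m}" "verts (edgeless m) = {0..<m}" "verts (copies t G) = {0..<t} \<times> verts G"
  by (auto simp: join_def disj_union_def complete_def edgeless_def copies_def)

lemma subgraph_iso_GF_even: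
  assumes "sgraph G" "A \<subseteq> verts G" "card A = delta_F ls" "card (verts G) = n"
    and cover: "\<And>x y. {x, y} \<in> edges G \<Longrightarrow> x \<in> A \<or> y \<in> A"
  shows "subgraph_iso G (GF_even ls n)"
proof -
  interpret graph "verts G" "\<lambda>x y. {x, y} \<in> edges G" by (rule graph_of_sgraph[OF assms(1)])
  have finA: "finite A" using assms(2) fin finite_subset by blast
  obtain al where al: "bij_betw al A {0..<delta_F ls}" using ex_bij_betw_finite_nat[OF finA] assms(3) by auto
  have "card (verts G - A) = n - delta_F ls" using assms(2-4) finA by (simp add: card_Diff_subset)
  then obtain be where be: "bij_betw be (verts G - A) {0..<n - delta_F ls}"
    using ex_bij_betw_finite_nat[of "verts G - A"] fin by auto
  define f where "f = (\<lambda>x. if x \<in> A then Inl (al x) else Inr (be x))"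
  have al': "al x < delta_F ls" if "x \<in> A" for x using al that by (auto simp: bij_betw_def)
  have be': "be x < n - delta_F ls" if "x \<in> verts G - A" for x using be that by (auto simp: bij_betw_def)
  have al_inj: "al x = al y \<longleftrightarrow> x = y" if "x \<in> A" "y \<in> A" for x y using al that by (auto simp: bij_betw_def inj_on_def)
  have "inj_on f (verts G)"
    using al be by (auto simp: f_def inj_on_def bij_betw_def)
  moreover have "f ` verts G \<subseteq> verts (GF_even ls n)" using al' be' by (auto simp: f_def GF_even_def)
  moreover have "{f u, f v} \<in> edges (GF_even ls n)" if uv: "u \<in> verts G" "v \<in> verts G" "{u, v} \<in> edges G" for u v
  proof -
    have "u \<noteq> v" using adj_irrefl uv by blast
    then show ?thesis using cover[OF uv(3)] uv al' be' al_inj by (auto simp: f_def GF_even_def)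
  qed
  ultimately show ?thesis unfolding subgraph_iso_def by blast
qed

lemma subgraph_iso_GF_odd:
  assumes "sgraph G" "A \<subseteq> verts G" "card A = delta_F ls" "card (verts G) = n"
    and t: "t \<in> verts G - A" "t' \<in> verts G - A" "t \<noteq> t'"
    and cover: "\<And>x y. {x, y} \<in> edges G \<Longrightarrow> x \<in> A \<or> y \<in> A \<or> {x, y} = {t, t'}"
  shows "subgraph_iso G (GF_odd ls n)"
proof -
  interpret graph "verts G" "\<lambda>x y. {x, y} \<in> edges G" by (rule graph_of_sgraph[OF assms(1)])
  have finA: "finite A" using assms(2) fin finite_subset by blast
  obtain al where al: "bij_betw al A {0..<delta_F ls}" using ex_bij_betw_finite_nat[OF finA] assms(3) by auto
  define B where "B = verts G - A - {t, t'}"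
  have "card (verts G - A) = n - delta_F ls" using assms(2-4) finA by (simp add: card_Diff_subset)
  then have "card B = n - delta_F ls - 2" using t fin unfolding B_def by (subst card_Diff_subset) auto
  then obtain be where be: "bij_betw be B {0..<n - delta_F ls - 2}"
    using ex_bij_betw_finite_nat[of B] fin by (auto simp: B_def)
  define f :: "'a \<Rightarrow> nat + (nat + nat)" where
    "f = (\<lambda>x. if x \<in> A then Inl (al x) else if x = t then Inr (Inr 0) else if x = t' then Inr (Inr 1) else Inr (Inl (be x)))"
  have al': "al x < delta_F ls" if "x \<in> A" for x using al that by (auto simp: bij_betw_def)
  have be': "be x < n - delta_F ls - 2" if "x \<in> B" for x using be that by (auto simp: bij_betw_def)
  have al_inj: "al x = al y \<longleftrightarrow> x = y" if "x \<in> A" "y \<in> A" for x y using al that by (auto simp: bij_betw_def inj_on_def)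
  have be_inj: "be x = be y \<longleftrightarrow> x = y" if "x \<in> B" "y \<in> B" for x y using be that by (auto simp: bij_betw_def inj_on_def)
  have BI: "x \<in> B" if "x \<in> verts G" "x \<notin> A" "x \<noteq> t" "x \<noteq> t'" for x using that by (simp add: B_def)
  have "inj_on f (verts G)"
  proof (rule inj_onI)
    fix x y assume xy: "x \<in> verts G" "y \<in> verts G" "f x = f y"
    then show "x = y" using al_inj[of x y] be_inj[OF BI BI, of x y] by (auto simp: f_def split: if_splits)
  qed
  moreover have fV: "f x \<in> verts (GF_odd ls n)" if "x \<in> verts G" for x
    using al' be'[OF BI[OF that]] that by (auto simp: f_def GF_odd_def)
  moreover have "{f u, f v} \<in> edges (GF_odd ls n)" if uv: "u \<in> verts G" "v \<in> verts G" "{u, v} \<in> edges G" for u v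
  proof -
    have ne: "u \<noteq> v" using adj_irrefl uv by blast
    consider "u \<in> A" "v \<in> A" | "u \<in> A" "v \<notin> A" | "u \<notin> A" "v \<in> A" | "u \<notin> A" "v \<notin> A" by blast
    then show ?thesis
    proof cases
      case 1 then show ?thesis using ne al' al_inj by (auto simp: f_def GF_odd_def)
    next
      case 2
      have fu: "f u = Inl (al u)" using 2 by (simp add: f_def)
      have "\<exists>w. f v = Inr w" using 2 by (simp add: f_def)
      then obtain w where w: "f v = Inr w" by blast
      show ?thesis using fV[OF uv(2)] al'[OF 2(1)] unfolding fu w GF_odd_def by auto
    next
      case 3
      have fv: "f v = Inl (al v)" using 3 by (simp add: f_def)
      have "\<exists>w. f u = Inr w" using 3 by (simp add: f_def)
      then obtain w where w: "f u = Inr w" by blast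
      show ?thesis using fV[OF uv(1)] al'[OF 3(2)] unfolding fv w GF_odd_def by auto
    next
      case 4
      then have "{u, v} = {t, t'}" using cover[OF uv(3)] by blast
      then have "u = t \<and> v = t' \<or> u = t' \<and> v = t" by (auto simp: doubleton_eq_iff)
      then show ?thesis using t by (auto simp: f_def GF_odd_def)
    qed
  qed
  ultimately show ?thesis unfolding subgraph_iso_def by blast
qed

text \<open>Covers all exceptions of the form J + tK_s, with \<open>S\<close> as the vertices of J.
  The clique of an outside vertex \<open>x\<close> is recovered as \<open>C x\<close>, the vertex
  with its neighbours outside \<open>S\<close>, and t is the number of different sets
  \<open>C x\<close>.\<close>

lemma graph_iso_join_copies:
  fixes G :: "'a sgraph" and J :: "nat sgraph"
  assumes G: "sgraph G" and S: "S \<subseteq> verts G" and s: "1 \<le> s"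
    and g: "bij_betw g S (verts J)" "\<And>u v. u \<in> S \<Longrightarrow> v \<in> S \<Longrightarrow> {u, v} \<in> edges G \<longleftrightarrow> {g u, g v} \<in> edges J"
    and K: "\<And>x. x \<in> verts G - S \<Longrightarrow> \<exists>K. x \<in> K \<and> K \<subseteq> verts G - S \<and> card K = s \<and> (\<forall>y\<in>K. {z. {y, z} \<in> edges G} = (K - {y}) \<union> S)"
  shows "\<exists>t. graph_iso G (join J (copies t (complete s)))"
proof -
  interpret graph "verts G" "\<lambda>x y. {x, y} \<in> edges G" by (rule graph_of_sgraph[OF G])
  have nbe: "nb y = {z. {y, z} \<in> edges G}" for y by (auto simp: nb_def)
  define C where "C = (\<lambda>x. insert x (nb x - S))"
  have Ceq: "C y = L" if "y \<in> L" "L \<subseteq> verts G - S" "\<forall>y\<in>L. {z. {y, z} \<in> edges G} = (L - {y}) \<union> S" for y L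
    using that by (auto simp: C_def nbe)
  have CK: "x \<in> C x" "C x \<subseteq> verts G - S" "card (C x) = s" "\<And>y. y \<in> C x \<Longrightarrow> nb y = (C x - {y}) \<union> S"
    "\<And>y. y \<in> C x \<Longrightarrow> C y = C x" if x: "x \<in> verts G - S" for x
  proof -
    obtain L where L: "x \<in> L" "L \<subseteq> verts G - S" "card L = s" "\<forall>y\<in>L. {z. {y, z} \<in> edges G} = (L - {y}) \<union> S"
      using K[OF x] by blast
    have CL: "C y = L" if "y \<in> L" for y using Ceq[OF that L(2,4)] .
    show "x \<in> C x" "C x \<subseteq> verts G - S" "card (C x) = s" using CL[OF L(1)] L by auto
    show "nb y = (C x - {y}) \<union> S" if "y \<in> C x" for y using that CL[OF L(1)] L(4) nbe by simp
    show "C y = C x" if "y \<in> C x" for y using that CL L(1) by simp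
  qed
  have finC: "finite (C ` (verts G - S))" using fin by simp
  define t where "t = card (C ` (verts G - S))"
  obtain idx where idx: "bij_betw idx (C ` (verts G - S)) {0..<t}"
    using ex_bij_betw_finite_nat[OF finC] by (auto simp: t_def)
  have "\<forall>L\<in>C ` (verts G - S). \<exists>p. bij_betw p L {0..<s}"
  proof
    fix L assume "L \<in> C ` (verts G - S)"
    then have "card L = s" using CK(3) by auto
    moreover from this have "finite L" using s by (metis card.infinite not_one_le_zero)
    ultimately show "\<exists>p. bij_betw p L {0..<s}" using ex_bij_betw_finite_nat[of L] by auto
  qed
  then obtain pos where pos: "\<And>L. L \<in> C ` (verts G - S) \<Longrightarrow> bij_betw (pos L) L {0..<s}" by (metis (full_types))
  define f :: "'a \<Rightarrow> nat + nat \<times> nat" where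
    "f = (\<lambda>x. if x \<in> S then Inl (g x) else Inr (idx (C x), pos (C x) x))"
  have posx: "pos (C x) x < s" "idx (C x) < t" if "x \<in> verts G - S" for x
    using pos[of "C x"] idx CK(1)[OF that] that by (auto simp: bij_betw_def)
  have idx_inj: "idx (C x) = idx (C y) \<longleftrightarrow> C x = C y" if "x \<in> verts G - S" "y \<in> verts G - S" for x y
    using idx that by (auto simp: bij_betw_def inj_on_def)
  have pos_inj: "pos (C x) x = pos (C x) y \<longleftrightarrow> x = y" if "x \<in> verts G - S" "y \<in> C x" for x y
    using pos[of "C x"] CK(1)[OF that(1)] that by (auto simp: bij_betw_def inj_on_def)
  have gin: "g x \<in> verts J" if "x \<in> S" for x using g(1) that by (auto simp: bij_betw_def)
  have ginj: "g x = g y \<longleftrightarrow> x = y" if "x \<in> S" "y \<in> S" for x y using g(1) that by (auto simp: bij_betw_def inj_on_def)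
  have "bij_betw f (verts G) (verts (join J (copies t (complete s))))"
    unfolding bij_betw_def
  proof
    show "inj_on f (verts G)"
    proof (rule inj_onI)
      fix x y assume xy: "x \<in> verts G" "y \<in> verts G" "f x = f y"
      show "x = y"
      proof (cases "x \<in> S")
        case True then show ?thesis using xy ginj by (auto simp: f_def split: if_splits)
      next
        case False
        then have yS: "y \<notin> S" using xy by (auto simp: f_def split: if_splits)
        have "idx (C x) = idx (C y)" "pos (C x) x = pos (C y) y" using xy(3) False yS by (auto simp: f_def)
        then have "C x = C y" "pos (C x) x = pos (C x) y" using idx_inj[of x y] xy False yS by auto
        moreover have "y \<in> C x" using CK(1)[of y] xy yS calculation(1) by auto
        ultimately show ?thesis using pos_inj[of x y] xy False by auto
      qed
    qed
    show "f ` verts G = verts (join J (copies t (complete s)))"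
    proof
      show "f ` verts G \<subseteq> verts (join J (copies t (complete s)))"
        using gin posx by (auto simp: f_def)
      show "verts (join J (copies t (complete s))) \<subseteq> f ` verts G"
      proof
        fix w assume w: "w \<in> verts (join J (copies t (complete s)))"
        then consider (l) a where "w = Inl a" "a \<in> verts J" | (r) i p where "w = Inr (i, p)" "i < t" "p < s" by auto
        then show "w \<in> f ` verts G"
        proof cases
          case l
          then have "a \<in> g ` S" using g(1) by (simp add: bij_betw_def)
          then obtain x where "x \<in> S" "g x = a" by blast
          then show ?thesis using l S by (intro image_eqI[of _ _ x]) (auto simp: f_def)
        next
          case r
          have "i \<in> idx ` C ` (verts G - S)" using idx r(2) by (simp add: bij_betw_def)
          then obtain L where L: "L \<in> C ` (verts G - S)" "idx L = i" by blast
          have "p \<in> pos L ` L" using pos[OF L(1)] r(3) by (simp add: bij_betw_def)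
          then obtain x where x: "x \<in> L" "pos L x = p" by blast
          obtain z where z: "z \<in> verts G - S" "L = C z" using L(1) by blast
          have "x \<in> verts G - S" "C x = L" using CK(2)[OF z(1)] CK(5)[OF z(1)] x z by auto
          then show ?thesis using r L x by (intro image_eqI[of _ _ x]) (auto simp: f_def)
        qed
      qed
    qed
  qed
  moreover have "{u, v} \<in> edges G \<longleftrightarrow> {f u, f v} \<in> edges (join J (copies t (complete s)))"
    if uv: "u \<in> verts G" "v \<in> verts G" for u v
  proof -
    have cross: "{a, b} \<in> edges G" if "a \<in> S" "b \<in> verts G - S" for a b
    proof -
      have "a \<in> nb b" using CK(4)[OF that(2) CK(1)[OF that(2)]] that(1) by blast
      then show ?thesis by (simp add: insert_commute)
    qed
    consider "u \<in> S" "v \<in> S" | "u \<in> S" "v \<notin> S" | "u \<notin> S" "v \<in> S" | "u \<notin> S" "v \<notin> S" by blast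
    then show ?thesis
    proof cases
      case 1 then show ?thesis using g(2) by (simp add: f_def)
    next
      case 2
      have "{u, v} \<in> edges G" using cross 2 uv by blast
      moreover have "{f u, f v} \<in> edges (join J (copies t (complete s)))"
        using 2 gin[OF 2(1)] posx[of v] uv by (simp add: f_def)
      ultimately show ?thesis by blast
    next
      case 3
      have "{u, v} \<in> edges G" using cross[of v u] 3 uv by (simp add: insert_commute)
      moreover have "{f u, f v} \<in> edges (join J (copies t (complete s)))"
        using 3 gin[OF 3(2)] posx[of u] uv by (simp add: f_def)
      ultimately show ?thesis by blast
    next
      case 4
      have u: "u \<in> verts G - S" and v: "v \<in> verts G - S" using 4 uv by auto
      have "{u, v} \<in> edges G \<longleftrightarrow> v \<in> C u \<and> v \<noteq> u"
        using CK(4)[OF u CK(1)[OF u]] 4 by (auto simp: nbe set_eq_iff)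
      also have "\<dots> \<longleftrightarrow> C u = C v \<and> u \<noteq> v" using CK(5)[OF u] CK(1)[OF v] by auto
      also have "\<dots> \<longleftrightarrow> idx (C u) = idx (C v) \<and> pos (C u) u \<noteq> pos (C v) v"
        using idx_inj[OF u v] pos_inj[OF u, of v] CK(1)[OF v] by auto
      also have "\<dots> \<longleftrightarrow> {f u, f v} \<in> edges (join J (copies t (complete s)))"
        using 4 posx[OF u] posx[OF v] by (auto simp: f_def)
      finally show ?thesis .
    qed
  qed
  ultimately show ?thesis unfolding graph_iso_def by blast
qed

text \<open>Each class \<open>C y\<close> has at most \<open>s\<close> vertices and fits into a copy
  of K_s of its own, so the second family of cliques is taken with no copies.\<close>

lemma subgraph_iso_join_small_components:
  fixes G :: "'a sgraph"
  assumes G: "sgraph G" and x: "x \<in> verts G"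
    and C: "\<And>y. y \<in> verts G - {x} \<Longrightarrow> y \<in> C y \<and> finite (C y) \<and> card (C y) \<le> s"
    and adjC: "\<And>y z. y \<in> verts G - {x} \<Longrightarrow> z \<in> verts G - {x} \<Longrightarrow> {y, z} \<in> edges G \<Longrightarrow> C y = C z"
  shows "\<exists>t. subgraph_iso G (join (complete 1) (disj_union (copies t (complete s)) (copies 0 (complete s'))))"
proof -
  interpret graph "verts G" "\<lambda>x y. {x, y} \<in> edges G" by (rule graph_of_sgraph[OF G])
  have finC: "finite (C ` (verts G - {x}))" using fin by simp
  define t where "t = card (C ` (verts G - {x}))"
  obtain idx where idx: "bij_betw idx (C ` (verts G - {x})) {0..<t}"
    using ex_bij_betw_finite_nat[OF finC] by (auto simp: t_def)
  have "\<forall>L\<in>C ` (verts G - {x}). \<exists>p. inj_on p L \<and> p ` L \<subseteq> {0..<s}"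
  proof
    fix L assume "L \<in> C ` (verts G - {x})"
    then have L: "finite L" "card L \<le> s" using C by auto
    then obtain p where "bij_betw p L {0..<card L}" using ex_bij_betw_finite_nat by blast
    then have "inj_on p L" "p ` L = {0..<card L}" by (auto simp: bij_betw_def)
    then show "\<exists>p. inj_on p L \<and> p ` L \<subseteq> {0..<s}" using L(2) by (intro exI[of _ p]) simp
  qed
  then obtain pos where pos: "\<And>L. L \<in> C ` (verts G - {x}) \<Longrightarrow> inj_on (pos L) L \<and> pos L ` L \<subseteq> {0..<s}" by (metis (full_types))
  define f :: "'a \<Rightarrow> nat + ((nat \<times> nat) + (nat \<times> nat))" where
    "f = (\<lambda>y. if y = x then Inl 0 else Inr (Inl (idx (C y), pos (C y) y)))"
  have posx: "pos (C y) y < s" "idx (C y) < t" if "y \<in> verts G - {x}" for y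
    using pos[of "C y"] idx C[OF that] that by (auto simp: bij_betw_def)
  have idx_inj: "idx (C y) = idx (C z) \<longleftrightarrow> C y = C z" if "y \<in> verts G - {x}" "z \<in> verts G - {x}" for y z
    using idx that by (auto simp: bij_betw_def inj_on_def)
  have pos_inj: "y = z" if "y \<in> verts G - {x}" "z \<in> verts G - {x}" "C y = C z" "pos (C y) y = pos (C z) z" for y z
  proof (rule inj_onD)
    show "inj_on (pos (C y)) (C y)" using pos that(1) by blast
    show "pos (C y) y = pos (C y) z" using that(3,4) by simp
    show "y \<in> C y" "z \<in> C y" using C[OF that(1)] C[OF that(2)] that(3) by auto
  qed
  let ?H = "join (complete 1) (disj_union (copies t (complete s)) (copies 0 (complete s')))"
  have "inj_on f (verts G)"
  proof (rule inj_onI)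
    fix y z assume "y \<in> verts G" "z \<in> verts G" "f y = f z"
    then show "y = z" using idx_inj[of y z] pos_inj[of y z] by (auto simp: f_def split: if_splits)
  qed
  moreover have "f ` verts G \<subseteq> verts ?H" using posx by (auto simp: f_def)
  moreover have "{f u, f v} \<in> edges ?H" if uv: "u \<in> verts G" "v \<in> verts G" "{u, v} \<in> edges G" for u v
  proof -
    have ne: "u \<noteq> v" using adj_irrefl uv by blast
    show ?thesis
    proof (cases "u = x \<or> v = x")
      case True then show ?thesis using ne posx[of u] posx[of v] uv by (auto simp: f_def)
    next
      case False
      then have "C u = C v" using adjC uv by blast
      moreover from this have "pos (C u) u \<noteq> pos (C v) v" using pos_inj[of u v] ne False uv by auto
      ultimately show ?thesis using False posx[of u] posx[of v] uv by (auto simp: f_def)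
    qed
  qed
  ultimately show ?thesis unfolding subgraph_iso_def by blast
qed

section \<open>Combination of the cases\<close>

text \<open>The question is whether any cycle of maximal length, not just \<open>cs\<close>, leaves
  an edge outside: only the negative answer for all of them supplies the hypothesis
  \<open>out\<close> of \<open>independent_complement\<close>.\<close>

theorem (in lcyc) long_cycle_structure:
  assumes ls: "2 \<le> length ls" "sorted_wrt (\<ge>) ls" "\<forall>l\<in>set ls. 2 \<le> l \<and> l \<noteq> 3"
      "(\<Sum>l\<leftarrow>ls. l div 2) = d + 1" "length (filter odd ls) = r"
    and free: "\<not> packs ls V"
  shows "(\<exists>A\<subseteq>V. card A = d \<and> (\<forall>x y. adj x y \<longrightarrow> x \<in> A \<or> y \<in> A)) \<or>
    ((\<forall>l\<in>set ls. odd l) \<and> (\<exists>A\<subseteq>V. card A = d \<and> (\<exists>t\<in>V - A. \<exists>t'\<in>V - A. t \<noteq> t' \<and>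
      (\<forall>x y. adj x y \<longrightarrow> x \<in> A \<or> y \<in> A \<or> {x, y} = {t, t'})))) \<or>
    (ls = [5, 5, 5] \<and> (\<exists>a b. a \<noteq> b \<and> a \<in> V \<and> b \<in> V \<and>
      (\<forall>x\<in>V - {a, b}. \<exists>K. x \<in> K \<and> K \<subseteq> V - {a, b} \<and> card K = 4 \<and> (\<forall>y\<in>K. nb y = (K - {y}) \<union> {a, b}))))"
proof (cases "\<exists>ds x y. cyc ds \<and> length ds = length cs \<and> x \<notin> set ds \<and> y \<notin> set ds \<and> adj x y")
  case False
  then have "\<And>ds x y. cyc ds \<Longrightarrow> length ds = length cs \<Longrightarrow> x \<notin> set ds \<Longrightarrow> y \<notin> set ds \<Longrightarrow> \<not> adj x y" by blast
  from independent_complement[OF ls(1,3,4,5) this free] show ?thesis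
    unfolding disj_assoc[symmetric] by (rule disjI1)
next
  case True
  then obtain ds x y where ds: "cyc ds" "length ds = length cs" and xy: "x \<notin> set ds" "y \<notin> set ds" "adj x y" by blast
  interpret L: lcyc V adj d ds r by (rule lcyc_same_length[OF ds])
  have x: "x \<in> V - set ds" using xy adj_in by blast
  then obtain ys where e: "L.ear (V - set ds) ys" using L.ear_exists[OF L.closedR_all] by blast
  have q2: "2 \<le> length ys"
  proof (rule ccontr)
    assume "\<not> 2 \<le> length ys"
    moreover have "length ys \<noteq> 0" using L.earD(2)[OF e] by simp
    ultimately have "length ys = 1" by linarith
    from L.ear_single[OF L.closedR_all e this x] show False using xy by auto
  qed
  have ex: "d = 5" "length ys = 4" using L.outside_edge_packs[OF ls e q2] free by blast+
  have r3: "r = 3" using L.ear_params(3)[OF L.closedR_all e q2] ex by (auto simp: L.sporadic_def)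
  have ls5: "ls = [5, 5, 5]" using small_forests(5)[OF ls(1-3)] ls(4,5) ex r3 by simp
  have "\<not> packs [5, 5, 5] V" using free ls5 by simp
  from L.exceptional_structure[OF ex(1) r3 e ex(2) this] have
    "\<exists>a b. a \<noteq> b \<and> a \<in> V \<and> b \<in> V \<and>
      (\<forall>x\<in>V - {a, b}. \<exists>K. x \<in> K \<and> K \<subseteq> V - {a, b} \<and> card K = 4 \<and> (\<forall>y\<in>K. nb y = (K - {y}) \<union> {a, b}))"
    unfolding L.good_K4_def .
  with ls5 show ?thesis by (intro disjI2 conjI)
qed

theorem mainTheorem3:
  fixes ls :: "nat list" and G :: "'a sgraph" and n :: nat
  assumes "length ls \<ge> 2"
    and "sorted_wrt (\<ge>) ls"
    and "\<forall>l\<in>set ls. l \<ge> 2 \<and> l \<noteq> 3"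
    and "sgraph G"
    and "free (linear_forest ls) G"
    and "connected_graph G"
    and "card (verts G) = n"
    and "n \<ge> 2 * size_F ls"
    and "\<forall>v\<in>verts G. degree G v \<ge> delta_F ls"
  shows "subgraph_of_GF G ls n
    \<or> (\<exists>l::nat. l \<ge> 2 \<and>
         ((even l \<and> ls \<in> {[l+1, l], [l, l]}) \<or>
          (odd l \<and> ls \<in> {[l+2, l], [l+1, l], [l, l, 2]})) \<and>
         (\<exists>t. graph_iso G (join (complete 1) (copies t (complete (l - 1))))))
    \<or> (\<exists>l::nat. l \<ge> 2 \<and> odd l \<and> ls = [l, l] \<and>
         (\<exists>t1 t2. subgraph_iso G (join (complete 1)
            (disj_union (copies t1 (complete (l - 1))) (copies t2 (complete (l - 2)))))))
    \<or> (ls = [5, 5, 5] \<and>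
         (\<exists>t. graph_iso G (join (complete 2) (copies t (complete 4)))
            \<or> graph_iso G (join (edgeless 2) (copies t (complete 4)))))"
proof -
  define d where "d = delta_F ls"
  define r where "r = length (filter odd ls)"
  have ls2: "\<forall>l\<in>set ls. 2 \<le> l \<and> l \<noteq> 3" using assms(3) by blast
  have half: "length ls + r \<le> (\<Sum>l\<leftarrow>ls. l div 2)" using length_plus_odd_le_halves[OF ls2] by (simp add: r_def)
  have sum: "(\<Sum>l\<leftarrow>ls. l div 2) = d + 1" using half assms(1) by (simp add: d_def delta_F_def)
  have "r \<le> length ls" by (simp add: r_def)
  then have dr: "1 \<le> d" "2 * r \<le> d + 1" "r < d" using half sum assms(1) by linarith+
  have tot: "sum_list ls = 2 * d + 2 + r" using sum_list_halves[of ls] sum by (simp add: r_def)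
  have card: "4 * d + 4 + 2 * r \<le> card (verts G)" using assms(7,8) tot by (simp add: size_F_def)
  interpret graph "verts G" "\<lambda>x y. {x, y} \<in> edges G" by (rule graph_of_sgraph[OF assms(4)])
  interpret mgraph "verts G" "\<lambda>x y. {x, y} \<in> edges G" d
  proof
    fix x assume x: "x \<in> verts G"
    have "nb x = {u \<in> verts G. {u, x} \<in> edges G}" using adj_in2 by (auto simp: nb_def insert_commute)
    then show "d \<le> card (nb x)" using assms(9) x by (simp add: degree_def d_def)
  next
    fix x y assume "x \<in> verts G" "y \<in> verts G"
    then show "(x, y) \<in> {(x, y). {x, y} \<in> edges G}\<^sup>*" using assms(6) by (simp add: connected_graph_def)
  qed (rule dr(1))
  have free: "\<not> packs ls (verts G)" using packs_imp_subgraph_iso[OF assms(4)] assms(5) by (auto simp: free_def)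
  have bound: "length p < 2 * d + 2 + r" if "pth p" for p
  proof (rule ccontr)
    assume "\<not> ?thesis"
    then have "packs ls (set p)" using packs_path[OF that, of ls] tot by simp
    then show False using packs_mono that free by (auto simp: pth_def)
  qed
  have nbe: "nb y = {z. {y, z} \<in> edges G}" for y by (auto simp: nb_def)
  show ?thesis
  proof (cases "\<exists>cs. cyc cs \<and> 2 * d \<le> length cs")
    case True
    then obtain cs0 where cs0: "cyc cs0" "2 * d \<le> length cs0" by blast
    have "\<forall>zs. cyc zs \<longrightarrow> length zs < Suc (card (verts G))" using pth_length_le by (simp add: cyc_def less_Suc_eq_le)
    from ex_has_greatest_nat[of cyc, OF cs0(1) this]
    obtain cs where cs: "cyc cs" "\<And>zs. cyc zs \<Longrightarrow> length zs \<le> length cs" by blast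
    interpret L: lcyc "verts G" "\<lambda>x y. {x, y} \<in> edges G" d cs r
      by unfold_locales (use cs cs0 bound dr card order_trans[OF cs0(2) cs(2)[OF cs0(1)]] in auto)
    consider (cover) A where "A \<subseteq> verts G" "card A = d" "\<forall>x y. {x, y} \<in> edges G \<longrightarrow> x \<in> A \<or> y \<in> A"
      | (odd) A t t' where "\<forall>l\<in>set ls. odd l" "A \<subseteq> verts G" "card A = d" "t \<in> verts G - A" "t' \<in> verts G - A" "t \<noteq> t'"
        "\<forall>x y. {x, y} \<in> edges G \<longrightarrow> x \<in> A \<or> y \<in> A \<or> {x, y} = {t, t'}"
      | (five) a b where "ls = [5, 5, 5]" "a \<noteq> b" "a \<in> verts G" "b \<in> verts G"
        "\<forall>x\<in>verts G - {a, b}. \<exists>K. x \<in> K \<and> K \<subseteq> verts G - {a, b} \<and> card K = 4 \<and> (\<forall>y\<in>K. nb y = (K - {y}) \<union> {a, b})"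
      using L.long_cycle_structure[OF assms(1,2) ls2 sum r_def[symmetric] free] by blast
    then show ?thesis
    proof cases
      case cover
      \<comment> \<open>If all components are odd, the target has an additional edge K_2; since
        \<open>A\<close> meets all edges, an arbitrary pair outside \<open>A\<close> can be mapped
        to it.\<close>
      have "card (verts G - A) = card (verts G) - d" using cover fin finite_subset by (metis card_Diff_subset)
      then have "2 \<le> card (verts G - A)" using card by linarith
      then obtain T where "T \<subseteq> verts G - A" "card T = 2" by (rule obtain_subset_with_card_n)
      then obtain t t' where t: "t \<in> verts G - A" "t' \<in> verts G - A" "t \<noteq> t'" by (auto simp: card_2_iff)
      have "subgraph_of_GF G ls n"
        using subgraph_iso_GF_even[OF assms(4) cover(1) _ assms(7), of ls]
          subgraph_iso_GF_odd[OF assms(4) cover(1) _ assms(7) t, of ls] cover(2,3)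
        unfolding subgraph_of_GF_def d_def by (metis (no_types))
      then show ?thesis by (rule disjI1)
    next
      case odd
      have "subgraph_of_GF G ls n"
        using subgraph_iso_GF_odd[OF assms(4) odd(2) _ assms(7) odd(4-6), of ls] odd(1,3,7)
        unfolding subgraph_of_GF_def d_def by auto
      then show ?thesis by (rule disjI1)
    next
      case five
      define f where "f = (\<lambda>x. if x = a then 0 else (1::nat))"
      have bij: "bij_betw f {a, b} {0..<2}"
      proof -
        have "{0..<2} = {0, 1::nat}" by auto
        then show ?thesis using five(2) by (auto simp: f_def bij_betw_def inj_on_def)
      qed
      have loop: "{x} \<notin> edges G" for x using adj_irrefl[of x] by simp
      have K: "\<exists>K. x \<in> K \<and> K \<subseteq> verts G - {a, b} \<and> card K = 4 \<and> (\<forall>y\<in>K. {z. {y, z} \<in> edges G} = (K - {y}) \<union> {a, b})"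
        if "x \<in> verts G - {a, b}" for x using five(5) that unfolding nbe by blast
      have ab: "{a, b} \<subseteq> verts G" using five by blast
      show ?thesis
      proof (cases "{a, b} \<in> edges G")
        case True
        have "\<exists>t. graph_iso G (join (complete 2) (copies t (complete 4)))"
          by (rule graph_iso_join_copies[OF assms(4) ab _ _ _ K, where g = f])
            (use bij True five(2) loop in \<open>auto simp: f_def insert_commute\<close>)
        with five(1) show ?thesis by (intro disjI2 conjI) blast+
      next
        case False
        have "\<exists>t. graph_iso G (join (edgeless 2) (copies t (complete 4)))"
          by (rule graph_iso_join_copies[OF assms(4) ab _ _ _ K, where g = f])
            (use bij False five(2) loop in \<open>auto simp: f_def edgeless_def insert_commute\<close>)
        with five(1) show ?thesis by (intro disjI2 conjI) blast+
      qed
    qed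
  next
    case False
    then have no_long: "length cs < 2 * d" if "cyc cs" for cs using that by (meson not_le)
    have alt: "spider d d (d + 1) \<or> (\<exists>v. clique_star v)"
      by (rule spider_or_clique_star[OF no_long bound dr(2)]) (use card in auto)
    obtain l1 l2 rest where l: "ls = l1 # l2 # rest" using assms(1) by (cases ls; cases "tl ls") auto
    have srt: "l2 \<le> l1" "\<forall>x\<in>set rest. x \<le> l2" using assms(2) l by auto
    \<comment> \<open>If the second component had at most \<open>d\<close> vertices, so would all
      later ones, and the spider or the clique star would contain F.\<close>
    have d2: "d + 1 \<le> l2"
    proof (rule ccontr)
      assume "\<not> d + 1 \<le> l2"
      then have "\<forall>x\<in>set (l2 # rest). x \<le> d" using srt(2) by fastforce
      then have "packs ls (verts G)"
        by (intro packs_of_spider_or_star[OF alt _ l sum ls2]) (use card in auto)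
      then show False using free by blast
    qed
    consider (eq) "(even l2 \<and> ls \<in> {[l2 + 1, l2], [l2, l2]}) \<or> (odd l2 \<and> ls \<in> {[l2 + 2, l2], [l2 + 1, l2], [l2, l2, 2]})" "d + 1 = l2"
      | (two) "odd l2" "ls = [l2, l2]" "d + 2 = l2"
      using two_long_paths_classification[OF l srt(1) ls2] sum d2 by auto
    then show ?thesis
    proof cases
      case eq
      have l2_ge: "2 \<le> l2" using eq(2) dr(1) by simp
      \<comment> \<open>A spider would hold the second component, on d + 1 vertices, in its longer
        leg and all others in the path on 2d + 1 vertices through the two other legs.\<close>
      have "\<not> spider d d (d + 1)"
      proof
        assume s: "spider d d (d + 1)"
        have "l2 \<noteq> 3" using ls2 l by simp
        then have "sum_list (l1 # rest) \<le> d + d + 1"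
          using eq l l2_ge by (auto simp: odd_pos elim!: oddE)
        then have "packs ((l1 # rest) @ [l2]) (verts G)" using s eq(2) by (intro spider_packs) auto
        then have "packs ls (verts G)" by (rule packs_perm[rotated]) (simp add: l)
        then show False using free by blast
      qed
      then obtain v where v: "clique_star v" using alt by blast
      have K: "\<exists>K. x \<in> K \<and> K \<subseteq> verts G - {v} \<and> card K = d \<and> (\<forall>y\<in>K. {z. {y, z} \<in> edges G} = (K - {y}) \<union> {v})"
        if "x \<in> verts G - {v}" for x
        using v that unfolding clique_star_def nbe by simp
      have loop: "{0} \<notin> edges (complete 1)" using complete_edge_iff[of 0 0 1] by simp
      have "\<exists>t. graph_iso G (join (complete 1) (copies t (complete d)))"
        by (rule graph_iso_join_copies[OF assms(4) _ dr(1) _ _ K, where g = "\<lambda>_. 0"])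
          (use v adj_irrefl loop in \<open>simp_all add: clique_star_def bij_betw_def\<close>)
      moreover have "d = l2 - 1" using eq(2) by simp
      ultimately show ?thesis using eq(1) l2_ge
        by (intro disjI2[OF disjI1[OF exI[of _ l2]]]) simp
    next
      case two
      \<comment> \<open>Here l = d + 2, so components of at most d + 1 vertices fit into copies of
        K_{l-1}; exception (2) is reached with t2 = 0.\<close>
      have "\<not> packs [d + 2, d + 2] (verts G)" using free two by simp
      moreover have "4 * d + 8 \<le> card (verts G)" using two(2) tot card two(3) by simp
      ultimately obtain x where x: "x \<in> verts G" "\<And>y. y \<in> verts G \<Longrightarrow> y \<noteq> x \<Longrightarrow> card (comp_avoiding x y) \<le> d + 1"
        using small_components[OF no_long] by blast
      have sub: "comp_avoiding x y \<subseteq> verts G" if "y \<in> verts G" "y \<noteq> x" for y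
        using comp_avoiding_closed[OF x(1) that] by (auto simp: closed_at_def)
      have "\<exists>t. subgraph_iso G (join (complete 1) (disj_union (copies t (complete (l2 - 1))) (copies 0 (complete (l2 - 2)))))"
      proof (rule subgraph_iso_join_small_components[OF assms(4) x(1)])
        fix y assume "y \<in> verts G - {x}"
        then show "y \<in> comp_avoiding x y \<and> finite (comp_avoiding x y) \<and> card (comp_avoiding x y) \<le> l2 - 1"
          using x(2)[of y] two(3) sub[of y] comp_avoiding_self finite_subset[OF _ fin] by auto
      next
        fix y z assume yz: "y \<in> verts G - {x}" "z \<in> verts G - {x}" "{y, z} \<in> edges G"
        then have "z \<in> comp_avoiding x y" unfolding comp_avoiding_def by auto
        then show "comp_avoiding x y = comp_avoiding x z"
          using comp_avoiding_eq_or_disjoint[OF x(1), of y z] comp_avoiding_self[of z x] yz by blast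
      qed
      moreover have "2 \<le> l2" using two(3) by simp
      ultimately have "\<exists>l::nat. l \<ge> 2 \<and> odd l \<and> ls = [l, l] \<and>
         (\<exists>t1 t2. subgraph_iso G (join (complete 1)
            (disj_union (copies t1 (complete (l - 1))) (copies t2 (complete (l - 2))))))"
        using two(1,2) by blast
      then show ?thesis by (intro disjI2[OF disjI2[OF disjI1]])
    qed
  qed
qed

end
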